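(* Assume that $\mathcal{D}(A)\subset\mathcal{D}(Q^{-1/2})$, $|(-A)^{1/2}Q^{1/2}|_{\mathcal{L}_2(H)}<\infty$ and $|Q^{-1/2}(-A)^{-1}|_{\mathcal{L}(H)}<\infty$. Assume that $F\colon H\to H$ is Fréchet differentiable and that there exist $L_F,L>0$ such that $|F(u)-F(v)|\le L_F|u-v|$ for $u,v\in H$, $|F(u)|_{\dot H^1}\le L(1+|u|_{\dot H^1})$ for $u\in\dot H^1$, and $|F'(u)v|_{\dot H^2}\le L(1+|u|_{\dot H^2}^2)|v|_{\dot H^2}$ for $u,v\in\dot H^2$. Assume moreover that $F(0)=0$ and $L_F<\lambda_1$. Then for any $n\in\mathbb{N}^+$, $\bar y\in H_n$, $\delta>0$ and $\gamma>0$, there exists $\varepsilon_0>0$ such that $$\mu^{\varepsilon,n}(\{y\in H_n:|y-\bar y|<\delta\})\ge\exp\Big(-\frac{V^n(\bar y)+\gamma}{\varepsilon^2}\Big),\quad 0<\varepsilon\le\varepsilon_0.$$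
   Context: $H:=L^2((0,1);\mathbb{R})$ with inner product $\langle\cdot,\cdot\rangle$ and norm $|\cdot|$; $\mathcal{L}(H)$ and $\mathcal{L}_2(H)$ are the bounded and the Hilbert–Schmidt operators on $H$. $A$ is the Dirichlet Laplacian on $(0,1)$, $\mathcal{D}(A)=H_0^1\cap H^2$; $e_i(\xi)=\sqrt2\sin(i\pi\xi)$ is an orthonormal basis of $H$ with $-Ae_i=\lambda_ie_i$, $\lambda_i=\pi^2i^2$. For $\gamma\in\mathbb{R}$, $\dot H^\gamma:=\mathcal{D}((-A)^{\gamma/2})$ with norm $|u|_{\dot H^\gamma}=|(-A)^{\gamma/2}u|$. $Q$ is a self-adjoint, positive definite bounded linear operator on $H$ with $Qe_i=q_ie_i$, $q_i>0$; $Q^{-1/2}\colon Q^{1/2}(H)\to H$ is the inverse of $Q^{1/2}$ and $\mathcal{D}(Q^{-1/2})=Q^{1/2}(H)$. $W(t)=\sum_i\beta_i(t)e_i$ is a cylindrical Wiener process, $\beta_i$ independent standard real Brownian motions. For $n\in\mathbb{N}^+$: $H_n:=\mathrm{span}\{e_1,\dots,e_n\}$, $P_n$ is the orthogonal projection of $H$ onto $H_n$, $A_n:=P_nA$ (on $H_n$), $F_n:=P_nF$, $Q_n^{1/2}:=P_nQ^{1/2}$, $W_n:=P_nW$. For $y\in H_n$, $\varepsilon>0$, $X_y^{\varepsilon,n}$ is the unique mild solution of $dX=(A_nX+F_n(X))dt+\varepsilon Q_n^{1/2}dW_n$, $X(0)=y$. The measure $\mu^{\varepsilon,n}$: the time averages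 $\mu_t^{\varepsilon,n}(B):=\frac1t\int_0^t\mathbb{P}(X_0^{\varepsilon,n}(s)\in B)ds$, $B\in\mathcal{B}(H_n)$, form a tight family, and for each $\varepsilon>0$, $\mu^{\varepsilon,n}$ denotes a weak limit of $\mu_{t_i}^{\varepsilon,n}$ along some sequence $t_i\uparrow+\infty$ (possibly depending on $\varepsilon$); by the Krylov–Bogoliubov theorem it is an invariant measure of the equation for $X^{\varepsilon,n}$. For $\psi\in L^2(0,T;H_n)$, $z_{0,y}^{n,\psi}$ is the unique mild solution of $\frac{dz}{dt}=A_nz+F_n(z)+Q_n^{1/2}\psi$ on $(0,T]$, $z(0)=y$; $I_{0,T}^{n,y}(z)=\tfrac12\inf\{|\psi|_{L^2(0,T;H)}^2:\psi\in L^2(0,T;H_n),\ z_{0,y}^{n,\psi}=z\}$ for $z\in C([0,T];H_n)$ ($\inf\emptyset=+\infty$); and $$V^n(v)=\inf\{I_{0,T}^{n,0}(z):T>0,\ z\in C([0,T];H_n),\ z(0)=0,\ z(T)=v\},\quad v\in H_n.$$ If $V^n(\bar y)=+\infty$ the right-hand side of the inequality is $0$. *)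

theory Defs
  imports "HOL-Probability.Probability"
begin

section \<open>The Hilbert space \<open>L\<^sup>2((0,1);\<real>)\<close>\<close>

abbreviation unit_leb :: "real measure" where
  "unit_leb \<equiv> lebesgue_on {0<..<1}"

definition square_integrable :: "(real \<Rightarrow> real) \<Rightarrow> bool" where
  "square_integrable f \<longleftrightarrow>
     f \<in> borel_measurable unit_leb \<and> integrable unit_leb (\<lambda>x. (f x)\<^sup>2)"

definition L2_eq :: "(real \<Rightarrow> real) \<Rightarrow> (real \<Rightarrow> real) \<Rightarrow> bool" where
  "L2_eq f g \<longleftrightarrow>
     square_integrable f \<and> square_integrable g \<and> (AE x in unit_leb. f x = g x)"

lemma square_integrable_mult:
  assumes "square_integrable f" "square_integrable g"
  shows "integrable unit_leb (\<lambda>x. f x * g x)"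
proof (rule Bochner_Integration.integrable_bound)
  show "integrable unit_leb (\<lambda>x. (f x)\<^sup>2 + (g x)\<^sup>2)"
    using assms by (auto simp: square_integrable_def)
  show "(\<lambda>x. f x * g x) \<in> borel_measurable unit_leb"
    using assms by (auto simp: square_integrable_def)
  have "\<bar>a * b\<bar> \<le> a\<^sup>2 + b\<^sup>2" for a b :: real
  proof -
    have "2 * (\<bar>a\<bar> * \<bar>b\<bar>) \<le> a\<^sup>2 + b\<^sup>2"
      using sum_squares_bound[of "\<bar>a\<bar>" "\<bar>b\<bar>"] by simp
    moreover have "0 \<le> \<bar>a\<bar> * \<bar>b\<bar>" by simp
    ultimately show ?thesis unfolding abs_mult by linarith
  qed
  then show "AE x in unit_leb. norm (f x * g x) \<le> norm ((f x)\<^sup>2 + (g x)\<^sup>2)"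
    by simp
qed

lemma square_integrable_zero: "square_integrable (\<lambda>x. 0)"
  by (simp add: square_integrable_def)

lemma square_integrable_scale:
  assumes "square_integrable f"
  shows "square_integrable (\<lambda>x. c * f x)"
  using assms by (auto simp: square_integrable_def power_mult_distrib)

lemma square_integrable_add:
  assumes "square_integrable f" "square_integrable g"
  shows "square_integrable (\<lambda>x. f x + g x)"
  using assms square_integrable_mult[OF assms]
  by (auto simp: square_integrable_def power2_sum mult.assoc)

quotient_type L2 = "real \<Rightarrow> real" / partial: L2_eq
proof (rule part_equivpI)
  show "\<exists>f. L2_eq f f"
    using square_integrable_zero by (auto simp: L2_eq_def)
  show "symp L2_eq" by (auto simp: symp_def L2_eq_def)
  show "transp L2_eq" by (auto simp: transp_def L2_eq_def)
qed

instantiation L2 :: real_vector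
begin

lift_definition zero_L2 :: L2 is "\<lambda>x. 0"
  by (simp add: L2_eq_def square_integrable_zero)

lift_definition plus_L2 :: "L2 \<Rightarrow> L2 \<Rightarrow> L2" is "\<lambda>f g x. f x + g x"
  by (auto simp: L2_eq_def square_integrable_add)

lift_definition scaleR_L2 :: "real \<Rightarrow> L2 \<Rightarrow> L2" is "\<lambda>c f x. c * f x"
  by (auto simp: L2_eq_def square_integrable_scale)

lift_definition uminus_L2 :: "L2 \<Rightarrow> L2" is "\<lambda>f x. - f x"
  using square_integrable_scale[of _ "-1"] by (auto simp: L2_eq_def)

definition minus_L2 :: "L2 \<Rightarrow> L2 \<Rightarrow> L2" where
  "minus_L2 u v = u + - v"

instance
proof
  fix u v w :: L2 and a b :: real
  show "u + v + w = u + (v + w)"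
    by transfer (auto simp: L2_eq_def square_integrable_add add.assoc)
  show "u + v = v + u"
    by transfer (auto simp: L2_eq_def square_integrable_add add.commute)
  show "0 + u = u"
    by transfer (auto simp: L2_eq_def)
  show "- u + u = 0"
    by transfer (auto simp: L2_eq_def square_integrable_zero)
  show "u - v = u + - v"
    by (simp add: minus_L2_def)
  show "a *\<^sub>R (u + v) = a *\<^sub>R u + a *\<^sub>R v"
    by transfer (auto simp: L2_eq_def distrib_left intro!: square_integrable_add square_integrable_scale)
  show "(a + b) *\<^sub>R u = a *\<^sub>R u + b *\<^sub>R u"
    by transfer (auto simp: L2_eq_def distrib_right intro!: square_integrable_add square_integrable_scale)
  show "a *\<^sub>R b *\<^sub>R u = (a * b) *\<^sub>R u"
    by transfer (auto simp: L2_eq_def mult.assoc intro!: square_integrable_scale)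
  show "1 *\<^sub>R u = u"
    by transfer (auto simp: L2_eq_def)
qed

end

instantiation L2 :: real_inner
begin

lift_definition inner_L2 :: "L2 \<Rightarrow> L2 \<Rightarrow> real" is "\<lambda>f g. LINT x|unit_leb. f x * g x"
proof -
  fix f f' g g' assume "L2_eq f f'" "L2_eq g g'"
  then show "(LINT x|unit_leb. f x * g x) = (LINT x|unit_leb. f' x * g' x)"
    by (intro integral_cong_AE) (auto simp: L2_eq_def square_integrable_def)
qed

definition norm_L2 :: "L2 \<Rightarrow> real" where
  "norm_L2 u = sqrt (inner u u)"

definition dist_L2 :: "L2 \<Rightarrow> L2 \<Rightarrow> real" where
  "dist_L2 u v = norm (u - v)"

definition sgn_L2 :: "L2 \<Rightarrow> L2" where
  "sgn_L2 u = u /\<^sub>R norm u"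

definition uniformity_L2 :: "(L2 \<times> L2) filter" where
  "uniformity_L2 = (INF e\<in>{0 <..}. principal {(u, v). dist u v < e})"

definition open_L2 :: "L2 set \<Rightarrow> bool" where
  "open_L2 U \<longleftrightarrow> (\<forall>u\<in>U. eventually (\<lambda>(u', v). u' = u \<longrightarrow> v \<in> U) uniformity)"

instance
proof
  fix u v w :: L2 and a :: real
  show "dist u v = norm (u - v)" by (simp add: dist_L2_def)
  show "sgn u = u /\<^sub>R norm u" by (simp add: sgn_L2_def)
  show "uniformity = (INF e\<in>{0 <..}. principal {(u::L2, v). dist u v < e})"
    by (simp add: uniformity_L2_def)
  show "open U \<longleftrightarrow> (\<forall>u\<in>U. eventually (\<lambda>(u', v). u' = u \<longrightarrow> v \<in> U) uniformity)" for U :: "L2 set"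
    by (simp add: open_L2_def)
  show "inner u v = inner v u"
    by transfer (simp add: mult.commute)
  show "inner (u + v) w = inner u w + inner v w"
    by transfer (simp add: L2_eq_def distrib_right square_integrable_mult)
  show "inner (a *\<^sub>R u) v = a * inner u v"
    by transfer (simp add: L2_eq_def mult.assoc)
  show "0 \<le> inner u u"
    by transfer simp
  show "inner u u = 0 \<longleftrightarrow> u = 0"
  proof transfer
    fix f assume f: "L2_eq f f"
    then have "(LINT x|unit_leb. f x * f x) = 0 \<longleftrightarrow> (AE x in unit_leb. f x * f x = 0)"
      by (intro integral_nonneg_eq_0_iff_AE) (auto simp: L2_eq_def square_integrable_mult)
    then show "(LINT x|unit_leb. f x * f x) = 0 \<longleftrightarrow> L2_eq f (\<lambda>x. 0)"
      using f by (simp add: L2_eq_def square_integrable_zero)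
  qed
  show "norm u = sqrt (inner u u)" by (simp add: norm_L2_def)
qed

end


section \<open>The Dirichlet Laplacian and its spectral calculus\<close>

text \<open>
  Sobolev spaces on \<open>(0,1)\<close> are defined through weak derivatives tested against
  \<open>C\<^sup>1\<close> functions with compact support in \<open>(0,1)\<close>; \<open>H\<^sub>0\<^sup>1\<close> is the closure of these
  test functions in the \<open>H\<^sup>1\<close> norm. \<^term>\<open>abs_L2 f\<close> is the class of a square-integrable
  function \<open>f\<close>.
\<close>

definition test_function :: "(real \<Rightarrow> real) \<Rightarrow> (real \<Rightarrow> real) \<Rightarrow> bool" where
  "test_function \<phi> \<phi>' \<longleftrightarrow>
     (\<forall>x. (\<phi> has_real_derivative \<phi>' x) (at x)) \<and> continuous_on UNIV \<phi>' \<and>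
     (\<exists>a b. 0 < a \<and> a < b \<and> b < 1 \<and> (\<forall>x. x \<notin> {a..b} \<longrightarrow> \<phi> x = 0))"

definition weak_deriv :: "L2 \<Rightarrow> L2 \<Rightarrow> bool" where
  "weak_deriv u g \<longleftrightarrow>
     (\<forall>\<phi> \<phi>'. test_function \<phi> \<phi>' \<longrightarrow> inner u (abs_L2 \<phi>') = - inner g (abs_L2 \<phi>))"

definition sobolev_H01 :: "L2 set" where
  "sobolev_H01 = {u. \<exists>g \<phi> \<phi>'. weak_deriv u g \<and> (\<forall>k::nat. test_function (\<phi> k) (\<phi>' k)) \<and>
     (\<lambda>k. abs_L2 (\<phi> k)) \<longlonglongrightarrow> u \<and> (\<lambda>k. abs_L2 (\<phi>' k)) \<longlonglongrightarrow> g}"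

definition sobolev_H2 :: "L2 set" where
  "sobolev_H2 = {u. \<exists>g h. weak_deriv u g \<and> weak_deriv g h}"

definition dom_A :: "L2 set" where
  "dom_A = sobolev_H01 \<inter> sobolev_H2"

definition A_op :: "L2 \<Rightarrow> L2" where
  "A_op u = (THE h. \<exists>g. weak_deriv u g \<and> weak_deriv g h)"

definition neg_A_inv :: "L2 \<Rightarrow> L2" where
  "neg_A_inv = inv_into dom_A (\<lambda>u. - A_op u)"

text \<open>Indices are those of the mathematics: the basis is \<open>e_basis 1, e_basis 2, \<dots>\<close>.\<close>

definition e_basis :: "nat \<Rightarrow> L2" where
  "e_basis i = abs_L2 (\<lambda>x. sqrt 2 * sin (real i * pi * x))"

definition eigval :: "nat \<Rightarrow> real" where
  "eigval i = pi\<^sup>2 * (real i)\<^sup>2"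

text \<open>
  The operator \<open>(-A)\<^sup>\<alpha>\<close> and its domain for \<open>\<alpha> \<ge> 0\<close>; series over the basis are indexed by \<open>Suc i\<close>.
\<close>

definition dom_neg_A_pow :: "real \<Rightarrow> L2 set" where
  "dom_neg_A_pow \<alpha> = {u. summable (\<lambda>i. (eigval (Suc i) powr \<alpha> * inner u (e_basis (Suc i)))\<^sup>2)}"

definition neg_A_pow :: "real \<Rightarrow> L2 \<Rightarrow> L2" where
  "neg_A_pow \<alpha> u = (\<Sum>i. (eigval (Suc i) powr \<alpha> * inner u (e_basis (Suc i))) *\<^sub>R e_basis (Suc i))"

definition Hdot :: "real \<Rightarrow> L2 set" where
  "Hdot \<gamma> = dom_neg_A_pow (\<gamma> / 2)"

definition norm_Hdot :: "real \<Rightarrow> L2 \<Rightarrow> real" where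
  "norm_Hdot \<gamma> u = norm (neg_A_pow (\<gamma> / 2) u)"


section \<open>Operators on the Hilbert space\<close>

definition selfadjoint_op :: "(L2 \<Rightarrow> L2) \<Rightarrow> bool" where
  "selfadjoint_op T \<longleftrightarrow> (\<forall>u v. inner (T u) v = inner u (T v))"

definition positive_definite_op :: "(L2 \<Rightarrow> L2) \<Rightarrow> bool" where
  "positive_definite_op T \<longleftrightarrow> (\<forall>u. u \<noteq> 0 \<longrightarrow> 0 < inner (T u) u)"

text \<open>\<open>R\<close> is the (unique) nonnegative self-adjoint bounded square root of \<open>T\<close>.\<close>

definition is_op_sqrt :: "(L2 \<Rightarrow> L2) \<Rightarrow> (L2 \<Rightarrow> L2) \<Rightarrow> bool" where
  "is_op_sqrt R T \<longleftrightarrow> bounded_linear R \<and> selfadjoint_op R \<and>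
     (\<forall>u. 0 \<le> inner (R u) u) \<and> (\<forall>u. R (R u) = T u)"

definition hilbert_schmidt :: "(L2 \<Rightarrow> L2) \<Rightarrow> bool" where
  "hilbert_schmidt T \<longleftrightarrow> bounded_linear T \<and> summable (\<lambda>i. (norm (T (e_basis (Suc i))))\<^sup>2)"


section \<open>Spectral Galerkin approximation\<close>

definition Hn :: "nat \<Rightarrow> L2 set" where
  "Hn n = span (e_basis ` {1..n})"

definition Pn :: "nat \<Rightarrow> L2 \<Rightarrow> L2" where
  "Pn n u = (\<Sum>i=1..n. inner u (e_basis i) *\<^sub>R e_basis i)"

definition An :: "nat \<Rightarrow> L2 \<Rightarrow> L2" where
  "An n u = Pn n (A_op u)"

definition Fn :: "(L2 \<Rightarrow> L2) \<Rightarrow> nat \<Rightarrow> L2 \<Rightarrow> L2" where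
  "Fn F n u = Pn n (F u)"

text \<open>\<open>Q\<^sub>n\<^bsup>1/2\<^esup>\<close>, in terms of \<open>R = Q\<^bsup>1/2\<^esup>\<close>.\<close>

definition sqrtQn :: "(L2 \<Rightarrow> L2) \<Rightarrow> nat \<Rightarrow> L2 \<Rightarrow> L2" where
  "sqrtQn R n u = Pn n (R u)"

text \<open>The semigroup \<open>exp (t A\<^sub>n)\<close> on \<^term>\<open>Hn n\<close>, as the exponential series of a bounded operator.\<close>

definition semigroup_n :: "nat \<Rightarrow> real \<Rightarrow> L2 \<Rightarrow> L2" where
  "semigroup_n n t u = (\<Sum>k. (t ^ k / fact k) *\<^sub>R (An n ^^ k) u)"

abbreviation borel_Hn :: "nat \<Rightarrow> L2 measure" where
  "borel_Hn n \<equiv> restrict_space borel (Hn n)"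


section \<open>Brownian motion and the Wiener integral\<close>

definition standard_BM :: "'w measure \<Rightarrow> (real \<Rightarrow> 'w \<Rightarrow> real) \<Rightarrow> bool" where
  "standard_BM M B \<longleftrightarrow>
     (\<forall>t\<ge>0. B t \<in> borel_measurable M) \<and>
     (AE \<omega> in M. B 0 \<omega> = 0) \<and>
     (AE \<omega> in M. continuous_on {0..} (\<lambda>t. B t \<omega>)) \<and>
     (\<forall>s t. 0 \<le> s \<and> s < t \<longrightarrow>
        distributed M lborel (\<lambda>\<omega>. B t \<omega> - B s \<omega>) (normal_density 0 (sqrt (t - s)))) \<and>
     (\<forall>(ts :: nat \<Rightarrow> real) k. 0 \<le> ts 0 \<and> (\<forall>j<k. ts j < ts (Suc j)) \<longrightarrow>
        prob_space.indep_vars M (\<lambda>_. borel) (\<lambda>j \<omega>. B (ts (Suc j)) \<omega> - B (ts j) \<omega>) {..<k})"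

text \<open>
  Independence of the processes is independence of the path-valued random variables for the
  product \<open>\<sigma>\<close>-algebra. The cylindrical Wiener process is the formal sum of the \<open>\<beta> i t *\<^sub>R e_basis i\<close>
  over \<open>i \<ge> 1\<close>; it is represented by its family of coordinates.
\<close>

definition cylindrical_Wiener :: "'w measure \<Rightarrow> (nat \<Rightarrow> real \<Rightarrow> 'w \<Rightarrow> real) \<Rightarrow> bool" where
  "cylindrical_Wiener M \<beta> \<longleftrightarrow>
     (\<forall>i\<ge>1. standard_BM M (\<beta> i)) \<and>
     prob_space.indep_vars M (\<lambda>_. \<Pi>\<^sub>M t\<in>{0..}. borel)
       (\<lambda>i \<omega>. \<lambda>t\<in>{0..}. \<beta> i t \<omega>) {1..}"

definition step_fun :: "(nat \<Rightarrow> real) \<Rightarrow> (nat \<Rightarrow> 'b) \<Rightarrow> nat \<Rightarrow> real \<Rightarrow> 'b::real_normed_vector" where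
  "step_fun ts c k s = (\<Sum>j<k. indicat_real {ts j<..ts (Suc j)} s *\<^sub>R c j)"

definition step_integral ::
  "(real \<Rightarrow> 'w \<Rightarrow> real) \<Rightarrow> (nat \<Rightarrow> real) \<Rightarrow> (nat \<Rightarrow> 'b) \<Rightarrow> nat \<Rightarrow> 'w \<Rightarrow> 'b::real_normed_vector" where
  "step_integral B ts c k \<omega> = (\<Sum>j<k. (B (ts (Suc j)) \<omega> - B (ts j) \<omega>) *\<^sub>R c j)"

text \<open>
  \<open>Y\<close> is a version of the stochastic integral \<open>\<integral>\<^sub>0\<^sup>t f(s) dB(s)\<close> of a deterministic square-integrable
  \<open>f\<close>: the \<open>L\<^sup>2(\<Omega>)\<close> limit of the integrals of step functions that converge to \<open>f\<close> in \<open>L\<^sup>2(0,t)\<close>.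
\<close>

definition is_Wiener_integral ::
  "'w measure \<Rightarrow> (real \<Rightarrow> 'w \<Rightarrow> real) \<Rightarrow> real \<Rightarrow> (real \<Rightarrow> 'b) \<Rightarrow> ('w \<Rightarrow> 'b::real_normed_vector) \<Rightarrow> bool" where
  "is_Wiener_integral M B t f Y \<longleftrightarrow>
     Y \<in> borel_measurable M \<and>
     (\<exists>(ts :: nat \<Rightarrow> nat \<Rightarrow> real) (c :: nat \<Rightarrow> nat \<Rightarrow> 'b) (k :: nat \<Rightarrow> nat).
        (\<forall>m. ts m 0 = 0 \<and> ts m (k m) = t \<and> (\<forall>j<k m. ts m j \<le> ts m (Suc j))) \<and>
        (\<lambda>m. \<integral>\<^sup>+s\<in>{0..t}. ennreal ((norm (step_fun (ts m) (c m) (k m) s - f s))\<^sup>2) \<partial>lborel)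
           \<longlonglongrightarrow> 0 \<and>
        (\<lambda>m. \<integral>\<^sup>+\<omega>. ennreal ((norm (step_integral B (ts m) (c m) (k m) \<omega> - Y \<omega>))\<^sup>2) \<partial>M)
           \<longlonglongrightarrow> 0)"


section \<open>The stochastic equation and its time averages\<close>

text \<open>
  Mild solution in \<^term>\<open>Hn n\<close> of \<open>dX = (A\<^sub>n X + F\<^sub>n(X)) dt + \<epsilon> Q\<^sub>n\<^bsup>1/2\<^esup> dW\<^sub>n\<close>, \<open>X(0) = y\<close>, where \<open>R = Q\<^bsup>1/2\<^esup>\<close> and
  \<open>W\<^sub>n = (\<Sum>i=1..n. \<beta> i *\<^sub>R e_basis i)\<close>; \<open>Z i t\<close> is the stochastic convolution with the \<open>i\<close>-th mode.
\<close>

definition mild_solution ::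
  "'w measure \<Rightarrow> (nat \<Rightarrow> real \<Rightarrow> 'w \<Rightarrow> real) \<Rightarrow> (L2 \<Rightarrow> L2) \<Rightarrow> (L2 \<Rightarrow> L2) \<Rightarrow> nat \<Rightarrow> real \<Rightarrow> L2 \<Rightarrow>
     (real \<Rightarrow> 'w \<Rightarrow> L2) \<Rightarrow> bool" where
  "mild_solution M \<beta> R F n \<epsilon> y X \<longleftrightarrow>
     (\<forall>t\<ge>0. X t \<in> M \<rightarrow>\<^sub>M borel_Hn n) \<and>
     (AE \<omega> in M. continuous_on {0..} (\<lambda>t. X t \<omega>)) \<and>
     (\<exists>Z :: nat \<Rightarrow> real \<Rightarrow> 'w \<Rightarrow> L2.
        (\<forall>i\<in>{1..n}. \<forall>t\<ge>0.
           is_Wiener_integral M (\<beta> i) t (\<lambda>s. semigroup_n n (t - s) (sqrtQn R n (e_basis i))) (Z i t)) \<and>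
        (\<forall>t\<ge>0. AE \<omega> in M.
           X t \<omega> = semigroup_n n t y
             + integral {0..t} (\<lambda>s. semigroup_n n (t - s) (Fn F n (X s \<omega>)))
             + \<epsilon> *\<^sub>R (\<Sum>i=1..n. Z i t \<omega>)))"

definition time_average :: "'w measure \<Rightarrow> nat \<Rightarrow> (real \<Rightarrow> 'w \<Rightarrow> L2) \<Rightarrow> real \<Rightarrow> L2 measure" where
  "time_average M n X t = measure_of (Hn n) (sets (borel_Hn n))
     (\<lambda>B. (\<integral>\<^sup>+s\<in>{0..t}. emeasure M {\<omega> \<in> space M. X s \<omega> \<in> B} \<partial>lborel) / ennreal t)"

definition weak_limit :: "nat \<Rightarrow> (nat \<Rightarrow> L2 measure) \<Rightarrow> L2 measure \<Rightarrow> bool" where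
  "weak_limit n N \<mu> \<longleftrightarrow>
     (\<forall>f :: L2 \<Rightarrow> real. continuous_on (Hn n) f \<and> bounded (f ` Hn n) \<longrightarrow>
        (\<lambda>i. LINT x|N i. f x) \<longlonglongrightarrow> (LINT x|\<mu>. f x))"

text \<open>
  \<open>\<mu>\<close> is a Krylov--Bogoliubov measure of the process \<open>X\<close>: a weak limit, among the Borel
  probability measures on \<^term>\<open>Hn n\<close>, of the time averages along some \<open>t\<^sub>i \<up> \<infinity>\<close>.
\<close>

definition time_average_limit ::
  "'w measure \<Rightarrow> nat \<Rightarrow> (real \<Rightarrow> 'w \<Rightarrow> L2) \<Rightarrow> L2 measure \<Rightarrow> bool" where
  "time_average_limit M n X \<mu> \<longleftrightarrow>
     prob_space \<mu> \<and> sets \<mu> = sets (borel_Hn n) \<and>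
     (\<exists>t :: nat \<Rightarrow> real. (\<forall>i. 0 < t i) \<and> incseq t \<and> filterlim t at_top sequentially \<and>
        weak_limit n (\<lambda>i. time_average M n X (t i)) \<mu>)"


section \<open>The rate function and the quasi-potential\<close>

definition control_L2 :: "nat \<Rightarrow> real \<Rightarrow> (real \<Rightarrow> L2) set" where
  "control_L2 n T = {\<psi>. \<psi> \<in> lebesgue_on {0..T} \<rightarrow>\<^sub>M borel_Hn n \<and>
     integrable (lebesgue_on {0..T}) (\<lambda>t. (norm (\<psi> t))\<^sup>2)}"

definition control_energy :: "real \<Rightarrow> (real \<Rightarrow> L2) \<Rightarrow> real" where
  "control_energy T \<psi> = (LINT t|lebesgue_on {0..T}. (norm (\<psi> t))\<^sup>2)"

text \<open>\<open>z\<close> is, on \<open>[0,T]\<close>, the mild solution of \<open>z' = A\<^sub>n z + F\<^sub>n(z) + Q\<^sub>n\<^bsup>1/2\<^esup> \<psi>\<close>, \<open>z(0) = y\<close>, with \<open>R = Q\<^bsup>1/2\<^esup>\<close>.\<close>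

definition skeleton_solution ::
  "(L2 \<Rightarrow> L2) \<Rightarrow> (L2 \<Rightarrow> L2) \<Rightarrow> nat \<Rightarrow> real \<Rightarrow> L2 \<Rightarrow> (real \<Rightarrow> L2) \<Rightarrow> (real \<Rightarrow> L2) \<Rightarrow> bool" where
  "skeleton_solution R F n T y \<psi> z \<longleftrightarrow>
     continuous_on {0..T} z \<and> z ` {0..T} \<subseteq> Hn n \<and>
     (\<forall>t\<in>{0..T}. z t = semigroup_n n t y
        + integral {0..t} (\<lambda>s. semigroup_n n (t - s) (Fn F n (z s) + sqrtQn R n (\<psi> s))))"

definition rate_function ::
  "(L2 \<Rightarrow> L2) \<Rightarrow> (L2 \<Rightarrow> L2) \<Rightarrow> nat \<Rightarrow> real \<Rightarrow> L2 \<Rightarrow> (real \<Rightarrow> L2) \<Rightarrow> ereal" where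
  "rate_function R F n T y z =
     ereal (1 / 2) * Inf {ereal (control_energy T \<psi>) |\<psi>.
        \<psi> \<in> control_L2 n T \<and> skeleton_solution R F n T y \<psi> z}"

definition quasi_potential :: "(L2 \<Rightarrow> L2) \<Rightarrow> (L2 \<Rightarrow> L2) \<Rightarrow> nat \<Rightarrow> L2 \<Rightarrow> ereal" where
  "quasi_potential R F n v =
     Inf {rate_function R F n T 0 z |T z. 0 < T \<and> continuous_on {0..T} z \<and>
        z ` {0..T} \<subseteq> Hn n \<and> z 0 = 0 \<and> z T = v}"

text \<open>\<open>exp (- (V + \<gamma>) / \<epsilon>\<^sup>2)\<close> for \<open>V \<in> [0,\<infinity>]\<close>, with value \<open>0\<close> at \<open>V = \<infinity>\<close>.\<close>

definition exp_lower_bound :: "ereal \<Rightarrow> real \<Rightarrow> real \<Rightarrow> real" where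
  "exp_lower_bound V \<gamma> \<epsilon> = (if V = \<infinity> then 0 else exp (- (real_of_ereal V + \<gamma>) / \<epsilon>\<^sup>2))"

end

(*
  The lower bound rests on one uniform estimate: for every target y_bar there is T such that
  P(|X^eps(s) - y_bar| < rho) >= exp(-(V + gamma) / eps^2) for all s >= T and all small eps, where X^eps
  starts at 0. Averaging it over s and passing to the weak limit gives the claim; neither the
  invariance of mu^eps nor the Markov property is needed.

  For the estimate, delay a nearly optimal skeleton path so that it rests at 0 and reaches y_bar exactly
  at time s (F 0 = 0 makes this free), and replace its control by a step control psi with energy E. Let xi be
  the Wiener integral of psi. Under the density exp(xi / eps - E / (2 eps^2)) the stochastic convolution
  eps Z(t) is Gaussian with variance O(eps^2) around the controlled convolution, uniformly in t; this is read
  off exponential moments of Wiener integrals, so no Girsanov theorem is required. Since L_F < lambda_1,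
  a Gronwall argument bounds |X^eps(s) - y_bar| pathwise by exponentially weighted time averages of the
  deviations of the convolutions, whose tilted mean is therefore small. On the event |xi - E / eps| <= E / 2 + 3,
  whose tilted probability is at least 3/4, the density is at most exp(E / (2 eps^2) + O(1 / eps)), and undoing
  the tilt yields the bound.
*)

theory Submission
  imports Defs
begin

section \<open>Uniqueness of weak derivatives\<close>

text \<open>Two features of the definitions shape the argument. \<open>A_op\<close> is a definite
  description over weak derivatives, so weak derivatives must be unique before exp(t A_n) can be
  read as a diagonal matrix in the sine basis; from then on everything is done in coordinates, with
  the full matrix of entries <R e_i, e_k> in front of the noise. And the stochastic convolutions are
  given only as L^2(\<Omega>) limits, one time at a time: the mild equation holds almost surely at
  each fixed time, and joint measurability of the convolutions is not part of the data. The time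
  integral in the Gronwall bound is therefore treated as a limit of Riemann sums over countably many
  times, and Fatou's lemma takes the place of Fubini's theorem.

  Step controls are used because the exponential moments of xi are then exact finite products. All
  that the convolutions need of them is uniform closeness of the primitives, since the kernels are
  monotone. The sharp constant L_F has to survive the passage to coordinates: uniformity in s rests
  on the integrability of exp(-(\<lambda>_1 - L_F) t) over the half-line.\<close>

lemma inner_abs_L2:
  assumes "square_integrable f" "square_integrable g"
  shows "inner (abs_L2 f) (abs_L2 g) = (LINT x|unit_leb. f x * g x)"
  using assms by (simp add: inner_L2.abs_eq L2_eq_def)

lemma obtain_rep_L2:
  obtains f where "square_integrable f" "u = abs_L2 f"
proof -
  have "\<exists>f. square_integrable f \<and> u = abs_L2 f"
    by (induction u rule: L2.abs_induct) (auto simp: L2_eq_def)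
  then show ?thesis using that by blast
qed

lemma continuous_integrable_unit:
  fixes f :: "real \<Rightarrow> real"
  assumes "continuous_on UNIV f"
  shows "integrable unit_leb f"
proof -
  have "f absolutely_integrable_on {0..1}"
    using assms absolutely_integrable_continuous_real continuous_on_subset by blast
  then have "f absolutely_integrable_on {0<..<1}"
    by (rule set_integrable_subset) auto
  then show ?thesis
    by (simp add: integrable_restrict_space set_integrable_def)
qed

lemma continuous_square_integrable:
  assumes "continuous_on UNIV f"
  shows "square_integrable f"
  unfolding square_integrable_def
  using continuous_integrable_unit[OF assms]
  by (auto intro!: continuous_integrable_unit continuous_intros assms)

lemma square_integrable_imp_integrable:
  assumes "square_integrable f"
  shows "integrable unit_leb f"
  using square_integrable_mult[OF assms, of "\<lambda>x. 1"] continuous_square_integrable[of "\<lambda>x. 1"]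
  by simp

lemma unit_integral_eq:
  fixes f :: "real \<Rightarrow> real"
  assumes "continuous_on UNIV f"
  shows "(LINT x|unit_leb. f x) = integral {0..1} f"
  using lebesgue_integral_eq_integral[OF continuous_integrable_unit[OF assms]]
  by (simp add: integral_open_interval_real)

lemma test_functionD:
  assumes "test_function \<phi> \<phi>'"
  shows "continuous_on UNIV \<phi>" "continuous_on UNIV \<phi>'" "\<phi> 0 = 0" "\<phi> 1 = 0"
    "square_integrable \<phi>" "square_integrable \<phi>'"
    "(\<phi> has_real_derivative \<phi>' x) (at x)"
proof -
  show d: "(\<phi> has_real_derivative \<phi>' x) (at x)" for x
    using assms by (auto simp: test_function_def)
  show c: "continuous_on UNIV \<phi>"
    by (rule DERIV_continuous_on[OF d]) 
  show c': "continuous_on UNIV \<phi>'" using assms by (auto simp: test_function_def)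
  show "\<phi> 0 = 0" "\<phi> 1 = 0" using assms by (force simp: test_function_def)+
  show "square_integrable \<phi>" "square_integrable \<phi>'"
    using c c' continuous_square_integrable by auto
qed

text \<open>Integration by parts; the boundary terms vanish through the test function alone, so the
  lemma also covers the cosines, which do not vanish at the endpoints.\<close>

lemma weak_deriv_classical:
  assumes d: "\<And>x. (f has_real_derivative f' x) (at x)" and c: "continuous_on UNIV f'"
  shows "weak_deriv (abs_L2 f) (abs_L2 f')"
  unfolding weak_deriv_def
proof (intro allI impI)
  fix \<phi> \<phi>' assume "test_function \<phi> \<phi>'"
  note \<phi> = test_functionD[OF this]
  have cf: "continuous_on UNIV f" by (rule DERIV_continuous_on[OF d])
  have "((\<lambda>x. f' x * \<phi> x + f x * \<phi>' x) has_integral (f 1 * \<phi> 1 - f 0 * \<phi> 0)) {0..1}"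
    by (rule fundamental_theorem_of_calculus)
      (auto intro!: derivative_eq_intros d \<phi>(7) simp flip: has_real_derivative_iff_has_vector_derivative
        intro: DERIV_subset)
  then have "integral {0..1} (\<lambda>x. f' x * \<phi> x + f x * \<phi>' x) = 0"
    using \<phi> by (simp add: integral_unique)
  moreover have "integral {0..1} (\<lambda>x. f' x * \<phi> x + f x * \<phi>' x)
      = integral {0..1} (\<lambda>x. f' x * \<phi> x) + integral {0..1} (\<lambda>x. f x * \<phi>' x)"
    by (intro Henstock_Kurzweil_Integration.integral_add integrable_continuous_real continuous_intros)
      (use cf c \<phi> in \<open>auto intro: continuous_on_subset\<close>)
  ultimately show "inner (abs_L2 f) (abs_L2 \<phi>') = - inner (abs_L2 f') (abs_L2 \<phi>)"
    using cf c \<phi> by (simp add: inner_abs_L2 continuous_square_integrable unit_integral_eq continuous_intros)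
qed

text \<open>Squaring the positive part of the parabola makes it C^1, and y -> k y / (1 + k y)
  saturates it: for growing \<open>k\<close> these functions stay in [0,1) and converge pointwise to
  the indicator of (a,b), while their support stays in [a,b].\<close>

lemma bump_limit_test_function:
  assumes "0 < a" "a < b" "b < 1"
  defines "m \<equiv> \<lambda>x. max 0 ((x - a) * (b - x))"
  shows "\<exists>\<phi>'. test_function (\<lambda>x. real k * (m x)^2 / (1 + real k * (m x)^2)) \<phi>'"
proof -
  have m2: "((\<lambda>x. (m x)^2) has_real_derivative 2 * m x * (a + b - 2 * x)) (at x)" for x
  proof -
    have sq: "((\<lambda>y. (max 0 y)^2) has_real_derivative 2 * max 0 y) (at y)" for y :: real
    proof -
      consider "y < 0" | "y > 0" | "y = 0" by linarith
      then show ?thesis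
      proof cases
        case 1
        have "((\<lambda>y. 0) has_real_derivative 2 * max 0 y) (at y)" using 1 by simp
        then show ?thesis
          by (rule has_field_derivative_transform_within_open[where S="{..<0}"]) (use 1 in auto)
      next
        case 2
        have "((\<lambda>y. y^2) has_real_derivative 2 * max 0 y) (at y)"
          using 2 by (auto intro!: derivative_eq_intros)
        then show ?thesis
          by (rule has_field_derivative_transform_within_open[where S="{0<..}"]) (use 2 in auto)
      next
        case 3
        have "((\<lambda>h. (max 0 h)^2 / h) \<longlongrightarrow> 0) (at (0::real))"
        proof (rule Lim_null_comparison[where g="\<lambda>h. \<bar>h\<bar>"])
          show "\<forall>\<^sub>F x in at 0. norm ((max 0 x)^2 / x) \<le> \<bar>x::real\<bar>"
            by (auto intro!: always_eventually simp: max_def power2_eq_square)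
          show "((\<lambda>h::real. \<bar>h\<bar>) \<longlongrightarrow> 0) (at 0)"
            by (intro tendsto_eq_intros) auto
        qed
        then show ?thesis using 3 by (simp add: DERIV_def)
      qed
    qed
    have "((\<lambda>x. (x - a) * (b - x)) has_real_derivative (a + b - 2 * x)) (at x)"
      by (auto intro!: derivative_eq_intros simp: algebra_simps)
    from DERIV_chain2[OF sq this] show ?thesis by (simp add: m_def)
  qed
  have pos: "1 + real k * (m x)^2 > 0" for x by (simp add: add_pos_nonneg)
  define \<phi>' where "\<phi>' = (\<lambda>x. (real k * (2 * m x * (a + b - 2 * x)) * (1 + real k * (m x)^2)
     - real k * (m x)^2 * (real k * (2 * m x * (a + b - 2 * x)))) / (1 + real k * (m x)^2)^2)"
  have mc: "continuous_on UNIV m"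
    unfolding m_def by (intro continuous_intros)
  have "test_function (\<lambda>x. real k * (m x)^2 / (1 + real k * (m x)^2)) \<phi>'"
    unfolding test_function_def
  proof (intro conjI allI)
    fix x
    show "((\<lambda>x. real k * (m x)^2 / (1 + real k * (m x)^2)) has_real_derivative \<phi>' x) (at x)"
    proof -
      have "((\<lambda>x. real k * g x / (1 + real k * g x)) has_real_derivative
          (real k * D * (1 + real k * g x) - real k * g x * (real k * D)) / (1 + real k * g x)^2) (at x)"
        if "(g has_real_derivative D) (at x)" "1 + real k * g x > 0" for g D
        using that by (auto intro!: derivative_eq_intros simp: power2_eq_square)
      from this[OF m2 pos] show ?thesis by (simp only: \<phi>'_def)
    qed
    show "continuous_on UNIV \<phi>'" unfolding \<phi>'_def
      using pos mc by (intro continuous_intros) (auto simp: less_le)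
    have "m x = 0" if "x \<notin> {a..b}" for x
      using that \<open>a < b\<close> by (auto simp: m_def max_def mult_le_0_iff not_le zero_le_mult_iff)
    then have "0 < a \<and> a < b \<and> b < 1 \<and> (\<forall>x. x \<notin> {a..b} \<longrightarrow> real k * (m x)^2 / (1 + real k * (m x)^2) = 0)"
      using assms(1-3) by simp
    then show "\<exists>a b. 0 < a \<and> a < b \<and> b < 1 \<and>
        (\<forall>x. x \<notin> {a..b} \<longrightarrow> real k * (m x)^2 / (1 + real k * (m x)^2) = 0)"
      by blast
  qed
  then show ?thesis by blast
qed


lemma sets_borel_open_intervals:
  "sets borel = sigma_sets UNIV (range (\<lambda>(a, b). {a<..<b::real}))"
  by (simp add: borel_eq_box box_real)

text \<open>Dynkin argument: open intervals are an intersection-stable generator of the Borel sets,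
  and the sets over which \<open>f\<close> integrates to zero are closed under complements and
  disjoint unions; an integrable density is determined by its integrals over Borel sets.\<close>

lemma integral_zero_on_intervals_imp_AE_zero:
  fixes f :: "real \<Rightarrow> real"
  assumes f: "integrable lborel f"
    and int0: "\<And>a b. a < b \<Longrightarrow> (LINT x:{a<..<b}|lborel. f x) = 0"
  shows "AE x in lborel. f x = 0"
proof (rule density_unique_real[OF f])
  show "integrable lborel (\<lambda>x::real. 0::real)" by simp
  have [measurable]: "f \<in> borel_measurable borel" using f by auto
  have si: "set_integrable lborel A f" if "A \<in> sets borel" for A
    using that f integrable_mult_indicator[of A lborel f] by (simp add: set_integrable_def)
  have "A \<in> sets borel \<Longrightarrow> (LINT x:A|lborel. f x) = 0" for A
  proof -
    assume "A \<in> sets borel"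
    have I: "Int_stable (range (\<lambda>(a, b). {a<..<b::real}))"
      by (force simp: Int_stable_def image_iff)
    have S: "range (\<lambda>(a, b). {a<..<b::real}) \<subseteq> Pow UNIV" by simp
    from \<open>A \<in> sets borel\<close> have "A \<in> sigma_sets UNIV (range (\<lambda>(a, b). {a<..<b::real}))"
      by (simp add: sets_borel_open_intervals)
    then show ?thesis
    proof (induction A rule: sigma_sets_induct_disjoint[OF I S, consumes 1, case_names basic empty compl union])
      case (basic A)
      then obtain a b where "A = {a<..<b}" by auto
      then show ?case using int0[of a b] by (cases "a < b") (auto simp: set_lebesgue_integral_def)
    next
      case empty
      then show ?case by (simp add: set_lebesgue_integral_def)
    next
      case (compl A)
      then have "A \<in> sets borel" by (simp add: sets_borel_open_intervals)
      \<comment> \<open>For complements the integral over the whole line has to vanish; the line is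
        exhausted by the intervals (-i, i).\<close>
      have u: "((\<lambda>i. LINT x:{- real i<..<real i}|lborel. f x) \<longlonglongrightarrow> (LINT x:(\<Union>i. {- real i<..<real i})|lborel. f x))"
        by (rule set_integral_cont_up) (use f in \<open>auto intro!: si simp: incseq_def\<close>)
      have "(\<Union>i. {- real i<..<real i}) = (UNIV::real set)"
      proof (intro set_eqI iffI UNIV_I)
        fix x :: real
        obtain i where "\<bar>x\<bar> < real i" using reals_Archimedean2 by blast
        then show "x \<in> (\<Union>i. {- real i<..<real i})" by (auto intro!: exI[of _ i])
      qed
      moreover have "(LINT x:{- real i<..<real i}|lborel. f x) = 0" for i
        using int0[of "- real i" "real i"] by (cases "i = 0") (auto simp: set_lebesgue_integral_def)
      ultimately have "(\<lambda>i. 0) \<longlonglongrightarrow> (LINT x:UNIV|lborel. f x)"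
        using u by simp
      then have "(LINT x:UNIV|lborel. f x) = 0" by (simp add: LIMSEQ_const_iff)
      then have "(LINT x:(A \<union> (UNIV - A))|lborel. f x) = 0" by simp
      then show ?case
        using compl.IH \<open>A \<in> sets borel\<close> 
        by (subst (asm) set_integral_Un) (auto intro!: si)
    next
      case (union A)
      then have "range A \<subseteq> sets borel" by (auto simp: sets_borel_open_intervals)
      then show ?case
        using union lebesgue_integral_countable_add[of A lborel f] by (auto simp: disjoint_family_on_def intro!: si)
    qed
  qed
  then show "A \<in> sets lborel \<Longrightarrow> (LINT x:A|lborel. f x) = (LINT x:A|lborel. 0)" for A
    by simp
qed

text \<open>Bump functions converge boundedly to indicators, so a representative of \<open>w\<close>
  has zero integral over every interval compactly contained in (0,1), and these integrals determine
  it almost everywhere.\<close>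

lemma fundamental_lemma:
  assumes "\<And>\<phi> \<phi>'. test_function \<phi> \<phi>' \<Longrightarrow> inner w (abs_L2 \<phi>) = 0"
  shows "w = 0"
proof -
  obtain f where f: "square_integrable f" "w = abs_L2 f" by (rule obtain_rep_L2)
  have fi: "integrable unit_leb f" using f(1) by (rule square_integrable_imp_integrable)
  have bump: "(LINT x|unit_leb. indicator {a<..<b} x * f x) = 0" if ab: "0 < a" "a < b" "b < 1" for a b
  proof -
    define m where "m = (\<lambda>x. max 0 ((x - a) * (b - x)))"
    define \<phi> where "\<phi> = (\<lambda>k x. real k * (m x)^2 / (1 + real k * (m x)^2))"
    have t: "\<exists>\<phi>'. test_function (\<phi> k) \<phi>'" for k
      using bump_limit_test_function[OF ab] by (simp add: \<phi>_def m_def)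
    have 0: "(LINT x|unit_leb. \<phi> k x * f x) = 0" for k
    proof -
      obtain \<phi>' where \<phi>': "test_function (\<phi> k) \<phi>'" using t by blast
      have "inner (abs_L2 (\<phi> k)) w = 0" using assms[OF \<phi>'] by (simp add: inner_commute)
      then show ?thesis using inner_abs_L2[OF test_functionD(5)[OF \<phi>'] f(1)] f(2) by simp
    qed
    have "(\<lambda>k. LINT x|unit_leb. \<phi> k x * f x) \<longlonglongrightarrow> (LINT x|unit_leb. indicator {a<..<b} x * f x)"
    proof (rule integral_dominated_convergence)
      show "integrable unit_leb (\<lambda>x. \<bar>f x\<bar>)" using fi by simp
      show "(\<lambda>x. indicator {a<..<b} x * f x) \<in> borel_measurable unit_leb" 
      proof (intro borel_measurable_times borel_measurable_indicator)
        show "{a<..<b} \<in> sets unit_leb"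
          by (subst sets_restrict_space_iff) (use ab in auto)
      qed (use fi in auto)
      show "(\<lambda>x. \<phi> k x * f x) \<in> borel_measurable unit_leb" for k
      proof -
        obtain \<phi>' where "test_function (\<phi> k) \<phi>'" using t by blast
        then have "\<phi> k \<in> borel_measurable unit_leb"
          using test_functionD(5) unfolding square_integrable_def by blast
        then show ?thesis using fi by (intro borel_measurable_times) auto
      qed
      have "(\<lambda>k. \<phi> k x) \<longlonglongrightarrow> indicator {a<..<b} x" for x
      proof (cases "x \<in> {a<..<b}")
        case True
        then have "m x > 0" by (simp add: m_def)
        have "(\<lambda>k. \<phi> k x) \<longlonglongrightarrow> 1" unfolding \<phi>_def using \<open>m x > 0\<close> by real_asymp
        then show ?thesis using True by simp
      next
        case False
        then have "m x = 0" using ab(2) by (auto simp: m_def max_def zero_le_mult_iff mult_le_0_iff not_le)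
        then show ?thesis using False by (simp add: \<phi>_def)
      qed
      then show "AE x in unit_leb. (\<lambda>k. \<phi> k x * f x) \<longlonglongrightarrow> indicator {a<..<b} x * f x"
        by (auto intro!: tendsto_mult)
      have "\<bar>\<phi> k x\<bar> \<le> 1" for k x
      proof -
        have "0 \<le> \<phi> k x" unfolding \<phi>_def by (intro divide_nonneg_nonneg add_nonneg_nonneg) auto
        moreover have "\<phi> k x \<le> 1" unfolding \<phi>_def by (simp add: add_pos_nonneg divide_le_eq_1)
        ultimately show ?thesis by simp
      qed
      then show "AE x in unit_leb. norm (\<phi> k x * f x) \<le> \<bar>f x\<bar>" for k
        by (intro AE_I2) (simp add: abs_mult mult_left_le_one_le)
    qed
    with 0 have "(\<lambda>k. 0) \<longlonglongrightarrow> (LINT x|unit_leb. indicator {a<..<b} x * f x)" by simp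
    then show ?thesis by (simp add: LIMSEQ_const_iff)
  qed
  have "set_integrable lebesgue {0<..<1} f"
    using fi by (simp add: integrable_restrict_space set_integrable_def)
  then have hi: "integrable lebesgue (\<lambda>x. indicator {0<..<1} x * f x)"
    by (simp add: set_integrable_def)
  \<comment> \<open>Representatives are only Lebesgue measurable; the interval argument runs over
    Borel sets, so it is applied to a Borel version \<open>h\<close> of the extension by
    zero.\<close>
  then obtain h where h: "h \<in> borel_measurable lborel" "AE x in lborel. indicator {0<..<1} x * f x = h x"
    using completion_ex_borel_measurable_real[of "\<lambda>x. indicator {0<..<1} x * f x" lborel] by auto
  have AEh: "AE x in lebesgue. indicator {0<..<1} x * f x = h x"
    using h(2) AE_completion by blast
  have hb: "integrable lborel h"
  proof -
    have "integrable lebesgue h"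
      using hi AEh measurable_completion[OF h(1)]
      by (subst integrable_cong_AE[where g="\<lambda>x. indicator {0<..<1} x * f x"]) auto
    then show ?thesis using h(1) integrable_completion by blast
  qed
  have key: "(LINT x|lborel. indicator S x * h x) = (LINT x|unit_leb. indicator S x * f x)"
    if [measurable]: "S \<in> sets borel" for S
  proof -
    have "(LINT x|lborel. indicator S x * h x) = (LINT x|lebesgue. indicator S x * h x)"
      by (rule integral_completion[symmetric]) (use h(1) in measurable)
    also have "\<dots> = (LINT x|lebesgue. indicator {0<..<1} x * (indicator S x * f x))"
    proof (rule integral_cong_AE)
      show "(\<lambda>x. indicator S x * h x) \<in> borel_measurable lebesgue"
        using h(1) by (intro measurable_completion) simp
      have "(\<lambda>x. indicator S x * (indicator {0<..<1} x * f x)) \<in> borel_measurable lebesgue"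
        by (rule borel_measurable_times[OF borel_measurable_indicator borel_measurable_integrable[OF hi]]) simp
      then show "(\<lambda>x. indicator {0<..<1} x * (indicator S x * f x)) \<in> borel_measurable lebesgue"
        by (simp add: mult.left_commute)
      show "AE x in lebesgue. indicator S x * h x = indicator {0<..<1} x * (indicator S x * f x)"
        using AEh by eventually_elim (simp add: mult.left_commute)
    qed
    also have "\<dots> = (LINT x|unit_leb. indicator S x * f x)"
      by (simp add: integral_restrict_space)
    finally show ?thesis .
  qed
  have "AE x in lborel. h x = 0"
  proof (rule integral_zero_on_intervals_imp_AE_zero[OF hb])
    fix a b :: real assume "a < b"
    \<comment> \<open>Bump functions live on intervals compactly inside (0,1); a general interval is
      reached as the limit of these truncations.\<close>
    define a' where "a' = (\<lambda>k. max a (1 / (real k + 3)))"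
    define b' where "b' = (\<lambda>k. min b (1 - 1 / (real k + 3)))"
    have z: "(LINT x|lborel. indicator {a' k<..<b' k} x * h x) = 0" for k
    proof (cases "a' k < b' k")
      case True
      have "0 < 1 / (real k + 3)" by simp
      then have "0 < a' k" "b' k < 1"
        unfolding a'_def b'_def less_max_iff_disj min_less_iff_disj by linarith+
      then show ?thesis using bump[of "a' k" "b' k"] True by (simp add: key)
    qed simp
    have "(\<lambda>k. LINT x|lborel. indicator {a' k<..<b' k} x * h x)
      \<longlonglongrightarrow> (LINT x|lborel. indicator ({a<..<b} \<inter> {0<..<1}) x * h x)"
    proof (rule integral_dominated_convergence)
      show "integrable lborel (\<lambda>x. \<bar>h x\<bar>)" using hb by simp
      show "AE x in lborel. (\<lambda>k. indicator {a' k<..<b' k} x * h x) \<longlonglongrightarrow> indicator ({a<..<b} \<inter> {0<..<1}) x * h x"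
      proof (intro AE_I2 tendsto_mult tendsto_const)
        fix x :: real
        have l: "(\<lambda>k. 1 / (real k + 3)) \<longlonglongrightarrow> 0" by real_asymp
        show "(\<lambda>k. indicator {a' k<..<b' k} x :: real) \<longlonglongrightarrow> indicator ({a<..<b} \<inter> {0<..<1}) x"
        proof (cases "x \<in> {a<..<b} \<inter> {0<..<1}")
          case True
          then have "min x (1 - x) > 0" by auto
          then have "eventually (\<lambda>k. 1 / (real k + 3) < min x (1 - x)) sequentially"
            using order_tendstoD(2)[OF l] by blast
          then have "eventually (\<lambda>k. indicator {a' k<..<b' k} x = (1::real)) sequentially"
            by eventually_elim (use True in \<open>auto simp: a'_def b'_def\<close>)
          then show ?thesis using True by (simp add: tendsto_eventually)
        next
          case False
          have "x \<notin> {a' k<..<b' k}" for k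
          proof -
            have "0 < 1 / (real k + 3)" by simp
            then show ?thesis
              using False unfolding a'_def b'_def greaterThanLessThan_iff Int_iff
                max_less_iff_conj min_less_iff_conj by linarith
          qed
          then show ?thesis using False by simp
        qed
      qed
    qed (use h(1) in \<open>auto simp: indicator_def\<close>)
    then have "(LINT x|lborel. indicator ({a<..<b} \<inter> {0<..<1}) x * h x) = 0"
      by (simp add: z LIMSEQ_const_iff)
    moreover have "(LINT x|lborel. indicator {a<..<b} x * h x) = (LINT x|lborel. indicator ({a<..<b} \<inter> {0<..<1}) x * h x)"
    proof -
      have "(LINT x|unit_leb. indicator {a<..<b} x * f x) = (LINT x|unit_leb. indicator ({a<..<b} \<inter> {0<..<1}) x * f x)"
        by (intro Bochner_Integration.integral_cong) (auto simp: indicator_def)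
      then show ?thesis by (simp only: key borel_open open_greaterThanLessThan open_Int)
    qed
    ultimately show "(LINT x:{a<..<b}|lborel. h x) = 0"
      by (simp add: set_lebesgue_integral_def)
  qed
  then have "AE x in lebesgue. h x = 0" using AE_completion by blast
  with AEh have "AE x in lebesgue. x \<in> {0<..<1} \<longrightarrow> f x = 0" by eventually_elim (auto simp: indicator_def)
  then have "AE x in unit_leb. f x = 0" by (simp add: AE_restrict_space_iff)
  then have "L2_eq f (\<lambda>x. 0)" using f square_integrable_zero by (simp add: L2_eq_def)
  then have "abs_L2 f = abs_L2 (\<lambda>x. 0)"
    using Quotient_rel[OF Quotient_L2, of f "\<lambda>x. 0"] L2_eq_def square_integrable_zero by blast
  then show ?thesis
    by (simp add: f(2) zero_L2.abs_eq)
qed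

section \<open>The Galerkin semigroup in coordinates\<close>

text \<open>Applied twice, this makes the definite description in \<open>A_op\<close> single-valued
  wherever two weak derivatives exist.\<close>

lemma weak_deriv_unique:
  assumes "weak_deriv u g" "weak_deriv u g'"
  shows "g = g'"
proof -
  have "g - g' = 0"
    by (rule fundamental_lemma) (use assms in \<open>auto simp: weak_deriv_def inner_diff_left\<close>)
  then show ?thesis by simp
qed

lemma weak_deriv_sum:
  assumes "\<And>i. i \<in> I \<Longrightarrow> weak_deriv (u i) (g i)"
  shows "weak_deriv (\<Sum>i\<in>I. c i *\<^sub>R u i) (\<Sum>i\<in>I. c i *\<^sub>R g i)"
  using assms by (simp add: weak_deriv_def inner_sum_left sum_negf[symmetric])

section \<open>The sine basis: eigenfunctions and coordinates\<close>

lemma square_integrable_sin: "square_integrable (\<lambda>x. c * sin (a * x))"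
  by (intro continuous_square_integrable continuous_intros)

lemma weak_deriv_e_basis:
  defines "g \<equiv> \<lambda>i. abs_L2 (\<lambda>x. sqrt 2 * (real i * pi) * cos (real i * pi * x))"
  shows "weak_deriv (e_basis i) (g i)" "weak_deriv (g i) (- eigval i *\<^sub>R e_basis i)"
proof -
  show "weak_deriv (e_basis i) (g i)"
    unfolding e_basis_def g_def
    by (rule weak_deriv_classical) (auto intro!: derivative_eq_intros continuous_intros)
  have "- eigval i *\<^sub>R e_basis i = abs_L2 (\<lambda>x. - eigval i * (sqrt 2 * sin (real i * pi * x)))"
    unfolding e_basis_def
    by (rule scaleR_L2.abs_eq) (use square_integrable_sin in \<open>auto simp: L2_eq_def\<close>)
  moreover have "weak_deriv (g i) (abs_L2 (\<lambda>x. - eigval i * (sqrt 2 * sin (real i * pi * x))))"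
    unfolding g_def
    by (rule weak_deriv_classical)
      (auto intro!: derivative_eq_intros continuous_intros simp: eigval_def power2_eq_square)
  ultimately show "weak_deriv (g i) (- eigval i *\<^sub>R e_basis i)" by simp
qed

abbreviation coord :: "nat \<Rightarrow> L2 \<Rightarrow> real" where
  "coord k v \<equiv> inner v (e_basis k)"

lemma inner_e_basis:
  assumes "1 \<le> i" "1 \<le> j"
  shows "coord j (e_basis i) = (if i = j then 1 else 0)"
proof -
  have sin0: "sin ((real i - real j) * pi) = 0" "sin ((real i + real j) * pi) = 0" "sin (2 * real i * pi) = 0"
    by (simp_all add: sin_times_pi_eq_0)
  have "coord j (e_basis i)
      = (LINT x|unit_leb. (sqrt 2 * sin (real i * pi * x)) * (sqrt 2 * sin (real j * pi * x)))"
    unfolding e_basis_def using square_integrable_sin by (intro inner_abs_L2) auto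
  also have "\<dots> = integral {0..1} (\<lambda>x. (sqrt 2 * sin (real i * pi * x)) * (sqrt 2 * sin (real j * pi * x)))"
    by (intro unit_integral_eq continuous_intros)
  also have "\<dots> = integral {0..1} (\<lambda>x. cos ((real i - real j) * pi * x) - cos ((real i + real j) * pi * x))"
  proof (intro integral_cong)
    fix x :: real
    have "(sqrt 2 * sin (real i * pi * x)) * (sqrt 2 * sin (real j * pi * x))
        = 2 * (sin (real i * pi * x) * sin (real j * pi * x))" by simp
    also have "\<dots> = cos ((real i - real j) * pi * x) - cos ((real i + real j) * pi * x)"
      by (simp add: sin_times_sin left_diff_distrib distrib_right)
    finally show "(sqrt 2 * sin (real i * pi * x)) * (sqrt 2 * sin (real j * pi * x)) = \<dots>" .
  qed
  also have "\<dots> = (if i = j then 1 else 0)"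
  proof (cases "i = j")
    case True
    have "((\<lambda>x. 1 - cos (2 * real i * pi * x)) has_integral
        ((1 - sin (2 * real i * pi * 1) / (2 * real i * pi)) - (0 - sin (2 * real i * pi * 0) / (2 * real i * pi)))) {0..1}"
      using assms by (intro fundamental_theorem_of_calculus)
        (auto intro!: derivative_eq_intros simp flip: has_real_derivative_iff_has_vector_derivative)
    then show ?thesis using True sin0 by (simp add: integral_unique mult.assoc)
  next
    case False
    have "((\<lambda>x. cos ((real i - real j) * pi * x) - cos ((real i + real j) * pi * x)) has_integral
        ((sin ((real i - real j) * pi * 1) / ((real i - real j) * pi) - sin ((real i + real j) * pi * 1) / ((real i + real j) * pi))
        - (sin ((real i - real j) * pi * 0) / ((real i - real j) * pi) - sin ((real i + real j) * pi * 0) / ((real i + real j) * pi)))) {0..1}"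
      using assms False by (intro fundamental_theorem_of_calculus)
        (auto intro!: derivative_eq_intros simp flip: has_real_derivative_iff_has_vector_derivative)
    then show ?thesis using False sin0 by (simp add: integral_unique)
  qed
  finally show ?thesis .
qed

lemma inner_sum_e_basis:
  assumes "1 \<le> k" "k \<le> n"
  shows "coord k (\<Sum>i=1..n. c i *\<^sub>R e_basis i) = c k"
proof -
  have "coord k (\<Sum>i=1..n. c i *\<^sub>R e_basis i) = (\<Sum>i=1..n. if i = k then c i else 0)"
    unfolding inner_sum_left inner_scaleR_left
    by (intro sum.cong refl) (use assms in \<open>auto simp: inner_e_basis\<close>)
  then show ?thesis using assms by simp
qed

lemma norm_sum_e_basis: "(norm (\<Sum>i=1..n. c i *\<^sub>R e_basis i))^2 = (\<Sum>i=1..n. (c i)^2)"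
proof -
  have "(norm (\<Sum>i=1..n. c i *\<^sub>R e_basis i))^2 = (\<Sum>k=1..n. c k * coord k (\<Sum>i=1..n. c i *\<^sub>R e_basis i))"
    by (simp add: power2_norm_eq_inner inner_sum_right)
  also have "\<dots> = (\<Sum>k=1..n. c k * c k)"
    by (intro sum.cong) (simp_all add: inner_sum_e_basis del: One_nat_def)
  finally show ?thesis by (simp add: power2_eq_square)
qed

lemma norm_e_basis: "1 \<le> k \<Longrightarrow> norm (e_basis k) = 1"
  by (simp add: norm_eq_sqrt_inner inner_e_basis)

lemma sum_e_basis_in_Hn: "(\<Sum>i=1..n. c i *\<^sub>R e_basis i) \<in> Hn n"
  unfolding Hn_def by (intro span_sum span_scale span_base) auto

lemma Pn_in_Hn: "Pn n u \<in> Hn n"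
  unfolding Pn_def by (rule sum_e_basis_in_Hn)

lemma inner_Pn: "1 \<le> k \<Longrightarrow> k \<le> n \<Longrightarrow> coord k (Pn n u) = coord k u"
  unfolding Pn_def by (rule inner_sum_e_basis)

lemma Hn_expansion:
  assumes "v \<in> Hn n"
  shows "v = (\<Sum>i=1..n. coord i v *\<^sub>R e_basis i)"
proof -
  have "Pn n v = v"
    using assms unfolding Hn_def
  proof (induction rule: span_induct_alt)
    case base
    then show ?case by (simp add: Pn_def)
  next
    case (step c x y)
    then obtain k where k: "k \<in> {1..n}" "x = e_basis k" by auto
    have "Pn n x = (\<Sum>i=1..n. if i = k then e_basis k else 0)"
      unfolding Pn_def by (intro sum.cong refl) (use k in \<open>auto simp: inner_e_basis\<close>)
    then have "Pn n x = x" using k by simp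
    moreover have "Pn n (c *\<^sub>R x + y) = c *\<^sub>R Pn n x + Pn n y"
      by (simp add: Pn_def inner_add_left scaleR_add_left sum.distrib scaleR_sum_right)
    ultimately show ?case using step by simp
  qed
  then show ?thesis by (simp add: Pn_def)
qed

lemma Hn_norm: "v \<in> Hn n \<Longrightarrow> (norm v)^2 = (\<Sum>i=1..n. (coord i v)^2)"
  using norm_sum_e_basis[of "\<lambda>i. coord i v" n] Hn_expansion[of v n] by simp

text \<open>Sine polynomials have two classical derivatives, so uniqueness evaluates the definite
  description in \<open>A_op\<close>; the result already lies in \<open>Hn n\<close>, where
  \<open>Pn\<close> is the identity.\<close>

lemma An_Hn:
  "An n (\<Sum>i=1..n. c i *\<^sub>R e_basis i) = (\<Sum>i=1..n. (- eigval i * c i) *\<^sub>R e_basis i)"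
proof -
  let ?g = "\<lambda>i. abs_L2 (\<lambda>x. sqrt 2 * (real i * pi) * cos (real i * pi * x))"
  let ?u = "\<Sum>i=1..n. c i *\<^sub>R e_basis i"
  have w: "weak_deriv ?u (\<Sum>i=1..n. c i *\<^sub>R ?g i)"
    "weak_deriv (\<Sum>i=1..n. c i *\<^sub>R ?g i) (\<Sum>i=1..n. c i *\<^sub>R (- eigval i *\<^sub>R e_basis i))"
    by (intro weak_deriv_sum weak_deriv_e_basis)+
  have "A_op ?u = (\<Sum>i=1..n. c i *\<^sub>R (- eigval i *\<^sub>R e_basis i))"
    unfolding A_op_def
  proof (rule the_equality)
    show "\<exists>g. weak_deriv ?u g \<and> weak_deriv g (\<Sum>i=1..n. c i *\<^sub>R (- eigval i *\<^sub>R e_basis i))"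
      using w by blast
  next
    fix h assume "\<exists>g. weak_deriv ?u g \<and> weak_deriv g h"
    then show "h = (\<Sum>i=1..n. c i *\<^sub>R (- eigval i *\<^sub>R e_basis i))"
      using w weak_deriv_unique by blast
  qed
  then have "A_op ?u = (\<Sum>i=1..n. (- eigval i * c i) *\<^sub>R e_basis i)"
    by (simp add: mult.commute)
  then show ?thesis
    unfolding An_def using Hn_expansion[OF sum_e_basis_in_Hn] by (metis Pn_def)
qed

text \<open>\<open>An n\<close> is diagonal on \<open>Hn n\<close>, so its exponential series
  converges coordinatewise to scalar exponentials. Elsewhere \<open>A_op\<close> may be applied to a
  function without weak derivatives, hence the restriction on \<open>v\<close>.\<close>

lemma semigroup_n_Hn:
  assumes "v \<in> Hn n"
  shows "semigroup_n n t v = (\<Sum>i=1..n. (exp (- eigval i * t) * coord i v) *\<^sub>R e_basis i)"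
proof -
  let ?c = "\<lambda>i. coord i v"
  have pow: "(An n ^^ k) v = (\<Sum>i=1..n. ((- eigval i) ^ k * ?c i) *\<^sub>R e_basis i)" for k
  proof (induction k)
    case 0
    then show ?case using Hn_expansion[OF assms] by simp
  next
    case (Suc k)
    have "(An n ^^ Suc k) v = An n (\<Sum>i=1..n. ((- eigval i) ^ k * ?c i) *\<^sub>R e_basis i)"
      using Suc by simp
    also have "\<dots> = (\<Sum>i=1..n. (- eigval i * ((- eigval i) ^ k * ?c i)) *\<^sub>R e_basis i)"
      by (rule An_Hn)
    finally show ?case by (simp only: power_Suc mult.assoc)
  qed
  have s: "(\<lambda>k. (\<Sum>i=1..n. ((t ^ k / fact k) * ((- eigval i) ^ k * ?c i)) *\<^sub>R e_basis i))
      sums (\<Sum>i=1..n. (exp (- eigval i * t) * ?c i) *\<^sub>R e_basis i)"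
  proof (intro sums_sum)
    fix i
    have "(\<lambda>k. (- eigval i * t) ^ k /\<^sub>R fact k) sums exp (- eigval i * t)" by (rule exp_converges)
    then have "(\<lambda>k. ((- eigval i * t) ^ k /\<^sub>R fact k) * ?c i) sums (exp (- eigval i * t) * ?c i)"
      by (rule sums_mult2)
    moreover have "((- eigval i * t) ^ k /\<^sub>R fact k) * ?c i = (t ^ k / fact k) * ((- eigval i) ^ k * ?c i)" for k
      by (simp only: power_mult_distrib real_scaleR_def) (simp add: field_simps)
    ultimately have "(\<lambda>k. (t ^ k / fact k) * ((- eigval i) ^ k * ?c i)) sums (exp (- eigval i * t) * ?c i)"
      by simp
    then show "(\<lambda>k. ((t ^ k / fact k) * ((- eigval i) ^ k * ?c i)) *\<^sub>R e_basis i) sums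
       ((exp (- eigval i * t) * ?c i) *\<^sub>R e_basis i)"
      by (rule bounded_linear.sums[OF bounded_linear_scaleR_left])
  qed
  then show ?thesis
    unfolding semigroup_n_def pow by (simp add: scaleR_sum_right sums_iff)
qed

lemma inner_semigroup_n:
  assumes "v \<in> Hn n" "1 \<le> k" "k \<le> n"
  shows "coord k (semigroup_n n t v) = exp (- eigval k * t) * coord k v"
  unfolding semigroup_n_Hn[OF assms(1)] by (rule inner_sum_e_basis[OF assms(2,3)])

lemma semigroup_n_in_Hn: "v \<in> Hn n \<Longrightarrow> semigroup_n n t v \<in> Hn n"
  unfolding semigroup_n_Hn by (rule sum_e_basis_in_Hn)

lemma semigroup_n_zero: "semigroup_n n t 0 = 0"
  by (subst semigroup_n_Hn) (simp_all add: Hn_def span_zero)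

lemma eigval_mono: "1 \<le> k \<Longrightarrow> eigval 1 \<le> eigval k"
  by (simp add: eigval_def one_le_power)

lemma eigval_pos: "1 \<le> k \<Longrightarrow> 0 < eigval k"
  by (simp add: eigval_def)

section \<open>Exponential moments of elementary Wiener integrals\<close>

text \<open>A list of triples (a, b, c) codes the step function that is a sum of c times the
  indicator of (a, b]; intervals may overlap, so sums and multiples are mere list operations. The
  functional is kept general in \<open>g\<close>: with a Brownian path it is the Wiener integral,
  with \<open>min t\<close> it is the primitive of the step function at t.\<close>

definition elem_int :: "(real \<Rightarrow> real) \<Rightarrow> (real \<times> real \<times> real) list \<Rightarrow> real" where
  "elem_int g xs = (\<Sum>(a, b, c)\<leftarrow>xs. c * (g b - g a))"

text \<open>The same functional with \<open>g\<close> the indicator of the times from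
  \<open>s\<close> on: the difference of its values at b and a is the indicator of (a, b], left-open
  as in \<open>step_fun\<close>.\<close>

definition elem_fun :: "(real \<times> real \<times> real) list \<Rightarrow> real \<Rightarrow> real" where
  "elem_fun xs s = elem_int (\<lambda>t. if s \<le> t then 1 else 0) xs"

definition wf_elem :: "(real \<times> real \<times> real) list \<Rightarrow> bool" where
  "wf_elem xs \<longleftrightarrow> (\<forall>(a, b, c)\<in>set xs. 0 \<le> a \<and> a \<le> b)"

lemma elem_int_Nil [simp]: "elem_int g [] = 0"
  by (simp add: elem_int_def)

lemma elem_int_Cons [simp]: "elem_int g ((a, b, c) # xs) = c * (g b - g a) + elem_int g xs"
  by (simp add: elem_int_def)

lemma elem_int_append: "elem_int g (xs @ ys) = elem_int g xs + elem_int g ys"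
  by (simp add: elem_int_def)

lemma elem_int_scale: "elem_int g (map (\<lambda>(a, b, c). (a, b, r * c)) xs) = r * elem_int g xs"
  by (induction xs) (auto simp: algebra_simps)

lemma elem_fun_append: "elem_fun (xs @ ys) s = elem_fun xs s + elem_fun ys s"
  by (simp add: elem_fun_def elem_int_append)

lemma elem_fun_scale: "elem_fun (map (\<lambda>(a, b, c). (a, b, r * c)) xs) s = r * elem_fun xs s"
  by (simp add: elem_fun_def elem_int_scale)

lemma wf_elem_append [simp]: "wf_elem (xs @ ys) \<longleftrightarrow> wf_elem xs \<and> wf_elem ys"
  by (simp only: wf_elem_def set_append ball_Un)

lemma wf_elem_Cons [simp]: "wf_elem ((a, b, c) # xs) \<longleftrightarrow> 0 \<le> a \<and> a \<le> b \<and> wf_elem xs"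
  by (auto simp: wf_elem_def)

lemma wf_elem_scale [simp]: "wf_elem (map (\<lambda>(a, b, c). (a, b, r * c)) xs) \<longleftrightarrow> wf_elem xs"
  by (auto simp: wf_elem_def)

section \<open>Common refinement of the intervals\<close>

lemma telescope_between:
  fixes g :: "real \<Rightarrow> real"
  assumes "p \<le> q" "q \<le> N"
  shows "(\<Sum>k<N. (if p \<le> k \<and> k < q then c else 0) * (g (ts (Suc k)) - g (ts k))) = c * (g (ts q) - g (ts p))"
proof -
  have "(\<Sum>k<N. (if p \<le> k \<and> k < q then c else 0) * (g (ts (Suc k)) - g (ts k)))
      = (\<Sum>k\<in>{p..<q}. c * (g (ts (Suc k)) - g (ts k)))"
    using assms by (intro sum.mono_neutral_cong_right) auto
  also have "\<dots> = c * (g (ts q) - g (ts p))"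
    using sum_Suc_diff'[OF assms(1), of "\<lambda>k. g (ts k)"] by (simp add: sum_distrib_left[symmetric])
  finally show ?thesis .
qed

text \<open>All endpoints are sorted into one strictly increasing grid, and a telescoping sum
  distributes each interval over its cells. The coefficients \<open>d\<close> do not depend on
  \<open>g\<close>, so the Wiener integral and its integrand share them; strictness is what the laws
  of Brownian increments ask for.\<close>

lemma elem_int_grid:
  assumes "wf_elem xs"
  obtains N ts d where "0 \<le> ts 0" "\<And>k. k < N \<Longrightarrow> ts k < ts (Suc k)"
    "\<And>g. elem_int g xs = (\<Sum>k<N. d k * (g (ts (Suc k)) - g (ts k)))"
proof -
  \<comment> \<open>The point 0 keeps the grid nonempty when the list is empty.\<close>
  define S where "S = insert 0 ((\<lambda>(a, b, c). a) ` set xs \<union> (\<lambda>(a, b, c). b) ` set xs)"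
  define l where "l = sorted_list_of_set S"
  define N where "N = length l - 1"
  define ts where "ts = (\<lambda>k. l ! k)"
  have fin: "finite S" "S \<noteq> {}" by (auto simp: S_def)
  then have l: "set l = S" "sorted_wrt (<) l" "l \<noteq> []"
    by (auto simp: l_def)
  then have len: "length l = Suc N" by (simp add: N_def)
  have S0: "x \<ge> 0" if "x \<in> S" for x using that assms by (auto simp: S_def wf_elem_def)
  have mono: "ts k < ts m" if "k < m" "m \<le> N" for k m
    using that l(2) len by (auto simp: ts_def sorted_wrt_iff_nth_less)
  have mono': "p \<le> q" if "ts p \<le> ts q" "p \<le> N" "q \<le> N" for p q
    using that mono[of q p] by (meson leD leI)
  have ex: "\<exists>k\<le>N. ts k = x" if "x \<in> S" for x
    using that l len by (auto simp: ts_def in_set_conv_nth less_Suc_eq_le)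
  have rep: "\<exists>d. \<forall>g. elem_int g ys = (\<Sum>k<N. d k * (g (ts (Suc k)) - g (ts k)))"
    if "set ys \<subseteq> set xs" for ys
    using that
  proof (induction ys)
    case Nil
    show ?case by (rule exI[of _ "\<lambda>k. 0"]) simp
  next
    case (Cons y ys)
    obtain a b c where y: "y = (a, b, c)" by (cases y)
    then have abc: "(a, b, c) \<in> set xs" using Cons by auto
    then have "a \<in> (\<lambda>(a, b, c). a) ` set xs" "b \<in> (\<lambda>(a, b, c). b) ` set xs"
      by (auto intro!: rev_image_eqI[OF abc])
    then have "a \<in> S" "b \<in> S" by (auto simp: S_def)
    have "a \<le> b" using assms abc by (auto simp: wf_elem_def)
    obtain p q where pq: "p \<le> N" "q \<le> N" "ts p = a" "ts q = b"
      using ex[OF \<open>a \<in> S\<close>] ex[OF \<open>b \<in> S\<close>] by blast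
    then have "p \<le> q" using mono' \<open>a \<le> b\<close> by auto
    obtain d where d: "\<And>g. elem_int g ys = (\<Sum>k<N. d k * (g (ts (Suc k)) - g (ts k)))"
      using Cons by auto
    show ?case
    proof (intro exI allI)
      fix g
      show "elem_int g (y # ys) = (\<Sum>k<N. ((if p \<le> k \<and> k < q then c else 0) + d k) * (g (ts (Suc k)) - g (ts k)))"
        using telescope_between[OF \<open>p \<le> q\<close> \<open>q \<le> N\<close>, of c g ts] pq
        by (simp add: y d distrib_right sum.distrib)
    qed
  qed
  have "ts 0 \<in> S" using l len by (auto simp: ts_def)
  then have "0 \<le> ts 0" using S0 by blast
  moreover obtain d where "\<And>g. elem_int g xs = (\<Sum>k<N. d k * (g (ts (Suc k)) - g (ts k)))"
    using rep[of xs] by auto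
  ultimately show ?thesis using that mono by (metis Suc_leI lessI)
qed

text \<open>The cells are disjoint, so in the square all products of different cells vanish.\<close>

lemma grid_square_integral:
  fixes ts d :: "nat \<Rightarrow> real"
  assumes mono: "\<And>k. k < N \<Longrightarrow> ts k \<le> ts (Suc k)"
  defines "h \<equiv> \<lambda>s. \<Sum>k<N. d k * ((if s \<le> ts (Suc k) then 1 else 0) - (if s \<le> ts k then 1 else (0::real)))"
  shows "integrable lborel (\<lambda>s. (h s)^2)"
    "(LINT s|lborel. (h s)^2) = (\<Sum>k<N. (d k)^2 * (ts (Suc k) - ts k))"
proof -
  have le: "ts k \<le> ts m" if "k \<le> m" "m \<le> N" for k m
    using that
  proof (induction m rule: dec_induct)
    case (step j)
    then show ?case using mono[of j] by force
  qed simp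
  have h: "h s = (\<Sum>k<N. d k * indicator {ts k<..ts (Suc k)} s)" for s
    unfolding h_def
  proof (intro sum.cong refl)
    fix k assume "k \<in> {..<N}"
    then have "ts k \<le> ts (Suc k)" using mono by simp
    then show "d k * ((if s \<le> ts (Suc k) then 1 else 0) - (if s \<le> ts k then 1 else 0))
        = d k * indicator {ts k<..ts (Suc k)} s"
      by (auto simp: indicator_def)
  qed
  have sq: "(h s)^2 = (\<Sum>k<N. (d k)^2 * indicator {ts k<..ts (Suc k)} s)" for s
  proof -
    have "(h s)^2 = (\<Sum>k<N. \<Sum>m<N. (d k * indicator {ts k<..ts (Suc k)} s) * (d m * indicator {ts m<..ts (Suc m)} s))"
      by (simp only: h power2_eq_square sum_product)
    also have "\<dots> = (\<Sum>k<N. \<Sum>m<N. if m = k then (d k)^2 * indicator {ts k<..ts (Suc k)} s else 0)"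
    proof (intro sum.cong refl)
      fix k m assume km: "k \<in> {..<N}" "m \<in> {..<N}"
      show "(d k * indicator {ts k<..ts (Suc k)} s) * (d m * indicator {ts m<..ts (Suc m)} s)
        = (if m = k then (d k)^2 * indicator {ts k<..ts (Suc k)} s else 0)"
      proof (cases m k rule: linorder_cases)
        case less
        then have "ts (Suc m) \<le> ts k" using km by (intro le) auto
        then show ?thesis using less by (auto simp: indicator_def)
      next
        case greater
        then have "ts (Suc k) \<le> ts m" using km by (intro le) auto
        then show ?thesis using greater by (auto simp: indicator_def)
      qed (auto simp: indicator_def power2_eq_square)
    qed
    finally show ?thesis by simp
  qed
  have i: "integrable lborel (\<lambda>s. (d k)^2 * indicator {ts k<..ts (Suc k)} s)" if "k \<in> {..<N}" for k
    using mono[of k] that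
    by (intro integrable_mult_right integrable_real_indicator) auto
  show "integrable lborel (\<lambda>s. (h s)^2)" unfolding sq by (intro Bochner_Integration.integrable_sum i)
  have "(LINT s|lborel. (h s)^2) = (\<Sum>k<N. LINT s|lborel. (d k)^2 * indicator {ts k<..ts (Suc k)} s)"
    unfolding sq by (intro Bochner_Integration.integral_sum i)
  also have "\<dots> = (\<Sum>k<N. (d k)^2 * (ts (Suc k) - ts k))"
    by (intro sum.cong refl) (use mono in simp)
  finally show "(LINT s|lborel. (h s)^2) = (\<Sum>k<N. (d k)^2 * (ts (Suc k) - ts k))" .
qed

text \<open>Expectations are taken in \<open>ennreal\<close>, so that exponential moments can be
  compared and passed to limits without separate proofs of integrability.\<close>

abbreviation nn_mean :: "'a measure \<Rightarrow> ('a \<Rightarrow> real) \<Rightarrow> ennreal" where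
  "nn_mean M f \<equiv> \<integral>\<^sup>+\<omega>. ennreal (f \<omega>) \<partial>M"

text \<open>Completing the square: the exponential weight moves the mean of the Gaussian density to
  \<open>c * \<sigma>^2\<close> and leaves a constant factor.\<close>

lemma (in prob_space) normal_mgf:
  assumes D: "distributed M lborel D (normal_density 0 \<sigma>)" and "\<sigma> > 0"
  shows "nn_mean M (\<lambda>\<omega>. exp (c * D \<omega>)) = ennreal (exp (c^2 * \<sigma>^2 / 2))"
proof -
  have e: "normal_density 0 \<sigma> x * exp (c * x) = exp (c^2 * \<sigma>^2 / 2) * normal_density (c * \<sigma>^2) \<sigma> x" for x
  proof -
    have "- (x^2 / (2 * \<sigma>^2)) + c * x = c^2 * \<sigma>^2 / 2 + - ((x - c * \<sigma>^2)^2 / (2 * \<sigma>^2))"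
      using \<open>\<sigma> > 0\<close> by (simp add: field_simps power2_eq_square)
    then show ?thesis by (simp add: normal_density_def exp_add[symmetric])
  qed
  have "nn_mean M (\<lambda>\<omega>. exp (c * D \<omega>)) = (\<integral>\<^sup>+x. ennreal (normal_density 0 \<sigma> x) * ennreal (exp (c * x)) \<partial>lborel)"
    by (rule distributed_nn_integral[OF D, symmetric]) simp
  also have "\<dots> = (\<integral>\<^sup>+x. ennreal (exp (c^2 * \<sigma>^2 / 2) * normal_density (c * \<sigma>^2) \<sigma> x) \<partial>lborel)"
    by (simp add: ennreal_mult[symmetric] e)
  also have "\<dots> = ennreal (LINT x|lborel. exp (c^2 * \<sigma>^2 / 2) * normal_density (c * \<sigma>^2) \<sigma> x)"
    using \<open>\<sigma> > 0\<close> by (intro nn_integral_eq_integral) auto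
  also have "(LINT x|lborel. exp (c^2 * \<sigma>^2 / 2) * normal_density (c * \<sigma>^2) \<sigma> x) = exp (c^2 * \<sigma>^2 / 2)"
    using \<open>\<sigma> > 0\<close> by simp
  finally show ?thesis .
qed

lemma elem_fun_integrable:
  assumes "wf_elem xs"
  shows "integrable lborel (\<lambda>s. (elem_fun xs s)^2)" "elem_fun xs \<in> borel_measurable borel"
proof -
  obtain N ts d where g: "0 \<le> ts 0" "\<And>k. k < N \<Longrightarrow> ts k < ts (Suc k)"
    "\<And>g. elem_int g xs = (\<Sum>k<N. d k * (g (ts (Suc k)) - g (ts k)))"
    by (rule elem_int_grid[OF assms]) blast
  show "integrable lborel (\<lambda>s. (elem_fun xs s)^2)"
    unfolding elem_fun_def g(3) by (rule grid_square_integral) (use g(2) less_imp_le in blast)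
  show "elem_fun xs \<in> borel_measurable borel"
    unfolding elem_fun_def g(3) by measurable
qed

abbreviation elem_energy :: "(real \<times> real \<times> real) list \<Rightarrow> real" where
  "elem_energy xs \<equiv> LINT s|lborel. (elem_fun xs s)^2"

text \<open>On the common grid the integral is a combination of independent Gaussian increments, so
  the exponential moment factorises and the exponents add up to half of the energy.\<close>

lemma (in prob_space) standard_BM_mgf:
  assumes B: "standard_BM M B" and xs: "wf_elem xs"
  shows "nn_mean M (\<lambda>\<omega>. exp (elem_int (\<lambda>t. B t \<omega>) xs))
    = ennreal (exp (elem_energy xs / 2))"
proof -
  obtain N ts d where g: "0 \<le> ts 0" "\<And>k. k < N \<Longrightarrow> ts k < ts (Suc k)"
    "\<And>g. elem_int g xs = (\<Sum>k<N. d k * (g (ts (Suc k)) - g (ts k)))"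
    by (rule elem_int_grid[OF xs]) blast
  have le: "ts 0 \<le> ts m" if "m \<le> N" for m
    using that
  proof (induction m)
    case (Suc m)
    then show ?case using g(2)[of m] by force
  qed simp
  have ind: "indep_vars (\<lambda>_. borel) (\<lambda>j \<omega>. B (ts (Suc j)) \<omega> - B (ts j) \<omega>) {..<N}"
    using B g(1,2) unfolding standard_BM_def by blast
  have ind': "indep_vars (\<lambda>_. borel) (\<lambda>j \<omega>. ennreal (exp (d j * (B (ts (Suc j)) \<omega> - B (ts j) \<omega>)))) {..<N}"
    by (rule indep_vars_compose2[OF ind]) simp
  have D: "distributed M lborel (\<lambda>\<omega>. B (ts (Suc j)) \<omega> - B (ts j) \<omega>) (normal_density 0 (sqrt (ts (Suc j) - ts j)))"
    if "j < N" for j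
    using B g(1) g(2)[OF that] le[of j] that unfolding standard_BM_def by (meson less_imp_le_nat order_trans)
  have "nn_mean M (\<lambda>\<omega>. exp (elem_int (\<lambda>t. B t \<omega>) xs))
      = (\<integral>\<^sup>+\<omega>. (\<Prod>j<N. ennreal (exp (d j * (B (ts (Suc j)) \<omega> - B (ts j) \<omega>)))) \<partial>M)"
    by (simp add: g(3) exp_sum prod_ennreal)
  also have "\<dots> = (\<Prod>j<N. nn_mean M (\<lambda>\<omega>. exp (d j * (B (ts (Suc j)) \<omega> - B (ts j) \<omega>))))"
    by (rule indep_vars_nn_integral[OF _ ind']) auto
  also have "\<dots> = (\<Prod>j<N. ennreal (exp ((d j)^2 * (sqrt (ts (Suc j) - ts j))^2 / 2)))"
    by (intro prod.cong refl normal_mgf D) (use g(2) in auto)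
  also have "\<dots> = ennreal (exp (\<Sum>j<N. (d j)^2 * (ts (Suc j) - ts j) / 2))"
    using g(2) by (simp add: prod_ennreal exp_sum less_imp_le)
  also have "(\<Sum>j<N. (d j)^2 * (ts (Suc j) - ts j) / 2) = elem_energy xs / 2"
    unfolding elem_fun_def g(3)
    by (subst grid_square_integral) (use g(2) in \<open>auto simp: sum_divide_distrib less_imp_le\<close>)
  finally show ?thesis .
qed

lemma elem_int_cong:
  assumes "wf_elem xs" "\<And>t. 0 \<le> t \<Longrightarrow> g t = h t"
  shows "elem_int g xs = elem_int h xs"
  using assms(1) by (induction xs) (auto simp: assms(2))

abbreviation elem_Wiener :: "(nat \<Rightarrow> real \<Rightarrow> 'w \<Rightarrow> real) \<Rightarrow> nat \<Rightarrow> 'w \<Rightarrow> (real \<times> real \<times> real) list \<Rightarrow> real" where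
  "elem_Wiener \<beta> i \<omega> xs \<equiv> elem_int (\<lambda>t. \<beta> i t \<omega>) xs"

lemma (in prob_space) cylindrical_Wiener_mgf:
  assumes W: "cylindrical_Wiener M \<beta>" and I: "finite I" "I \<subseteq> {1..}" and xs: "\<And>i. i \<in> I \<Longrightarrow> wf_elem (xs i)"
  shows "nn_mean M (\<lambda>\<omega>. exp (\<Sum>i\<in>I. elem_Wiener \<beta> i \<omega> (xs i)))
    = ennreal (exp ((\<Sum>i\<in>I. elem_energy (xs i)) / 2))"
proof -
  have "indep_vars (\<lambda>_. \<Pi>\<^sub>M t\<in>{0..}. borel) (\<lambda>i \<omega>. \<lambda>t\<in>{0..}. \<beta> i t \<omega>) I"
    using W I indep_vars_subset unfolding cylindrical_Wiener_def by blast
  \<comment> \<open>Independence is given for whole paths; the elementary integral is a measurable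
    functional of the path since it reads only finitely many coordinates.\<close>
  moreover have "(\<lambda>g. ennreal (exp (elem_int g ys))) \<in> borel_measurable (\<Pi>\<^sub>M t\<in>{0..}. borel)"
    if "wf_elem ys" for ys
  proof -
    have "(\<lambda>g. elem_int g ys) \<in> borel_measurable (\<Pi>\<^sub>M t\<in>{0..}. borel)"
      using that
    proof (induction ys)
      case (Cons y ys)
      obtain a b c where y: "y = (a, b, c)" by (cases y)
      have "(\<lambda>g. c * (g b - g a) + elem_int g ys) \<in> borel_measurable (\<Pi>\<^sub>M t\<in>{0..}. borel)"
        using Cons y by (intro borel_measurable_add borel_measurable_times borel_measurable_diff
          borel_measurable_const measurable_component_singleton) auto
      then show ?case by (simp add: y)
    qed simp
    then show ?thesis by simp
  qed
  ultimately have "indep_vars (\<lambda>_. borel) (\<lambda>i \<omega>. ennreal (exp (elem_int (\<lambda>t\<in>{0..}. \<beta> i t \<omega>) (xs i)))) I"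
    using xs by (rule_tac indep_vars_compose2[where X="\<lambda>i \<omega>. \<lambda>t\<in>{0..}. \<beta> i t \<omega>"]) auto
  moreover have "elem_int (\<lambda>t\<in>{0..}. \<beta> i t \<omega>) (xs i) = elem_Wiener \<beta> i \<omega> (xs i)" if "i \<in> I" for i \<omega>
    by (rule elem_int_cong[OF xs[OF that]]) simp
  ultimately have ind: "indep_vars (\<lambda>_. borel) (\<lambda>i \<omega>. ennreal (exp (elem_Wiener \<beta> i \<omega> (xs i)))) I"
    by (subst (asm) indep_vars_cong[OF refl _ refl, where Y="\<lambda>i \<omega>. ennreal (exp (elem_Wiener \<beta> i \<omega> (xs i)))"]) auto
  have "nn_mean M (\<lambda>\<omega>. exp (\<Sum>i\<in>I. elem_Wiener \<beta> i \<omega> (xs i)))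
      = (\<integral>\<^sup>+\<omega>. (\<Prod>i\<in>I. ennreal (exp (elem_Wiener \<beta> i \<omega> (xs i)))) \<partial>M)"
    using I by (simp add: exp_sum prod_ennreal)
  also have "\<dots> = (\<Prod>i\<in>I. nn_mean M (\<lambda>\<omega>. exp (elem_Wiener \<beta> i \<omega> (xs i))))"
    by (rule indep_vars_nn_integral[OF I(1) ind]) auto
  also have "\<dots> = (\<Prod>i\<in>I. ennreal (exp (elem_energy (xs i) / 2)))"
    by (intro prod.cong refl standard_BM_mgf xs) (use W I in \<open>auto simp: cylindrical_Wiener_def\<close>)
  also have "\<dots> = ennreal (exp ((\<Sum>i\<in>I. elem_energy (xs i)) / 2))"
    using I by (simp add: prod_ennreal exp_sum sum_divide_distrib)
  finally show ?thesis .
qed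

section \<open>Approximation of Wiener integrals\<close>

text \<open>Pairing with a unit vector is a contraction, so the approximating step functions and
  step integrals may be paired as well. This reduces the \<open>L2\<close>-valued integrals to
  scalar ones, mode by mode.\<close>

lemma is_Wiener_integral_inner:
  fixes f :: "real \<Rightarrow> L2"
  assumes "is_Wiener_integral M B t f Y" and e: "norm e = 1"
  shows "is_Wiener_integral M B t (\<lambda>s. inner (f s) e) (\<lambda>\<omega>. inner (Y \<omega>) e)"
proof -
  obtain ts :: "nat \<Rightarrow> nat \<Rightarrow> real" and c :: "nat \<Rightarrow> nat \<Rightarrow> L2" and k :: "nat \<Rightarrow> nat" where Y: "Y \<in> borel_measurable M"
    and ts: "\<forall>m. ts m 0 = 0 \<and> ts m (k m) = t \<and> (\<forall>j<k m. ts m j \<le> ts m (Suc j))"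
    and f: "(\<lambda>m. \<integral>\<^sup>+s\<in>{0..t}. ennreal ((norm (step_fun (ts m) (c m) (k m) s - f s))^2) \<partial>lborel) \<longlonglongrightarrow> 0"
    and i: "(\<lambda>m. nn_mean M (\<lambda>\<omega>. (norm (step_integral B (ts m) (c m) (k m) \<omega> - Y \<omega>))^2)) \<longlonglongrightarrow> 0"
    using assms unfolding is_Wiener_integral_def by blast
  have le: "(inner x e)^2 \<le> (norm x)^2" for x :: L2
    using Cauchy_Schwarz_ineq2[of x e] e by (simp add: abs_le_square_iff[symmetric])
  have sf: "step_fun (ts m) (\<lambda>j. inner (c m j) e) (k m) s - inner (f s) e
      = inner (step_fun (ts m) (c m) (k m) s - f s) e" for m s
    by (simp add: step_fun_def inner_diff_left inner_sum_left)
  have si: "step_integral B (ts m) (\<lambda>j. inner (c m j) e) (k m) \<omega> - inner (Y \<omega>) e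
      = inner (step_integral B (ts m) (c m) (k m) \<omega> - Y \<omega>) e" for m \<omega>
    by (simp add: step_integral_def inner_diff_left inner_sum_left)
  have "(\<lambda>m. \<integral>\<^sup>+s\<in>{0..t}. ennreal ((norm (step_fun (ts m) (\<lambda>j. inner (c m j) e) (k m) s - inner (f s) e))^2) \<partial>lborel) \<longlonglongrightarrow> 0"
    unfolding sf
    by (rule tendsto_sandwich[OF _ _ tendsto_const f])
      (auto intro!: always_eventually nn_integral_mono mult_right_mono ennreal_leI le)
  moreover have "(\<lambda>m. nn_mean M (\<lambda>\<omega>. (norm (step_integral B (ts m) (\<lambda>j. inner (c m j) e) (k m) \<omega> - inner (Y \<omega>) e))^2)) \<longlonglongrightarrow> 0"
    unfolding si
    by (rule tendsto_sandwich[OF _ _ tendsto_const i])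
      (auto intro!: always_eventually nn_integral_mono ennreal_leI le)
  moreover have Y': "(\<lambda>\<omega>. inner (Y \<omega>) e) \<in> borel_measurable M"
    by (rule measurable_compose[OF Y]) (intro borel_measurable_continuous_onI continuous_intros)
  ultimately have "\<exists>k. (\<forall>m. ts m 0 = 0 \<and> ts m (k m) = t \<and> (\<forall>j<k m. ts m j \<le> ts m (Suc j)))
      \<and> (\<lambda>m. \<integral>\<^sup>+s\<in>{0..t}. ennreal ((norm (step_fun (ts m) (\<lambda>j. inner (c m j) e) (k m) s - inner (f s) e))^2) \<partial>lborel) \<longlonglongrightarrow> 0
      \<and> (\<lambda>m. nn_mean M (\<lambda>\<omega>. (norm (step_integral B (ts m) (\<lambda>j. inner (c m j) e) (k m) \<omega> - inner (Y \<omega>) e))^2)) \<longlonglongrightarrow> 0"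
    using ts by (intro exI[of _ k]) simp
  then have "\<exists>ts c k. (\<forall>m. ts m 0 = 0 \<and> ts m (k m) = t \<and> (\<forall>j<k m. ts m j \<le> ts m (Suc j)))
      \<and> (\<lambda>m. \<integral>\<^sup>+s\<in>{0..t}. ennreal ((norm (step_fun (ts m) (c m) (k m) s - inner (f s) e))^2) \<partial>lborel) \<longlonglongrightarrow> 0
      \<and> (\<lambda>m. nn_mean M (\<lambda>\<omega>. (norm (step_integral B (ts m) (c m) (k m) \<omega> - inner (Y \<omega>) e))^2)) \<longlonglongrightarrow> 0"
    by (rule exI[of _ "\<lambda>m j. inner (c m j) e", THEN exI[of _ ts]])
  then show ?thesis
    using Y' unfolding is_Wiener_integral_def by simp
qed

text \<open>The approximating sequence is rewritten in the list coding. Extending the integrand by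
  zero outside [0,t] turns the convergence into one over the whole line, where energies are
  measured.\<close>

lemma is_Wiener_integral_elem:
  fixes f :: "real \<Rightarrow> real"
  assumes "is_Wiener_integral M B t f Y"
  obtains xs where "\<And>m. wf_elem (xs m)" "\<And>m s. s \<notin> {0..t} \<Longrightarrow> elem_fun (xs m) s = 0"
    "(\<lambda>m. \<integral>\<^sup>+s. ennreal ((elem_fun (xs m) s - indicator {0..t} s * f s)^2) \<partial>lborel) \<longlonglongrightarrow> 0"
    "(\<lambda>m. nn_mean M (\<lambda>\<omega>. (elem_int (\<lambda>t. B t \<omega>) (xs m) - Y \<omega>)^2)) \<longlonglongrightarrow> 0"
proof -
  obtain ts :: "nat \<Rightarrow> nat \<Rightarrow> real" and c :: "nat \<Rightarrow> nat \<Rightarrow> real" and k :: "nat \<Rightarrow> nat" where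
        ts: "\<forall>m. ts m 0 = 0 \<and> ts m (k m) = t \<and> (\<forall>j<k m. ts m j \<le> ts m (Suc j))"
    and f: "(\<lambda>m. \<integral>\<^sup>+s\<in>{0..t}. ennreal ((norm (step_fun (ts m) (c m) (k m) s - f s))^2) \<partial>lborel) \<longlonglongrightarrow> 0"
    and i: "(\<lambda>m. nn_mean M (\<lambda>\<omega>. (norm (step_integral B (ts m) (c m) (k m) \<omega> - Y \<omega>))^2)) \<longlonglongrightarrow> 0"
    using assms unfolding is_Wiener_integral_def by blast
  define xs where "xs m = map (\<lambda>j. (ts m j, ts m (Suc j), c m j)) [0..<k m]" for m
  have mono: "ts m i \<le> ts m j" if "i \<le> j" "j \<le> k m" for m i j
    using that
  proof (induction j rule: dec_induct)
    case (step j)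
    then show ?case using ts by (meson Suc_leD Suc_le_lessD order_trans)
  qed simp
  have pos: "0 \<le> ts m j" if "j \<le> k m" for m j
    using mono[of 0 j m] that ts by simp
  have wf: "wf_elem (xs m)" for m
    using pos ts by (auto simp: wf_elem_def xs_def)
  have ei: "elem_int g (xs m) = (\<Sum>j<k m. c m j * (g (ts m (Suc j)) - g (ts m j)))" for g m
    by (simp add: elem_int_def xs_def comp_def interv_sum_list_conv_sum_set_nat atLeast0LessThan)
  have ef: "elem_fun (xs m) s = step_fun (ts m) (c m) (k m) s" for m s
    unfolding elem_fun_def ei step_fun_def
  proof (intro sum.cong refl)
    fix j assume "j \<in> {..<k m}"
    then have "ts m j \<le> ts m (Suc j)" using ts by simp
    then show "c m j * ((if s \<le> ts m (Suc j) then 1 else 0) - (if s \<le> ts m j then 1 else 0))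
        = indicat_real {ts m j<..ts m (Suc j)} s *\<^sub>R c m j"
      by (auto simp: indicator_def)
  qed
  have supp: "elem_fun (xs m) s = 0" if s: "s \<notin> {0..t}" for m s
    unfolding ef step_fun_def
  proof (intro sum.neutral ballI)
    fix j assume "j \<in> {..<k m}"
    then have "0 \<le> ts m j" "ts m (Suc j) \<le> t" using pos mono[of "Suc j" "k m" m] ts by auto
    then show "indicat_real {ts m j<..ts m (Suc j)} s *\<^sub>R c m j = 0"
      using s by (auto simp: indicator_def)
  qed
  have "(\<lambda>m. \<integral>\<^sup>+s. ennreal ((elem_fun (xs m) s - indicator {0..t} s * f s)^2) \<partial>lborel) \<longlonglongrightarrow> 0"
  proof -
    have "(\<integral>\<^sup>+s. ennreal ((elem_fun (xs m) s - indicator {0..t} s * f s)^2) \<partial>lborel)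
        = (\<integral>\<^sup>+s\<in>{0..t}. ennreal ((norm (step_fun (ts m) (c m) (k m) s - f s))^2) \<partial>lborel)" for m
      by (intro nn_integral_cong) (use supp in \<open>auto simp: ef[symmetric] indicator_def\<close>)
    then show ?thesis using f by simp
  qed
  moreover have "(\<lambda>m. nn_mean M (\<lambda>\<omega>. (elem_int (\<lambda>t. B t \<omega>) (xs m) - Y \<omega>)^2)) \<longlonglongrightarrow> 0"
    using i by (simp add: ei step_integral_def mult.commute)
  ultimately show ?thesis using that[of xs] wf supp by blast
qed

lemma elem_int_measurable:
  assumes "standard_BM M B" "wf_elem xs"
  shows "(\<lambda>\<omega>. elem_int (\<lambda>t. B t \<omega>) xs) \<in> borel_measurable M"
  using assms(2)
proof (induction xs)
  case (Cons y ys)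
  obtain a b c where y: "y = (a, b, c)" by (cases y)
  have "B a \<in> borel_measurable M" "B b \<in> borel_measurable M"
    using assms(1) Cons.prems by (auto simp: y standard_BM_def)
  then show ?case using Cons by (simp add: y)
qed simp

lemma integrable_times_of_squares:
  fixes f g :: "'a \<Rightarrow> real"
  assumes [measurable]: "f \<in> borel_measurable M" "g \<in> borel_measurable M"
    and "integrable M (\<lambda>x. (f x)^2)" "integrable M (\<lambda>x. (g x)^2)"
  shows "integrable M (\<lambda>x. f x * g x)"
proof (rule Bochner_Integration.integrable_bound)
  show "integrable M (\<lambda>x. (f x)^2 + (g x)^2)" using assms by auto
  have "\<bar>a * b\<bar> \<le> a^2 + b^2" for a b :: real
  proof -
    have "2 * (\<bar>a\<bar> * \<bar>b\<bar>) \<le> a^2 + b^2"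
      using sum_squares_bound[of "\<bar>a\<bar>" "\<bar>b\<bar>"] by simp
    moreover have "0 \<le> \<bar>a\<bar> * \<bar>b\<bar>" by simp
    ultimately show ?thesis unfolding abs_mult by linarith
  qed
  then show "AE x in M. norm (f x * g x) \<le> norm ((f x)^2 + (g x)^2)" by simp
qed simp

lemma AE_subseq_of_nn_integral_tendsto_0:
  fixes u :: "nat \<Rightarrow> 'a \<Rightarrow> real"
  assumes [measurable]: "\<And>m. u m \<in> borel_measurable M" and nonneg: "\<And>m x. 0 \<le> u m x"
    and lim: "(\<lambda>m. \<integral>\<^sup>+x. ennreal (u m x) \<partial>M) \<longlonglongrightarrow> 0"
  obtains r where "strict_mono r" "AE x in M. (\<lambda>m. u (r m) x) \<longlonglongrightarrow> 0"
proof -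
  have "eventually (\<lambda>m. (\<integral>\<^sup>+x. ennreal (u m x) \<partial>M) < 1) sequentially"
    using lim by (rule order_tendstoD) simp
  \<comment> \<open>Early terms may have infinite mean; after the shift by \<open>m0\<close> all
    terms are integrable and the subsequence theorem for L^1 applies.\<close>
  then obtain m0 where m0: "\<And>m. m \<ge> m0 \<Longrightarrow> (\<integral>\<^sup>+x. ennreal (u m x) \<partial>M) < 1"
    by (auto simp: eventually_sequentially)
  have int: "integrable M (u (m + m0))" for m
  proof (rule integrableI_bounded)
    show "(\<integral>\<^sup>+x. ennreal (norm (u (m + m0) x)) \<partial>M) < \<infinity>"
      using m0[of "m + m0"] nonneg by (simp add: less_top order.strict_trans2[OF _ top_greatest])
  qed simp
  have "(\<lambda>m. \<integral>\<^sup>+x. ennreal (u (m + m0) x) \<partial>M) \<longlonglongrightarrow> 0"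
    using lim by (rule LIMSEQ_ignore_initial_segment)
  then have "(\<lambda>m. ennreal (\<integral>x. norm (u (m + m0) x) \<partial>M)) \<longlonglongrightarrow> ennreal 0"
    using int nonneg by (simp add: nn_integral_eq_integral)
  then have "(\<lambda>m. \<integral>x. norm (u (m + m0) x) \<partial>M) \<longlonglongrightarrow> 0"
    by (subst (asm) tendsto_ennreal_iff) auto
  from tendsto_L1_AE_subseq[OF int this]
  obtain r where r: "strict_mono r" "AE x in M. (\<lambda>m. u (r m + m0) x) \<longlonglongrightarrow> 0" by blast
  have "strict_mono (\<lambda>m. r m + m0)" using r(1) by (auto simp: strict_mono_def)
  from that[OF this r(2)] show ?thesis .
qed

text \<open>Young's inequality (x + y)^2 \<le> (1 + \<theta>) x^2 + (1 + 1/\<theta>) y^2, with y the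
  approximation error. A convergent upper bound is enough, because \<theta> is sent to 0
  afterwards.\<close>

lemma square_integral_limit_bound:
  fixes p f :: "real \<Rightarrow> real" and g :: "nat \<Rightarrow> real \<Rightarrow> real"
  assumes [measurable]: "p \<in> borel_measurable borel" "f \<in> borel_measurable borel" "\<And>m. g m \<in> borel_measurable borel"
    and p: "integrable lborel (\<lambda>s. (p s)^2)" and f: "integrable lborel (\<lambda>s. (f s)^2)"
    and g: "\<And>m. integrable lborel (\<lambda>s. (g m s)^2)"
    and lim: "(\<lambda>m. \<integral>\<^sup>+s. ennreal ((g m s - f s)^2) \<partial>lborel) \<longlonglongrightarrow> 0" and "\<theta> > 0" 
  shows "\<exists>a. a \<longlonglongrightarrow> (1 + \<theta>) * (LINT s|lborel. (p s + b * f s)^2) \<and> (\<forall>m. (LINT s|lborel. (p s + b * g m s)^2) \<le> a m)"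
proof -
  have sq: "integrable lborel (\<lambda>s. (x s + c * y s)^2)"
    if [measurable]: "x \<in> borel_measurable borel" "y \<in> borel_measurable borel"
      and "integrable lborel (\<lambda>s. (x s)^2)" "integrable lborel (\<lambda>s. (y s)^2)" for x y :: "real \<Rightarrow> real" and c
  proof -
    have "integrable lborel (\<lambda>s. (x s)^2 + c^2 * (y s)^2 + 2 * c * (x s * y s))"
      using that integrable_times_of_squares[of x lborel y] by auto
    then show ?thesis by (simp add: power2_sum power_mult_distrib algebra_simps)
  qed
  define a where "a m = (LINT s|lborel. (g m s - f s)^2)" for m
  have d: "integrable lborel (\<lambda>s. (g m s - f s)^2)" for m
    using sq[of "g m" f "-1"] g f by simp
  have "(\<lambda>m. ennreal (a m)) \<longlonglongrightarrow> ennreal 0"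
    using lim d by (simp add: a_def nn_integral_eq_integral)
  then have a: "a \<longlonglongrightarrow> 0"
    by (subst (asm) tendsto_ennreal_iff) (auto simp: a_def)
  have "(\<lambda>m. (1 + \<theta>) * (LINT s|lborel. (p s + b * f s)^2) + (1 + 1 / \<theta>) * b^2 * a m)
      \<longlonglongrightarrow> (1 + \<theta>) * (LINT s|lborel. (p s + b * f s)^2) + (1 + 1 / \<theta>) * b^2 * 0"
    by (intro tendsto_intros a)
  moreover have "(LINT s|lborel. (p s + b * g m s)^2)
      \<le> (1 + \<theta>) * (LINT s|lborel. (p s + b * f s)^2) + (1 + 1 / \<theta>) * b^2 * a m" for m
  proof -
    have "(LINT s|lborel. (p s + b * g m s)^2)
        \<le> (LINT s|lborel. (1 + \<theta>) * (p s + b * f s)^2 + ((1 + 1 / \<theta>) * b^2) * (g m s - f s)^2)"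
    proof (rule integral_mono)
      fix s
      define x y where "x = p s + b * f s" and "y = b * (g m s - f s)"
      have xy: "p s + b * g m s = x + y" by (simp add: x_def y_def algebra_simps)
      have "0 \<le> (\<theta> * x - y)^2 / \<theta>" using \<open>\<theta> > 0\<close> by simp
      also have "\<dots> = \<theta> * x^2 + y^2 / \<theta> - 2 * x * y"
        using \<open>\<theta> > 0\<close> by (simp add: field_simps power2_eq_square)
      finally have "(x + y)^2 \<le> (1 + \<theta>) * x^2 + (1 + 1 / \<theta>) * y^2"
        by (simp add: power2_sum algebra_simps)
      then show "(p s + b * g m s)^2 \<le> (1 + \<theta>) * (p s + b * f s)^2 + ((1 + 1 / \<theta>) * b^2) * (g m s - f s)^2"
        by (simp add: xy x_def[symmetric] y_def power_mult_distrib mult.assoc)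
    qed (use sq p f g d in auto)
    also have "\<dots> = (1 + \<theta>) * (LINT s|lborel. (p s + b * f s)^2) + (1 + 1 / \<theta>) * b^2 * a m"
      unfolding a_def using sq p f d by (subst Bochner_Integration.integral_add) auto
    finally show ?thesis .
  qed
  ultimately show ?thesis by auto
qed

lemma continuous_on_square_integrable:
  fixes f :: "real \<Rightarrow> real"
  assumes "continuous_on {a..b} f"
  shows "(\<lambda>s. indicator {a..b} s * f s) \<in> borel_measurable borel"
    "integrable lborel (\<lambda>s. (indicator {a..b} s * f s)^2)"
proof -
  show "(\<lambda>s. indicator {a..b} s * f s) \<in> borel_measurable borel"
    using borel_measurable_continuous_on_indicator[of "{a..b}" f] assms by simp
  have "set_integrable lborel {a..b} (\<lambda>s. (f s)^2)"
    by (intro borel_integrable_atLeastAtMost' continuous_intros assms)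
  moreover have "(indicator {a..b} s * f s)^2 = indicator {a..b} s *\<^sub>R (f s)^2" for s
    by (simp add: indicator_def)
  ultimately show "integrable lborel (\<lambda>s. (indicator {a..b} s * f s)^2)"
    by (simp add: set_integrable_def)
qed

section \<open>The tilted measure\<close>

text \<open>The moments of the elementary approximations are exact; Fatou's lemma along an almost
  surely convergent subsequence turns them into an upper bound. Combining an elementary part with
  general Wiener integrals is what allows the tilt to be elementary while the noise is a stochastic
  convolution.\<close>

lemma (in prob_space) Wiener_integral_mgf_le:
  assumes W: "cylindrical_Wiener M \<beta>" and I: "finite I" "I \<subseteq> {1..}"
    and ps: "\<And>i. i \<in> I \<Longrightarrow> wf_elem (ps i)"
    and Y: "\<And>i. i \<in> I \<Longrightarrow> is_Wiener_integral M (\<beta> i) t (f i) (Y i)"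
    and f: "\<And>i. i \<in> I \<Longrightarrow> continuous_on {0..t} (f i)"
  shows "nn_mean M (\<lambda>\<omega>. exp ((\<Sum>i\<in>I. elem_Wiener \<beta> i \<omega> (ps i)) + b * (\<Sum>i\<in>I. Y i \<omega>)))
    \<le> ennreal (exp ((\<Sum>i\<in>I. LINT s|lborel. (elem_fun (ps i) s + b * (indicator {0..t} s * f i s))^2) / 2))"
    (is "?L \<le> _")
proof -
  define F where "F i s = indicator {0..t} s * f i s" for i s
  have Fm[measurable]: "F i \<in> borel_measurable borel" and Fi: "integrable lborel (\<lambda>s. (F i s)^2)" if "i \<in> I" for i
    using continuous_on_square_integrable[OF f[OF that]] by (simp_all add: F_def[abs_def])
  have BM: "standard_BM M (\<beta> i)" if "i \<in> I" for i
    using W I that by (auto simp: cylindrical_Wiener_def)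
  define P where "P i xs \<longleftrightarrow> (\<forall>m. wf_elem (xs m)) \<and>
      (\<lambda>m. \<integral>\<^sup>+s. ennreal ((elem_fun (xs m) s - F i s)^2) \<partial>lborel) \<longlonglongrightarrow> 0 \<and>
      (\<lambda>m. nn_mean M (\<lambda>\<omega>. (elem_Wiener \<beta> i \<omega> (xs m) - Y i \<omega>)^2)) \<longlonglongrightarrow> 0" for i xs
  have "\<exists>xs. P i xs" if "i \<in> I" for i
    unfolding P_def F_def by (rule is_Wiener_integral_elem[OF Y[OF that]]) blast
  then have "\<forall>i\<in>I. \<exists>xs. P i xs" by blast
  then obtain xs where xs: "\<forall>i\<in>I. P i (xs i)" by (rule bchoice[THEN exE])
  have wf: "wf_elem (xs i m)" if "i \<in> I" for i m
    using xs that unfolding P_def by blast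
  have lim1: "(\<lambda>m. \<integral>\<^sup>+s. ennreal ((elem_fun (xs i m) s - F i s)^2) \<partial>lborel) \<longlonglongrightarrow> 0" if "i \<in> I" for i
    using xs that unfolding P_def by blast
  have lim2: "(\<lambda>m. nn_mean M (\<lambda>\<omega>. (elem_Wiener \<beta> i \<omega> (xs i m) - Y i \<omega>)^2)) \<longlonglongrightarrow> 0" if "i \<in> I" for i
    using xs that unfolding P_def by blast
  have Ym: "Y i \<in> borel_measurable M" if "i \<in> I" for i
    using Y[OF that] by (simp add: is_Wiener_integral_def)
  have em: "(\<lambda>\<omega>. elem_Wiener \<beta> i \<omega> ys) \<in> borel_measurable M" if "i \<in> I" "wf_elem ys" for i ys
    using elem_int_measurable[OF BM] that by blast
  define u where "u m \<omega> = (\<Sum>i\<in>I. (elem_Wiener \<beta> i \<omega> (xs i m) - Y i \<omega>)^2)" for m \<omega>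
  have dm: "(\<lambda>\<omega>. (elem_Wiener \<beta> i \<omega> (xs i m) - Y i \<omega>)^2) \<in> borel_measurable M" if "i \<in> I" for i m
    using em[OF that wf[OF that]] Ym[OF that] by auto
  have um: "u m \<in> borel_measurable M" for m
    unfolding u_def using dm by (intro borel_measurable_sum) auto
  have "nn_mean M (\<lambda>\<omega>. u m \<omega>)
      = (\<Sum>i\<in>I. nn_mean M (\<lambda>\<omega>. (elem_Wiener \<beta> i \<omega> (xs i m) - Y i \<omega>)^2))" for m
  proof -
    have "nn_mean M (\<lambda>\<omega>. u m \<omega>)
        = (\<integral>\<^sup>+\<omega>. (\<Sum>i\<in>I. ennreal ((elem_Wiener \<beta> i \<omega> (xs i m) - Y i \<omega>)^2)) \<partial>M)"
      by (simp add: u_def sum_ennreal)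
    also have "\<dots> = (\<Sum>i\<in>I. nn_mean M (\<lambda>\<omega>. (elem_Wiener \<beta> i \<omega> (xs i m) - Y i \<omega>)^2))"
      by (rule nn_integral_sum) (use dm measurable_compose[OF _ measurable_ennreal] in blast)
    finally show ?thesis .
  qed
  moreover have "(\<lambda>m. \<Sum>i\<in>I. nn_mean M (\<lambda>\<omega>. (elem_Wiener \<beta> i \<omega> (xs i m) - Y i \<omega>)^2)) \<longlonglongrightarrow> (\<Sum>i\<in>I. 0)"
    by (intro tendsto_sum lim2)
  ultimately have "(\<lambda>m. nn_mean M (\<lambda>\<omega>. u m \<omega>)) \<longlonglongrightarrow> 0" by simp
  moreover have "0 \<le> u m \<omega>" for m \<omega> by (simp add: u_def sum_nonneg)
  ultimately obtain r where r: "strict_mono r" "AE \<omega> in M. (\<lambda>m. u (r m) \<omega>) \<longlonglongrightarrow> 0"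
    using AE_subseq_of_nn_integral_tendsto_0[of u M] um by blast
  \<comment> \<open>Concatenating the lists of each mode keeps the exponent a sum of elementary
    integrals, so that its moment is known exactly.\<close>
  define S where "S m \<omega> = (\<Sum>i\<in>I. elem_Wiener \<beta> i \<omega> (ps i @ map (\<lambda>(a, b', c). (a, b', b * c)) (xs i (r m))))" for m \<omega>
  have Sm: "S m \<in> borel_measurable M" for m
    unfolding S_def using em wf ps by (intro borel_measurable_sum) auto
  have lim: "AE \<omega> in M. (\<lambda>m. S m \<omega>) \<longlonglongrightarrow> (\<Sum>i\<in>I. elem_Wiener \<beta> i \<omega> (ps i)) + b * (\<Sum>i\<in>I. Y i \<omega>)"
    using r(2)
  proof eventually_elim
    case (elim \<omega>)
    have "(\<lambda>m. elem_Wiener \<beta> i \<omega> (xs i (r m))) \<longlonglongrightarrow> Y i \<omega>" if "i \<in> I" for i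
    proof -
      have "(\<lambda>m. (elem_Wiener \<beta> i \<omega> (xs i (r m)) - Y i \<omega>)^2) \<longlonglongrightarrow> 0"
        by (rule tendsto_sandwich[OF _ _ tendsto_const elim])
          (use I that in \<open>auto intro!: always_eventually member_le_sum simp: u_def\<close>)
      then have "(\<lambda>m. elem_Wiener \<beta> i \<omega> (xs i (r m)) - Y i \<omega>) \<longlonglongrightarrow> 0"
        by (simp add: power_tendsto_0_iff)
      then show ?thesis by (simp add: LIM_zero_iff)
    qed
    then have "(\<lambda>m. \<Sum>i\<in>I. elem_Wiener \<beta> i \<omega> (ps i) + b * elem_Wiener \<beta> i \<omega> (xs i (r m)))
        \<longlonglongrightarrow> (\<Sum>i\<in>I. elem_Wiener \<beta> i \<omega> (ps i) + b * Y i \<omega>)"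
      by (intro tendsto_intros)
    then show ?case
      by (simp add: S_def elem_int_append elem_int_scale sum.distrib sum_distrib_left)
  qed
  have mgf: "nn_mean M (\<lambda>\<omega>. exp (S m \<omega>))
      = ennreal (exp ((\<Sum>i\<in>I. LINT s|lborel. (elem_fun (ps i) s + b * elem_fun (xs i (r m)) s)^2) / 2))" for m
    unfolding S_def using wf ps
    by (subst cylindrical_Wiener_mgf[OF W I]) (auto simp: elem_fun_append elem_fun_scale)
  define A where "A = (\<Sum>i\<in>I. LINT s|lborel. (elem_fun (ps i) s + b * F i s)^2)"
  have bound: "?L \<le> ennreal (exp ((1 + \<theta>) * A / 2))" if "\<theta> > 0" for \<theta>
  proof -
    define P' where "P' i a \<longleftrightarrow> a \<longlonglongrightarrow> (1 + \<theta>) * (LINT s|lborel. (elem_fun (ps i) s + b * F i s)^2) \<and>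
        (\<forall>m. (LINT s|lborel. (elem_fun (ps i) s + b * elem_fun (xs i (r m)) s)^2) \<le> a m)" for i a
    have "\<exists>a. P' i a" if i: "i \<in> I" for i
      unfolding P'_def
    proof (rule square_integral_limit_bound)
      show "(\<lambda>m. \<integral>\<^sup>+s. ennreal ((elem_fun (xs i (r m)) s - F i s)^2) \<partial>lborel) \<longlonglongrightarrow> 0"
        using LIMSEQ_subseq_LIMSEQ[OF lim1[OF i] r(1)] by (simp add: comp_def)
    qed (use \<open>\<theta> > 0\<close> elem_fun_integrable[OF ps[OF i]] elem_fun_integrable[OF wf[OF i]] Fm[OF i] Fi[OF i] in auto)
    then have "\<forall>i\<in>I. \<exists>a. P' i a" by blast
    then obtain a where a': "\<forall>i\<in>I. P' i (a i)" by (rule bchoice[THEN exE])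
    have a: "a i \<longlonglongrightarrow> (1 + \<theta>) * (LINT s|lborel. (elem_fun (ps i) s + b * F i s)^2)"
       "(LINT s|lborel. (elem_fun (ps i) s + b * elem_fun (xs i (r m)) s)^2) \<le> a i m" if "i \<in> I" for i m
      using a' that unfolding P'_def by blast+
    have "?L = (\<integral>\<^sup>+\<omega>. liminf (\<lambda>m. ennreal (exp (S m \<omega>))) \<partial>M)"
    proof (rule nn_integral_cong_AE)
      show "AE \<omega> in M. ennreal (exp ((\<Sum>i\<in>I. elem_Wiener \<beta> i \<omega> (ps i)) + b * (\<Sum>i\<in>I. Y i \<omega>)))
         = liminf (\<lambda>m. ennreal (exp (S m \<omega>)))"
        using lim
      proof eventually_elim
        case (elim \<omega>)
        then have "(\<lambda>m. ennreal (exp (S m \<omega>))) \<longlonglongrightarrow> ennreal (exp ((\<Sum>i\<in>I. elem_Wiener \<beta> i \<omega> (ps i)) + b * (\<Sum>i\<in>I. Y i \<omega>)))"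
          by (intro tendsto_ennrealI tendsto_intros)
        then show ?case by (rule lim_imp_Liminf[OF trivial_limit_sequentially, symmetric])
      qed
    qed
    also have "\<dots> \<le> liminf (\<lambda>m. nn_mean M (\<lambda>\<omega>. exp (S m \<omega>)))"
      by (rule nn_integral_liminf) (use Sm in measurable)
    also have "\<dots> \<le> liminf (\<lambda>m. ennreal (exp ((\<Sum>i\<in>I. a i m) / 2)))"
      unfolding mgf using a(2) by (intro Liminf_mono always_eventually allI ennreal_leI) (auto intro!: sum_mono divide_right_mono)
    also have "\<dots> = ennreal (exp ((\<Sum>i\<in>I. (1 + \<theta>) * (LINT s|lborel. (elem_fun (ps i) s + b * F i s)^2)) / 2))"
      by (intro lim_imp_Liminf tendsto_ennrealI tendsto_intros a(1)) auto
    also have "\<dots> = ennreal (exp ((1 + \<theta>) * A / 2))"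
      by (simp add: A_def sum_distrib_left)
    finally show ?thesis .
  qed
  \<comment> \<open>The slack \<theta> is removed along 1/(k+1).\<close>
  have "(\<lambda>k. ennreal (exp ((1 + 1 / real (Suc k)) * A / 2))) \<longlonglongrightarrow> ennreal (exp ((1 + 0) * A / 2))"
    by (intro tendsto_ennrealI tendsto_intros lim_1_over_real_power LIMSEQ_Suc[OF lim_1_over_n]) auto
  then have "?L \<le> ennreal (exp ((1 + 0) * A / 2))"
    by (rule LIMSEQ_le_const) (use bound in auto)
  then show ?thesis by (simp add: A_def F_def)
qed

text \<open>Under the tilted measure with density \<open>exp (\<xi> - E / 2)\<close> the Gaussian \<open>U = \<Sum>\<^sub>i Y\<^sub>i\<close> keeps its
  variance and is shifted by its covariance with \<open>\<xi>\<close>; the moment bound uses \<open>\<bar>x\<bar> \<le> exp x + exp (- x)\<close>.\<close>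

lemma (in prob_space) tilted_abs_moment:
  assumes W: "cylindrical_Wiener M \<beta>" and I: "finite I" "I \<subseteq> {1..}"
    and ps: "\<And>i. i \<in> I \<Longrightarrow> wf_elem (ps i)"
    and Y: "\<And>i. i \<in> I \<Longrightarrow> is_Wiener_integral M (\<beta> i) t (f i) (Y i)"
    and f: "\<And>i. i \<in> I \<Longrightarrow> continuous_on {0..t} (f i)"
  defines "E \<equiv> (\<Sum>i\<in>I. elem_energy (ps i))"
    and "u \<equiv> (\<Sum>i\<in>I. LINT s|lborel. elem_fun (ps i) s * (indicator {0..t} s * f i s))"
    and "v \<equiv> (\<Sum>i\<in>I. LINT s|lborel. (indicator {0..t} s * f i s)^2)"
  shows "nn_mean M (\<lambda>\<omega>. exp ((\<Sum>i\<in>I. elem_Wiener \<beta> i \<omega> (ps i)) - E / 2) * \<bar>(\<Sum>i\<in>I. Y i \<omega>) - u\<bar>)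
    \<le> ennreal (2 * exp (v / 2))"
proof -
  define G where "G b \<omega> = exp ((\<Sum>i\<in>I. elem_Wiener \<beta> i \<omega> (ps i)) + b * (\<Sum>i\<in>I. Y i \<omega>))" for b \<omega>
  have Ym: "Y i \<in> borel_measurable M" if "i \<in> I" for i
    using Y[OF that] by (simp add: is_Wiener_integral_def)
  have "standard_BM M (\<beta> i)" if "i \<in> I" for i
    using W I that by (auto simp: cylindrical_Wiener_def)
  then have em: "(\<lambda>\<omega>. elem_Wiener \<beta> i \<omega> (ps i)) \<in> borel_measurable M" if "i \<in> I" for i
    using elem_int_measurable ps that by blast
  have Gm [measurable]: "G b \<in> borel_measurable M" for b
    unfolding G_def using Ym em
    by (intro borel_measurable_exp measurable_compose[OF _ borel_measurable_exp]
       borel_measurable_add borel_measurable_times borel_measurable_const borel_measurable_sum) auto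
  \<comment> \<open>Only b = 1 and b = -1 are used: the exponent (E + 2 b u + v)/2 then cancels
    against the prefactor, leaving v/2 with neither E nor u.\<close>
  have G: "nn_mean M (\<lambda>\<omega>. exp (- E / 2 - b * u) * G b \<omega>) \<le> ennreal (exp (v / 2))" if b: "b^2 = 1" for b
  proof -
    have "(\<Sum>i\<in>I. LINT s|lborel. (elem_fun (ps i) s + b * (indicator {0..t} s * f i s))^2)
        = (\<Sum>i\<in>I. elem_energy (ps i) + 2 * b * (LINT s|lborel. elem_fun (ps i) s * (indicator {0..t} s * f i s))
           + (LINT s|lborel. (indicator {0..t} s * f i s)^2))"
    proof (intro sum.cong refl)
      fix i assume i: "i \<in> I"
      note 1 = elem_fun_integrable[OF ps[OF i]] and 2 = continuous_on_square_integrable[OF f[OF i]]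
      note 3 = integrable_times_of_squares[of "elem_fun (ps i)" lborel, simplified, OF 1(2) 2(1) 1(1) 2(2)]
      have "(LINT s|lborel. (elem_fun (ps i) s + b * (indicator {0..t} s * f i s))^2)
          = (LINT s|lborel. (elem_fun (ps i) s)^2 + 2 * b * (elem_fun (ps i) s * (indicator {0..t} s * f i s)) + (indicator {0..t} s * f i s)^2)"
        using b by (intro Bochner_Integration.integral_cong refl) (simp add: power2_sum power_mult_distrib)
      also have "\<dots> = elem_energy (ps i) + 2 * b * (LINT s|lborel. elem_fun (ps i) s * (indicator {0..t} s * f i s))
           + (LINT s|lborel. (indicator {0..t} s * f i s)^2)"
        using 1 2 3 by (simp only: Bochner_Integration.integral_add Bochner_Integration.integrable_add
          integrable_mult_right integral_mult_right_zero)
      finally show "(LINT s|lborel. (elem_fun (ps i) s + b * (indicator {0..t} s * f i s))^2)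
          = elem_energy (ps i) + 2 * b * (LINT s|lborel. elem_fun (ps i) s * (indicator {0..t} s * f i s))
           + (LINT s|lborel. (indicator {0..t} s * f i s)^2)" .
    qed
    also have "\<dots> = E + 2 * b * u + v"
      by (simp add: E_def u_def v_def sum.distrib sum_distrib_left)
    finally have mg: "nn_mean M (\<lambda>\<omega>. G b \<omega>) \<le> ennreal (exp ((E + 2 * b * u + v) / 2))"
      unfolding G_def using Wiener_integral_mgf_le[of \<beta> I ps t f Y b, OF W I ps Y f] by simp
    have "nn_mean M (\<lambda>\<omega>. exp (- E / 2 - b * u) * G b \<omega>)
        = ennreal (exp (- E / 2 - b * u)) * nn_mean M (\<lambda>\<omega>. G b \<omega>)"
      by (subst nn_integral_cmult[symmetric]) (auto simp: ennreal_mult' intro!: measurable_compose[OF Gm measurable_ennreal])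
    also have "\<dots> \<le> ennreal (exp (- E / 2 - b * u)) * ennreal (exp ((E + 2 * b * u + v) / 2))"
      by (intro mult_left_mono mg) simp
    also have "\<dots> = ennreal (exp (v / 2))"
      by (simp add: ennreal_mult'[symmetric] exp_add[symmetric] field_simps)
    finally show ?thesis .
  qed
  have "exp (a - E / 2) * \<bar>y - u\<bar> \<le> exp (- E / 2 - 1 * u) * exp (a + 1 * y) + exp (- E / 2 - (- 1) * u) * exp (a + (- 1) * y)" for a y :: real
  proof -
    have "\<bar>y - u\<bar> \<le> exp (y - u) + exp (- (y - u))"
      using exp_ge_add_one_self[of "y - u"] exp_ge_add_one_self[of "- (y - u)"]
        exp_gt_zero[of "y - u"] exp_gt_zero[of "- (y - u)"] by linarith
    then have "exp (a - E / 2) * \<bar>y - u\<bar> \<le> exp (a - E / 2) * (exp (y - u) + exp (- (y - u)))"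
      by (rule mult_left_mono) simp
    then show ?thesis by (simp add: distrib_left exp_add[symmetric] algebra_simps)
  qed
  then have "nn_mean M (\<lambda>\<omega>. exp ((\<Sum>i\<in>I. elem_Wiener \<beta> i \<omega> (ps i)) - E / 2) * \<bar>(\<Sum>i\<in>I. Y i \<omega>) - u\<bar>)
     \<le> (\<integral>\<^sup>+\<omega>. ennreal (exp (- E / 2 - 1 * u) * G 1 \<omega>) + ennreal (exp (- E / 2 - (- 1) * u) * G (- 1) \<omega>) \<partial>M)"
    unfolding G_def by (intro nn_integral_mono) (simp add: ennreal_plus[symmetric] ennreal_leI del: ennreal_plus)
  also have "\<dots> = nn_mean M (\<lambda>\<omega>. exp (- E / 2 - 1 * u) * G 1 \<omega>) + nn_mean M (\<lambda>\<omega>. exp (- E / 2 - (- 1) * u) * G (- 1) \<omega>)"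
    by (rule nn_integral_add) measurable
  also have "\<dots> \<le> ennreal (exp (v / 2)) + ennreal (exp (v / 2))"
    by (intro add_mono G) auto
  also have "\<dots> = ennreal (2 * exp (v / 2))"
    by (simp add: ennreal_plus[symmetric] del: ennreal_plus)
  finally show ?thesis .
qed

section \<open>Pathwise comparison of mild equations\<close>

lemma exp_mult_exp: "exp a * (exp b * y) = exp (a + b) * (y::real)"
  by (simp add: exp_add)

abbreviation exp_conv :: "real \<Rightarrow> (real \<Rightarrow> real) \<Rightarrow> real \<Rightarrow> real" where
  "exp_conv l f t \<equiv> integral {0..t} (\<lambda>u. exp (- l * (t - u)) * f u)"

text \<open>With \<phi>(t) the integral of exp(c u) a(u) over [0,t], the hypothesis bounds the
  derivative of exp(-L t) \<phi>(t) by exp((c - L) t) b(t). The conclusion keeps the integral of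
  \<open>b\<close> instead of its supremum, because later only means of \<open>b\<close> at single
  times are under control.\<close>

lemma gronwall_convolution:
  fixes a b :: "real \<Rightarrow> real"
  assumes a: "continuous_on {0..s} a" and b: "continuous_on {0..s} b" and "0 \<le> s" "0 \<le> L"
    and le: "\<And>t. t \<in> {0..s} \<Longrightarrow> a t \<le> b t + L * exp_conv c a t"
  shows "a s \<le> b s + L * integral {0..s} (\<lambda>u. exp (- (c - L) * (s - u)) * b u)"
proof -
  define \<phi> where "\<phi> t = integral {0..t} (\<lambda>u. exp (c * u) * a u)" for t
  have conv: "exp_conv c a t = exp (- c * t) * \<phi> t" for t
    unfolding \<phi>_def by (subst integral_mult_right[symmetric]) (simp only: exp_mult_exp, simp add: algebra_simps)
  have d\<phi>: "(\<phi> has_real_derivative exp (c * t) * a t) (at t within {0..s})" if "t \<in> {0..s}" for t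
    unfolding \<phi>_def
    by (rule integral_has_real_derivative) (use that a in \<open>auto intro!: continuous_intros\<close>)
  define \<psi>' where "\<psi>' t = exp (- L * t) * (exp (c * t) * a t - L * \<phi> t)" for t
  have d\<psi>: "((\<lambda>t. exp (- L * t) * \<phi> t) has_real_derivative \<psi>' t) (at t within {0..s})" if "t \<in> {0..s}" for t
    unfolding \<psi>'_def by (auto intro!: derivative_eq_intros d\<phi>[OF that] simp: algebra_simps)
  have "(\<psi>' has_integral (exp (- L * s) * \<phi> s - exp (- L * 0) * \<phi> 0)) {0..s}"
    by (rule fundamental_theorem_of_calculus) (use d\<psi> \<open>0 \<le> s\<close> in \<open>auto simp: has_real_derivative_iff_has_vector_derivative\<close>)
  then have I: "(\<psi>' has_integral exp (- L * s) * \<phi> s) {0..s}" by (simp add: \<phi>_def)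
  have J: "((\<lambda>u. exp ((c - L) * u) * b u) has_integral integral {0..s} (\<lambda>u. exp ((c - L) * u) * b u)) {0..s}"
    by (intro integrable_integral integrable_continuous_real continuous_intros b)
  have "exp (- L * s) * \<phi> s \<le> integral {0..s} (\<lambda>u. exp ((c - L) * u) * b u)"
  proof (rule has_integral_le[OF I J])
    fix t assume t: "t \<in> {0..s}"
    have "exp (c * t) * a t \<le> exp (c * t) * (b t + L * (exp (- c * t) * \<phi> t))"
      using le[OF t] unfolding conv by (intro mult_left_mono) auto
    also have "\<dots> = exp (c * t) * b t + L * \<phi> t"
      by (simp add: distrib_left mult.left_commute[of "exp (c * t)"] exp_mult_exp)
    finally have "\<psi>' t \<le> exp (- L * t) * (exp (c * t) * b t)"
      unfolding \<psi>'_def by (intro mult_left_mono) auto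
    moreover have "- L * t + c * t = (c - L) * t" by (simp add: algebra_simps)
    ultimately show "\<psi>' t \<le> exp ((c - L) * t) * b t" by (simp only: exp_mult_exp)
  qed
  then have "exp (- (c - L) * s) * (exp (- L * s) * \<phi> s) \<le> exp (- (c - L) * s) * integral {0..s} (\<lambda>u. exp ((c - L) * u) * b u)"
    by (intro mult_left_mono) auto
  also have "\<dots> = integral {0..s} (\<lambda>u. exp (- (c - L) * (s - u)) * b u)"
    by (subst integral_mult_right[symmetric]) (simp only: exp_mult_exp, simp add: algebra_simps)
  finally have "exp (- (c - L) * s) * (exp (- L * s) * \<phi> s) \<le> integral {0..s} (\<lambda>u. exp (- (c - L) * (s - u)) * b u)" .
  moreover have "- (c - L) * s + - L * s = - c * s" by (simp add: algebra_simps)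
  ultimately have "exp (- c * s) * \<phi> s \<le> integral {0..s} (\<lambda>u. exp (- (c - L) * (s - u)) * b u)"
    by (simp only: exp_mult_exp)
  then have "L * (exp (- c * s) * \<phi> s) \<le> L * integral {0..s} (\<lambda>u. exp (- (c - L) * (s - u)) * b u)"
    using \<open>0 \<le> L\<close> by (rule mult_left_mono)
  then show ?thesis using le[of s] \<open>0 \<le> s\<close> unfolding conv by simp
qed

text \<open>Integrands with values in the finite-dimensional space \<open>Hn n\<close> are
  integrated coordinate by coordinate, and the vector integral, its existence included, is assembled
  from the scalar ones.\<close>

lemma integral_Hn:
  assumes h: "\<And>s. s \<in> S \<Longrightarrow> h s \<in> Hn n"
    and i: "\<And>k. 1 \<le> k \<Longrightarrow> k \<le> n \<Longrightarrow> (\<lambda>s. coord k (h s)) integrable_on S"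
    and k: "1 \<le> k" "k \<le> n"
  shows "coord k (integral S h) = integral S (\<lambda>s. coord k (h s))"
proof -
  have "((\<lambda>s. \<Sum>k=1..n. coord k (h s) *\<^sub>R e_basis k) has_integral
      (\<Sum>k=1..n. integral S (\<lambda>s. coord k (h s)) *\<^sub>R e_basis k)) S"
    using i by (intro has_integral_sum has_integral_scaleR_left integrable_integral) auto
  then have "(h has_integral (\<Sum>k=1..n. integral S (\<lambda>s. coord k (h s)) *\<^sub>R e_basis k)) S"
    by (rule has_integral_eq[rotated]) (simp add: Hn_expansion[OF h, symmetric] del: One_nat_def)
  then show ?thesis
    by (simp only: integral_unique inner_sum_e_basis[OF k])
qed

text \<open>Coordinate \<open>k\<close> of the drift convolution, written with \<open>F\<close>
  instead of \<open>Fn F n\<close>: the two have the same coordinates for k between 1 and n.\<close>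

definition conv_coord :: "(L2 \<Rightarrow> L2) \<Rightarrow> (real \<Rightarrow> L2) \<Rightarrow> nat \<Rightarrow> real \<Rightarrow> real" where
  "conv_coord F x k t = exp_conv (eigval k) (\<lambda>u. coord k (F (x u))) t"

lemma inner_mild_drift:
  assumes x: "continuous_on {0..t} x" and F: "continuous_on UNIV F" and k: "1 \<le> k" "k \<le> n"
  shows "coord k (integral {0..t} (\<lambda>s. semigroup_n n (t - s) (Fn F n (x s)))) = conv_coord F x k t"
proof -
  have c: "coord j (semigroup_n n (t - s) (Fn F n (x s)))
      = exp (- eigval j * (t - s)) * coord j (F (x s))" if "1 \<le> j" "j \<le> n" for j s
    using that by (simp add: Fn_def inner_semigroup_n Pn_in_Hn inner_Pn)
  have "continuous_on {0..t} (\<lambda>s. F (x s))"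
    by (rule continuous_on_compose2[OF F x]) auto
  then have "(\<lambda>s. coord j (semigroup_n n (t - s) (Fn F n (x s)))) integrable_on {0..t}"
    if "1 \<le> j" "j \<le> n" for j
    unfolding c[OF that] by (intro integrable_continuous_real continuous_intros)
  then have "coord k (integral {0..t} (\<lambda>s. semigroup_n n (t - s) (Fn F n (x s))))
      = integral {0..t} (\<lambda>s. coord k (semigroup_n n (t - s) (Fn F n (x s))))"
    by (intro integral_Hn[where n=n] k semigroup_n_in_Hn) (simp_all add: Fn_def Pn_in_Hn)
  then show ?thesis by (simp only: c[OF k] conv_coord_def)
qed

text \<open>Pulling the t-dependent factor of the kernel out of the integral leaves an indefinite
  integral.\<close>

lemma conv_coord_continuous:
  assumes x: "continuous_on {0..s} x" and F: "continuous_on UNIV F"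
  shows "continuous_on {0..s} (conv_coord F x k)"
proof -
  have "continuous_on {0..s} (\<lambda>s. F (x s))"
    by (rule continuous_on_compose2[OF F x]) auto
  then have "continuous_on {0..s} (\<lambda>t. exp (- eigval k * t) * integral {0..t} (\<lambda>u. exp (eigval k * u) * coord k (F (x u))))"
    by (intro continuous_intros indefinite_integral_continuous_1 integrable_continuous_real)
  moreover have "exp (- eigval k * t) * integral {0..t} (\<lambda>u. exp (eigval k * u) * coord k (F (x u))) = conv_coord F x k t" for t
    unfolding conv_coord_def by (subst integral_mult_right[symmetric]) (simp only: exp_mult_exp, simp add: algebra_simps)
  ultimately show ?thesis by simp
qed

text \<open>Duality: for the difference w of the convolutions, |w|^2 is the integral of <F(x) -
  F(z), y> with y = exp((t - u) A_n) w, and |y| \<le> exp(-\<lambda>_1 (t - u)) |w|. Summing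
  separate bounds for the coordinates would cost a factor depending on n and destroy the margin L_F
  < \<lambda>_1.\<close>

lemma norm_conv_diff_le:
  assumes x: "continuous_on {0..t} x" and z: "continuous_on {0..t} z"
    and Lip: "\<And>u v. norm (F u - F v) \<le> L * norm (u - v)" and F: "continuous_on UNIV F"
  shows "norm (\<Sum>k=1..n. (conv_coord F x k t - conv_coord F z k t) *\<^sub>R e_basis k)
    \<le> L * exp_conv (eigval 1) (\<lambda>u. norm (x u - z u)) t"
proof -
  define J where "J k = conv_coord F x k t - conv_coord F z k t" for k
  define w where "w = (\<Sum>k=1..n. J k *\<^sub>R e_basis k)"
  define B where "B = exp_conv (eigval 1) (\<lambda>u. norm (x u - z u)) t"
  have Fx: "continuous_on {0..t} (\<lambda>s. F (x s))" and Fz: "continuous_on {0..t} (\<lambda>s. F (z s))"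
    by (rule continuous_on_compose2[OF F x] continuous_on_compose2[OF F z]; auto)+
  have J: "((\<lambda>u. exp (- eigval k * (t - u)) * coord k (F (x u) - F (z u))) has_integral J k) {0..t}" for k
  proof -
    have "((\<lambda>u. exp (- eigval k * (t - u)) * coord k (F (x u)) - exp (- eigval k * (t - u)) * coord k (F (z u)))
      has_integral J k) {0..t}"
      unfolding J_def conv_coord_def
      by (intro has_integral_diff integrable_integral integrable_continuous_real continuous_intros Fx Fz)
    then show ?thesis by (simp add: inner_diff_left right_diff_distrib)
  qed
  have W: "((\<lambda>u. \<Sum>k=1..n. J k * (exp (- eigval k * (t - u)) * coord k (F (x u) - F (z u))))
      has_integral (\<Sum>k=1..n. J k * J k)) {0..t}"
    by (intro has_integral_sum has_integral_mult_right J) auto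
  have BI: "((\<lambda>u. (norm w * L) * (exp (- eigval 1 * (t - u)) * norm (x u - z u))) has_integral (norm w * L) * B) {0..t}"
    unfolding B_def by (intro has_integral_mult_right integrable_integral integrable_continuous_real continuous_intros x z)
  have "(\<Sum>k=1..n. J k * J k) \<le> (norm w * L) * B"
  proof (rule has_integral_le[OF W BI])
    fix u assume u: "u \<in> {0..t}"
    define y where "y = (\<Sum>k=1..n. (J k * exp (- eigval k * (t - u))) *\<^sub>R e_basis k)"
    have "(norm y)^2 \<le> (exp (- eigval 1 * (t - u)) * norm w)^2"
    proof -
      have "(norm y)^2 = (\<Sum>k=1..n. (J k * exp (- eigval k * (t - u)))^2)"
        unfolding y_def by (rule norm_sum_e_basis)
      also have "\<dots> \<le> (\<Sum>k=1..n. (exp (- eigval 1 * (t - u)))^2 * (J k)^2)"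
      proof (rule sum_mono)
        fix k assume "k \<in> {1..n}"
        then have "exp (- eigval k * (t - u)) \<le> exp (- eigval 1 * (t - u))"
          using eigval_mono[of k] u by (auto intro!: mult_right_mono)
        then have "(exp (- eigval k * (t - u)))^2 \<le> (exp (- eigval 1 * (t - u)))^2"
          by (rule power_mono) simp
        then show "(J k * exp (- eigval k * (t - u)))^2 \<le> (exp (- eigval 1 * (t - u)))^2 * (J k)^2"
          unfolding power_mult_distrib by (subst mult.commute) (rule mult_right_mono, auto)
      qed
      also have "\<dots> = (exp (- eigval 1 * (t - u)) * norm w)^2"
        by (simp add: power_mult_distrib w_def norm_sum_e_basis sum_distrib_left del: One_nat_def)
      finally show ?thesis .
    qed
    then have y: "norm y \<le> exp (- eigval 1 * (t - u)) * norm w"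
      by (rule power2_le_imp_le) simp
    have "(\<Sum>k=1..n. J k * (exp (- eigval k * (t - u)) * coord k (F (x u) - F (z u)))) = inner (F (x u) - F (z u)) y"
      by (simp add: y_def inner_sum_right mult.assoc)
    also have "\<dots> \<le> norm (F (x u) - F (z u)) * norm y" by (rule norm_cauchy_schwarz)
    also have "\<dots> \<le> (L * norm (x u - z u)) * (exp (- eigval 1 * (t - u)) * norm w)"
      by (intro mult_mono Lip y) (use order_trans[OF norm_ge_zero Lip] in auto)
    finally show "(\<Sum>k=1..n. J k * (exp (- eigval k * (t - u)) * coord k (F (x u) - F (z u))))
        \<le> (norm w * L) * (exp (- eigval 1 * (t - u)) * norm (x u - z u))"
      by (simp add: mult_ac)
  qed
  moreover have "(\<Sum>k=1..n. J k * J k) = norm w * norm w"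
    using norm_sum_e_basis[of J n] by (simp add: w_def power2_eq_square)
  ultimately have *: "norm w * norm w \<le> norm w * (L * B)" by (simp add: mult.assoc)
  have "0 \<le> L" using order_trans[OF norm_ge_zero Lip[of "e_basis 1" 0]] norm_e_basis[of 1] by simp
  moreover have "0 \<le> B" unfolding B_def by (intro integral_nonneg integrable_continuous_real continuous_intros x z) auto
  ultimately have "norm w \<le> L * B" using * by (cases "norm w = 0") (auto simp: mult_le_cancel_left)
  then show ?thesis by (simp add: w_def J_def B_def)
qed

lemma norm_lipschitz_continuous:
  assumes "\<And>u v. norm (F u - F v) \<le> L * norm (u - v)" "0 \<le> L"
  shows "continuous_on UNIV F"
  by (rule lipschitz_on_continuous_on[of L]) (use assms in \<open>auto simp: lipschitz_on_def dist_norm\<close>)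

text \<open>Neither path has to solve an equation: \<open>b\<close> adds up, over the modes, the
  differences of what remains after subtracting the drift convolution, which in the application is a
  stochastic convolution on one side and a control convolution on the other. Gronwall lowers the
  decay rate \<open>eigval 1\<close> of the drift kernel to \<open>eigval 1 - L\<close>.\<close>

lemma mild_comparison:
  assumes x: "continuous_on {0..s} x" "x ` {0..s} \<subseteq> Hn n" and z: "continuous_on {0..s} z" "z ` {0..s} \<subseteq> Hn n"
    and Lip: "\<And>u v. norm (F u - F v) \<le> L * norm (u - v)" and "0 \<le> s" "0 \<le> L"
  defines "b \<equiv> \<lambda>t. \<Sum>k=1..n. \<bar>(coord k (x t) - conv_coord F x k t) - (coord k (z t) - conv_coord F z k t)\<bar>"
  shows "continuous_on {0..s} b"
    and "norm (x s - z s) \<le> b s + L * integral {0..s} (\<lambda>u. exp (- (eigval 1 - L) * (s - u)) * b u)"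
proof -
  have F: "continuous_on UNIV F" by (rule norm_lipschitz_continuous[OF Lip \<open>0 \<le> L\<close>])
  show b: "continuous_on {0..s} b"
    unfolding b_def by (intro continuous_intros x z conv_coord_continuous F)
  show "norm (x s - z s) \<le> b s + L * integral {0..s} (\<lambda>u. exp (- (eigval 1 - L) * (s - u)) * b u)"
  proof (rule gronwall_convolution[OF _ b \<open>0 \<le> s\<close> \<open>0 \<le> L\<close>, where a="\<lambda>t. norm (x t - z t)"])
    show "continuous_on {0..s} (\<lambda>t. norm (x t - z t))" by (intro continuous_intros x z)
    fix t assume t: "t \<in> {0..s}"
    then have sub: "{0..t} \<subseteq> {0..s}" by auto
    define \<eta> where "\<eta> k = (coord k (x t) - conv_coord F x k t) - (coord k (z t) - conv_coord F z k t)" for k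
    have "x t - z t = (\<Sum>k=1..n. coord k (x t - z t) *\<^sub>R e_basis k)"
      using x(2) z(2) t by (intro Hn_expansion) (auto simp: Hn_def intro!: span_diff)
    also have "\<dots> = (\<Sum>k=1..n. \<eta> k *\<^sub>R e_basis k) + (\<Sum>k=1..n. (conv_coord F x k t - conv_coord F z k t) *\<^sub>R e_basis k)"
      by (simp add: \<eta>_def sum.distrib[symmetric] scaleR_add_left[symmetric] inner_diff_left)
    finally have "norm (x t - z t) \<le> norm (\<Sum>k=1..n. \<eta> k *\<^sub>R e_basis k) + norm (\<Sum>k=1..n. (conv_coord F x k t - conv_coord F z k t) *\<^sub>R e_basis k)"
      using norm_triangle_ineq by metis
    moreover have "norm (\<Sum>k=1..n. \<eta> k *\<^sub>R e_basis k) \<le> b t"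
      unfolding b_def \<eta>_def[symmetric]
      by (rule order_trans[OF norm_sum]) (auto intro!: sum_mono simp: norm_e_basis)
    moreover have "norm (\<Sum>k=1..n. (conv_coord F x k t - conv_coord F z k t) *\<^sub>R e_basis k)
        \<le> L * exp_conv (eigval 1) (\<lambda>u. norm (x u - z u)) t"
      by (intro norm_conv_diff_le F Lip continuous_on_subset[OF x(1) sub] continuous_on_subset[OF z(1) sub])
    ultimately show "norm (x t - z t) \<le> b t + L * exp_conv (eigval 1) (\<lambda>u. norm (x u - z u)) t"
      by linarith
  qed
qed

text \<open>Induction over the cells, each contributing an error of at most \<open>e' * h\<close> by
  uniform continuity. It serves to replace the Gronwall integral by values at countably many
  times.\<close>

lemma left_riemann_sum_tendsto:
  fixes g :: "real \<Rightarrow> real"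
  assumes g: "continuous_on {0..s} g" and "0 < s"
  shows "(\<lambda>N. \<Sum>j<Suc N. s / real (Suc N) * g (real j * (s / real (Suc N)))) \<longlonglongrightarrow> integral {0..s} g"
proof (rule LIMSEQ_I)
  fix e :: real assume "e > 0"
  define e' where "e' = e / (2 * s)"
  have "e' > 0" using \<open>e > 0\<close> \<open>0 < s\<close> by (simp add: e'_def)
  have "uniformly_continuous_on {0..s} g" by (intro compact_uniformly_continuous g) simp
  then obtain d where d: "d > 0" "\<And>u v. u \<in> {0..s} \<Longrightarrow> v \<in> {0..s} \<Longrightarrow> dist v u < d \<Longrightarrow> dist (g v) (g u) < e'"
    using \<open>e' > 0\<close> unfolding uniformly_continuous_on_def by meson
  have "(\<lambda>N. s / real (Suc N)) \<longlonglongrightarrow> 0"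
    using tendsto_mult_right_zero[OF LIMSEQ_Suc[OF lim_1_over_n], of s] by simp
  then have "eventually (\<lambda>N. s / real (Suc N) < d) sequentially" using d(1) by (rule order_tendstoD(2))
  then obtain N0 where N0: "\<And>N. N \<ge> N0 \<Longrightarrow> s / real (Suc N) < d" by (auto simp: eventually_sequentially)
  show "\<exists>no. \<forall>N\<ge>no. norm ((\<Sum>j<Suc N. s / real (Suc N) * g (real j * (s / real (Suc N)))) - integral {0..s} g) < e"
  proof (intro exI[of _ N0] allI impI)
    fix N assume "N0 \<le> N"
    define h where "h = s / real (Suc N)"
    have h: "0 < h" "h < d" "real (Suc N) * h = s" using N0[OF \<open>N0 \<le> N\<close>] \<open>0 < s\<close> by (auto simp: h_def)
    have top: "real K * h \<le> s" if "K \<le> Suc N" for K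
    proof -
      have "real K * h \<le> real (Suc N) * h" by (rule mult_right_mono) (use that h(1) in auto)
      then show ?thesis by (simp only: h(3))
    qed
    have "\<bar>(\<Sum>j<K. h * g (real j * h)) - integral {0..real K * h} g\<bar> \<le> real K * h * e'" if "K \<le> Suc N" for K
      using that
    proof (induction K)
      case (Suc K)
      have K: "real (Suc K) * h \<le> s" by (rule top[OF Suc.prems])
      have nn: "0 \<le> real K * h" "real K * h \<le> real (Suc K) * h" using h(1) by (auto simp: algebra_simps)
      have gi: "g integrable_on {0..real (Suc K) * h}"
        by (intro integrable_continuous_real continuous_on_subset[OF g]) (use K in auto)
      have gc: "g integrable_on {real K * h..real (Suc K) * h}"
        by (intro integrable_continuous_real continuous_on_subset[OF g]) (use K nn in auto)
      have cmb: "integral {0..real K * h} g + integral {real K * h..real (Suc K) * h} g = integral {0..real (Suc K) * h} g"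
        by (rule Henstock_Kurzweil_Integration.integral_combine[OF nn gi])
      have "((\<lambda>u. g (real K * h) - g u) has_integral (h * g (real K * h) - integral {real K * h..real (Suc K) * h} g)) {real K * h..real (Suc K) * h}"
      proof (rule has_integral_diff)
        show "((\<lambda>u. g (real K * h)) has_integral h * g (real K * h)) {real K * h..real (Suc K) * h}"
          using has_integral_const_real[of "g (real K * h)" "real K * h" "real (Suc K) * h"] h(1)
          by (simp add: algebra_simps)
      qed (rule integrable_integral[OF gc])
      moreover have "\<bar>g (real K * h) - g u\<bar> \<le> e'" if u: "u \<in> {real K * h..real (Suc K) * h}" for u
      proof -
        have "dist (real K * h) u < d" using u h(2) by (auto simp: dist_real_def algebra_simps)
        then show ?thesis using d(2)[of u "real K * h"] u K nn by (auto simp: dist_real_def)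
      qed
      ultimately have "\<bar>h * g (real K * h) - integral {real K * h..real (Suc K) * h} g\<bar> \<le> e' * h"
        using has_integral_bound_real[of e' "{}" "\<lambda>u. g (real K * h) - g u" _ "real K * h" "real (Suc K) * h"] \<open>e' > 0\<close> h(1)
        by (simp add: algebra_simps)
      moreover have "\<bar>(\<Sum>j<K. h * g (real j * h)) - integral {0..real K * h} g\<bar> \<le> real K * h * e'"
        using Suc by simp
      moreover have "real (Suc K) * h * e' = real K * h * e' + e' * h" by (simp add: algebra_simps)
      ultimately show ?case using cmb by (simp only: sum.lessThan_Suc)
    qed simp
    from this[of "Suc N"] have "\<bar>(\<Sum>j<Suc N. h * g (real j * h)) - integral {0..s} g\<bar> \<le> s * e'"
      using h(3) by simp
    also have "s * e' < e" using \<open>0 < s\<close> \<open>e > 0\<close> by (simp add: e'_def)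
    finally show "norm ((\<Sum>j<Suc N. s / real (Suc N) * g (real j * (s / real (Suc N)))) - integral {0..s} g) < e"
      by (simp add: h_def)
  qed
qed

text \<open>From 1 + \<kappa> h \<le> exp(\<kappa> h), each term at a left endpoint is at most an
  increment of the exponential divided by \<kappa>, and the sum telescopes. The bound is free of
  \<open>s\<close> and \<open>N\<close>, which gives uniformity in time and in the mesh.\<close>

lemma exp_riemann_sum_le:
  assumes "\<kappa> > 0" "s > 0"
  shows "(\<Sum>j<Suc N. s / real (Suc N) * exp (- \<kappa> * (s - real j * (s / real (Suc N))))) \<le> 1 / \<kappa>"
proof -
  define h where "h = s / real (Suc N)"
  define x where "x j = exp (- \<kappa> * (s - real j * h))" for j
  have h: "h > 0" "real (Suc N) * h = s" using assms by (auto simp: h_def)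
  have "h * x j \<le> (x (Suc j) - x j) / \<kappa>" for j
  proof -
    have "x (Suc j) = x j * exp (\<kappa> * h)" by (simp add: x_def exp_add[symmetric] algebra_simps)
    moreover have "1 + \<kappa> * h \<le> exp (\<kappa> * h)" by (rule exp_ge_add_one_self)
    ultimately have "x j * (1 + \<kappa> * h) \<le> x (Suc j)" by (simp add: x_def)
    then show ?thesis using \<open>\<kappa> > 0\<close> by (simp add: field_simps)
  qed
  then have "(\<Sum>j<Suc N. h * x j) \<le> (\<Sum>j<Suc N. (x (Suc j) - x j) / \<kappa>)" by (intro sum_mono) auto
  also have "\<dots> = (x (Suc N) - x 0) / \<kappa>"
    by (simp only: sum_divide_distrib[symmetric] sum_lessThan_telescope)
  also have "\<dots> \<le> 1 / \<kappa>"
  proof (rule divide_right_mono)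
    have "x (Suc N) = 1" using h(2) by (simp add: x_def)
    moreover have "0 \<le> x 0" by (simp add: x_def)
    ultimately show "x (Suc N) - x 0 \<le> 1" by linarith
  qed (use \<open>\<kappa> > 0\<close> in simp)
  finally show ?thesis by (simp add: h_def x_def)
qed

section \<open>Step controls\<close>

lemma integral_grid_sum:
  fixes f :: "real \<Rightarrow> real"
  assumes f: "f integrable_on {0..real m * h}" and "0 \<le> h" "K \<le> m"
  shows "(\<Sum>j<K. integral {real j * h..real (Suc j) * h} f) = integral {0..real K * h} f"
  using \<open>K \<le> m\<close>
proof (induction K)
  case (Suc K)
  have nn: "0 \<le> real K * h" "real K * h \<le> real (Suc K) * h" "real (Suc K) * h \<le> real m * h"
    using \<open>0 \<le> h\<close> Suc.prems by (auto intro!: mult_right_mono)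
  have "f integrable_on {0..real (Suc K) * h}"
    by (rule integrable_on_subinterval[OF f]) (use nn in auto)
  from Henstock_Kurzweil_Integration.integral_combine[OF nn(1,2) this] show ?case
    using Suc by simp
qed simp

text \<open>Averaging over the cells of a fine grid. By Jensen's inequality the energy does not
  grow, and the primitive of the averaged control interpolates the primitive of \<open>f\<close>
  linearly, so uniform continuity of that primitive gives the deviation bound; no L^2 approximation
  of \<open>f\<close> is involved.\<close>

lemma step_control_approx:
  fixes f :: "real \<Rightarrow> real"
  assumes f: "f integrable_on {0..T}" and f2: "(\<lambda>u. (f u)^2) integrable_on {0..T}" and "0 < T" "0 < \<tau>"
  obtains qs where "wf_elem qs" "elem_energy qs \<le> integral {0..T} (\<lambda>u. (f u)^2)"
    "elem_fun qs integrable_on {0..T}"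
    "\<And>t. t \<in> {0..T} \<Longrightarrow> \<bar>integral {0..t} f - integral {0..t} (elem_fun qs)\<bar> \<le> \<tau>"
proof -
  define \<Psi> where "\<Psi> t = integral {0..t} f" for t
  have "continuous_on {0..T} \<Psi>" unfolding \<Psi>_def by (rule indefinite_integral_continuous_1[OF f])
  then have "uniformly_continuous_on {0..T} \<Psi>" by (rule compact_uniformly_continuous) simp
  then obtain d where d: "d > 0" "\<And>u v. u \<in> {0..T} \<Longrightarrow> v \<in> {0..T} \<Longrightarrow> dist v u < d \<Longrightarrow> dist (\<Psi> v) (\<Psi> u) < \<tau> / 2"
    using \<open>\<tau> > 0\<close> unfolding uniformly_continuous_on_def by (meson half_gt_zero)
  obtain m0 where m0: "T / d < real m0" using reals_Archimedean2 by blast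
  define m where "m = Suc m0"
  define h where "h = T / real m"
  have m: "0 < m" "T / d < real m" using m0 by (auto simp: m_def)
  have h: "0 < h" "h < d" "real m * h = T"
    using m \<open>0 < T\<close> d(1) by (auto simp: h_def field_simps)
  define c where "c j = (\<Psi> (real (Suc j) * h) - \<Psi> (real j * h)) / h" for j
  define qs where "qs = map (\<lambda>j. (real j * h, real (Suc j) * h, c j)) [0..<m]"
  have grid: "real j * h \<le> real (Suc j) * h" for j using h(1) by (simp add: algebra_simps)
  have top: "0 \<le> real K * h" "real K * h \<le> T" if "K \<le> m" for K
    using that h(1) mult_right_mono[of "real K" "real m" h] unfolding h(3) by auto
  have ei: "elem_int g qs = (\<Sum>j<m. c j * (g (real (Suc j) * h) - g (real j * h)))" for g
    by (simp add: elem_int_def qs_def comp_def interv_sum_list_conv_sum_set_nat atLeast0LessThan)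
  have wf: "wf_elem qs"
    using h(1) grid by (auto simp: wf_elem_def qs_def)
  have fcell: "f integrable_on {real j * h..real (Suc j) * h}" "(\<lambda>u. (f u)^2) integrable_on {real j * h..real (Suc j) * h}"
    if "j < m" for j
    using top[of j] top[of "Suc j"] that
    by (auto intro!: integrable_on_subinterval[OF f] integrable_on_subinterval[OF f2])
  have ccell: "integral {real j * h..real (Suc j) * h} f = c j * h" if "j < m" for j
  proof -
    have "f integrable_on {0..real (Suc j) * h}"
      using top[of "Suc j"] that by (auto intro!: integrable_on_subinterval[OF f])
    from Henstock_Kurzweil_Integration.integral_combine[OF _ grid this] h(1) show ?thesis
      by (simp add: c_def \<Psi>_def)
  qed
  have "elem_energy qs = (\<Sum>j<m. (c j)^2 * (real (Suc j) * h - real j * h))"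
    unfolding elem_fun_def ei by (rule grid_square_integral[where ts="\<lambda>j. real j * h"]) (rule grid)
  also have "\<dots> = (\<Sum>j<m. (c j)^2 * h)" by (simp add: algebra_simps)
  also have "\<dots> \<le> (\<Sum>j<m. integral {real j * h..real (Suc j) * h} (\<lambda>u. (f u)^2))"
  proof (rule sum_mono)
    fix j assume "j \<in> {..<m}"
    then have j: "j < m" by simp
    \<comment> \<open>Jensen's inequality on one cell, from the nonnegative integral of (f -
      c)^2.\<close>
    have "((\<lambda>u. (f u)^2 - (2 * c j) * f u + (c j)^2) has_integral
        integral {real j * h..real (Suc j) * h} (\<lambda>u. (f u)^2) - (2 * c j) * (c j * h) + (c j)^2 * h) {real j * h..real (Suc j) * h}"
    proof (intro has_integral_add has_integral_diff has_integral_mult_right)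
      show "(f has_integral c j * h) {real j * h..real (Suc j) * h}"
        using integrable_integral[OF fcell(1)[OF j]] by (simp only: ccell[OF j])
      show "((\<lambda>u. (c j)^2) has_integral (c j)^2 * h) {real j * h..real (Suc j) * h}"
        using has_integral_const_real[of "(c j)^2" "real j * h" "real (Suc j) * h"] h(1) by (simp add: algebra_simps)
    qed (rule integrable_integral[OF fcell(2)[OF j]])
    then have "0 \<le> integral {real j * h..real (Suc j) * h} (\<lambda>u. (f u)^2) - (2 * c j) * (c j * h) + (c j)^2 * h"
    proof (rule has_integral_nonneg)
      fix u
      have "(f u)^2 - (2 * c j) * f u + (c j)^2 = (f u - c j)^2" by (simp add: power2_diff)
      then show "0 \<le> (f u)^2 - (2 * c j) * f u + (c j)^2" by simp
    qed
    then show "(c j)^2 * h \<le> integral {real j * h..real (Suc j) * h} (\<lambda>u. (f u)^2)"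
      by (simp add: power2_eq_square algebra_simps)
  qed
  also have "\<dots> = integral {0..T} (\<lambda>u. (f u)^2)"
    using integral_grid_sum[of "\<lambda>u. (f u)^2" m h m] f2 h by simp
  finally have energy: "elem_energy qs \<le> integral {0..T} (\<lambda>u. (f u)^2)" .
  have step: "((\<lambda>u. if u \<le> b then 1 else 0) has_integral min t b) {0..t}" if "0 \<le> b" "0 \<le> t" for b t :: real
  proof -
    have "((\<lambda>u. 1) has_integral min t b) {0..min t b}"
      using has_integral_const_real[of "1::real" 0 "min t b"] that by simp
    then have "((\<lambda>u. if u \<in> {0..min t b} then 1 else 0) has_integral min t b) {0..t}"
      by (subst has_integral_restrict) auto
    then show ?thesis by (rule has_integral_eq[rotated]) auto
  qed
  \<comment> \<open>The indicator of u \<le> b has integral min t b over [0,t], so the primitive of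
    a coded step function is its functional at \<open>min t\<close>.\<close>
  have prim: "(elem_fun qs has_integral elem_int (min t) qs) {0..t}" if "0 \<le> t" for t
    unfolding elem_fun_def[abs_def] ei
    by (intro has_integral_sum has_integral_mult_right has_integral_diff step that) (use h(1) in auto)
  have dev: "\<bar>\<Psi> t - elem_int (min t) qs\<bar> \<le> \<tau>" if t: "t \<in> {0..T}" for t
  proof -
    have ex: "\<exists>J<m. t \<in> {real J * h..real (Suc J) * h}"
    proof (cases "t = T")
      case True
      then show ?thesis using m(1) grid[of "m - 1"] h(3) by (intro exI[of _ "m - 1"]) auto
    next
      case False
      define J where "J = nat \<lfloor>t / h\<rfloor>"
      have q: "0 \<le> t / h" using t h(1) by simp
      then have "real J \<le> t / h" "t / h < real J + 1" by (auto simp: J_def of_nat_nat)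
      then have 1: "real J * h \<le> t" "t < real (Suc J) * h" using h(1) by (auto simp: field_simps)
      have "t < real m * h" using False t h(3) by simp
      with 1(1) have "real J * h < real m * h" by simp
      then have "J < m" using h(1) by (simp add: mult_less_cancel_right)
      then show ?thesis using 1 by auto
    qed
    then obtain J where J: "J < m" "real J * h \<le> t" "t \<le> real (Suc J) * h" by auto
    \<comment> \<open>Cells before J are complete and telescope, cell J contributes its linear part,
      later cells contribute nothing.\<close>
    have "elem_int (min t) qs = (\<Sum>j<m. if j < J then \<Psi> (real (Suc j) * h) - \<Psi> (real j * h)
        else if j = J then c J * (t - real J * h) else 0)"
      unfolding ei
    proof (intro sum.cong refl)
      fix j
      consider "j < J" | "j = J" | "J < j" by linarith
      then show "c j * (min t (real (Suc j) * h) - min t (real j * h)) =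
        (if j < J then \<Psi> (real (Suc j) * h) - \<Psi> (real j * h) else if j = J then c J * (t - real J * h) else 0)"
      proof cases
        case 1
        then have "real (Suc j) * h \<le> real J * h" using h(1) by (intro mult_right_mono) auto
        then have "real (Suc j) * h \<le> t" using J by simp
        then have eq: "min t (real (Suc j) * h) - min t (real j * h) = h" using grid[of j] by (simp add: min_def algebra_simps)
        show ?thesis unfolding eq c_def using 1 h(1) by simp
      next
        case 2
        then show ?thesis using J by (simp add: min_def)
      next
        case 3
        then have "real (Suc J) * h \<le> real j * h" using h(1) by (intro mult_right_mono) auto
        then have "t \<le> real j * h" using J by simp
        then have "min t (real (Suc j) * h) - min t (real j * h) = 0" using grid[of j] by (simp add: min_def)
        then show ?thesis using 3 by simp
      qed
    qed
    also have "\<dots> = (\<Sum>j<J. \<Psi> (real (Suc j) * h) - \<Psi> (real j * h)) + c J * (t - real J * h)"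
    proof -
      have "(\<Sum>j<m. if j < J then \<Psi> (real (Suc j) * h) - \<Psi> (real j * h) else if j = J then c J * (t - real J * h) else 0)
        = (\<Sum>j<Suc J. if j < J then \<Psi> (real (Suc j) * h) - \<Psi> (real j * h) else if j = J then c J * (t - real J * h) else 0)"
        by (rule sum.mono_neutral_right) (use J(1) in auto)
      then show ?thesis by simp
    qed
    also have "(\<Sum>j<J. \<Psi> (real (Suc j) * h) - \<Psi> (real j * h)) = \<Psi> (real J * h) - \<Psi> (real 0 * h)"
      by (rule sum_lessThan_telescope)
    finally have e: "elem_int (min t) qs = \<Psi> (real J * h) + (t - real J * h) / h * (\<Psi> (real (Suc J) * h) - \<Psi> (real J * h))"
      by (simp add: c_def \<Psi>_def)
    have tJ: "real J * h \<in> {0..T}" "real (Suc J) * h \<in> {0..T}" using top[of J] top[of "Suc J"] J(1) by auto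
    have hh: "real (Suc J) * h - real J * h = h" by (simp add: algebra_simps)
    have 1: "\<bar>\<Psi> t - \<Psi> (real J * h)\<bar> < \<tau> / 2"
      using d(2)[OF tJ(1) t] J hh h(2) by (simp add: dist_real_def)
    have 2: "\<bar>\<Psi> (real (Suc J) * h) - \<Psi> (real J * h)\<bar> < \<tau> / 2"
      using d(2)[OF tJ] hh h by (simp add: dist_real_def)
    have "\<bar>(t - real J * h) / h\<bar> \<le> 1" using J hh h(1) by simp
    then have "\<bar>(t - real J * h) / h * (\<Psi> (real (Suc J) * h) - \<Psi> (real J * h))\<bar> \<le> 1 * \<bar>\<Psi> (real (Suc J) * h) - \<Psi> (real J * h)\<bar>"
      unfolding abs_mult by (rule mult_right_mono) simp
    moreover have "\<bar>a - (b + x)\<bar> \<le> \<tau>" if "\<bar>x\<bar> \<le> 1 * \<bar>y\<bar>" "\<bar>a - b\<bar> < \<tau> / 2" "\<bar>y\<bar> < \<tau> / 2" for a b x y :: real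
      using that by linarith
    ultimately show ?thesis unfolding e using 1 2 by blast
  qed
  show ?thesis
  proof (rule that[OF wf energy])
    show "elem_fun qs integrable_on {0..T}" using prim[of T] \<open>0 < T\<close> by (auto simp: integrable_on_def)
    show "\<bar>integral {0..t} f - integral {0..t} (elem_fun qs)\<bar> \<le> \<tau>" if "t \<in> {0..T}" for t
      using dev[OF that] prim[of t] that by (simp add: \<Psi>_def integral_unique)
  qed
qed

text \<open>Second mean value theorem: the kernel is increasing with values in [0,1], so weighted
  integrals are controlled by primitives alone. The constant 3 is 1 + 2: one \<tau> for the piece up
  to c, two for the piece from c to t, a difference of two primitives. The bound does not grow with
  \<open>l\<close> or \<open>t\<close>.\<close>

lemma exp_kernel_bound:
  fixes f g :: "real \<Rightarrow> real"
  assumes f: "f integrable_on {0..t}" and g: "g integrable_on {0..t}" and "0 \<le> t" "0 \<le> l"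
    and dev: "\<And>c. c \<in> {0..t} \<Longrightarrow> \<bar>integral {0..c} f - integral {0..c} g\<bar> \<le> \<tau>"
  shows "(\<lambda>u. exp (- l * (t - u)) * f u) integrable_on {0..t}"
    "\<bar>exp_conv l f t - exp_conv l g t\<bar> \<le> 3 * \<tau>"
proof -
  have mono: "exp (- l * (t - x)) \<le> exp (- l * (t - y))" if "x \<le> y" for x y :: real
    using that \<open>0 \<le> l\<close> by (auto intro!: mult_left_mono)
  have int: "(\<lambda>u. exp (- l * (t - u)) * f u) integrable_on {0..t}" if "f integrable_on {0..t}" for f :: "real \<Rightarrow> real"
    by (rule second_mean_value_theorem_full[OF that \<open>0 \<le> t\<close>, of "\<lambda>u. exp (- l * (t - u))"])
      (use mono in \<open>auto intro: has_integral_integrable\<close>)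
  show "(\<lambda>u. exp (- l * (t - u)) * f u) integrable_on {0..t}" by (rule int[OF f])
  have w: "(\<lambda>u. f u - g u) integrable_on {0..t}" by (rule Henstock_Kurzweil_Integration.integrable_diff[OF f g])
  obtain c where c: "c \<in> {0..t}"
    "exp_conv l (\<lambda>u. (f u - g u)) t
      = exp (- l * (t - 0)) * integral {0..c} (\<lambda>u. f u - g u) + exp (- l * (t - t)) * integral {c..t} (\<lambda>u. f u - g u)"
    by (rule second_mean_value_theorem[OF w \<open>0 \<le> t\<close>, of "\<lambda>u. exp (- l * (t - u))"]) (use mono in auto)
  have W: "\<bar>integral {0..x} (\<lambda>u. f u - g u)\<bar> \<le> \<tau>" if "x \<in> {0..t}" for x
  proof -
    have "f integrable_on {0..x}" "g integrable_on {0..x}"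
      by (rule integrable_on_subinterval[OF f] integrable_on_subinterval[OF g]; use that in auto)+
    then show ?thesis using dev[OF that] by (simp add: Henstock_Kurzweil_Integration.integral_diff)
  qed
  have cmb: "integral {0..c} (\<lambda>u. f u - g u) + integral {c..t} (\<lambda>u. f u - g u) = integral {0..t} (\<lambda>u. f u - g u)"
    by (rule Henstock_Kurzweil_Integration.integral_combine) (use c w in auto)
  have "\<bar>exp (- l * (t - 0)) * integral {0..c} (\<lambda>u. f u - g u)\<bar> \<le> 1 * \<bar>integral {0..c} (\<lambda>u. f u - g u)\<bar>"
    unfolding abs_mult using \<open>0 \<le> l\<close> \<open>0 \<le> t\<close> by (intro mult_right_mono) auto
  then have "\<bar>exp_conv l (\<lambda>u. (f u - g u)) t\<bar> \<le> 3 * \<tau>"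
    using W[OF c(1)] W[of t] cmb \<open>0 \<le> t\<close> unfolding c(2) by simp
  then show "\<bar>exp_conv l f t - exp_conv l g t\<bar> \<le> 3 * \<tau>"
    using int[OF f] int[OF g] by (simp add: Henstock_Kurzweil_Integration.integral_diff[symmetric] right_diff_distrib)
qed

text \<open>The variance of an Ornstein-Uhlenbeck process started at 0 stays below its stationary
  value; this bounds the Gaussian deviations uniformly in time.\<close>

lemma exp_kernel_square:
  fixes l t r :: real
  assumes "0 < l" "0 \<le> t"
  shows "(LINT s|lborel. (indicator {0..t} s * (r * exp (- l * (t - s))))^2) \<le> r^2 / (2 * l)"
proof -
  have "((\<lambda>s. r^2 * exp (- (2 * l) * (t - s))) has_integral
      (r^2 * exp (- (2 * l) * (t - t)) / (2 * l) - r^2 * exp (- (2 * l) * (t - 0)) / (2 * l))) {0..t}"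
    using assms by (intro fundamental_theorem_of_calculus)
      (auto intro!: derivative_eq_intros simp flip: has_real_derivative_iff_has_vector_derivative)
  then have "integral {0..t} (\<lambda>s. r^2 * exp (- (2 * l) * (t - s)))
      = r^2 * exp (- (2 * l) * (t - t)) / (2 * l) - r^2 * exp (- (2 * l) * (t - 0)) / (2 * l)"
    by (rule integral_unique)
  also have "\<dots> \<le> r^2 / (2 * l)" using assms by simp
  finally have I: "integral {0..t} (\<lambda>s. r^2 * exp (- (2 * l) * (t - s))) \<le> r^2 / (2 * l)" .
  have "(indicator {0..t} s * (r * exp (- l * (t - s))))^2 = indicator {0..t} s *\<^sub>R (r^2 * exp (- (2 * l) * (t - s)))" for s
    by (auto simp: indicator_def power_mult_distrib power2_eq_square[of "exp _"] exp_add[symmetric] algebra_simps)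
  then have "(LINT s|lborel. (indicator {0..t} s * (r * exp (- l * (t - s))))^2) = (LINT s:{0..t}|lborel. r^2 * exp (- (2 * l) * (t - s)))"
    unfolding set_lebesgue_integral_def by (simp only:)
  also have "\<dots> = integral {0..t} (\<lambda>s. r^2 * exp (- (2 * l) * (t - s)))"
    by (intro set_borel_integral_eq_integral borel_integrable_atLeastAtMost' continuous_intros)
  finally show ?thesis using I by simp
qed

section \<open>Delayed skeleton paths and the change of measure\<close>

lemma delayed_integral:
  fixes G :: "real \<Rightarrow> real"
  assumes "0 \<le> \<sigma>" "\<sigma> \<le> t" and 0: "\<And>u. u < \<sigma> \<Longrightarrow> G u = 0"
    and i: "(\<lambda>v. G (\<sigma> + v)) integrable_on {0..t - \<sigma>}"
  shows "(G has_integral integral {0..t - \<sigma>} (\<lambda>v. G (\<sigma> + v))) {0..t}"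
proof -
  have "(G has_integral 0) {0..\<sigma>}"
    by (rule has_integral_spike_finite[where S="{\<sigma>}" and f="\<lambda>_. 0"]) (use 0 in auto)
  moreover have "((G \<circ> (+) \<sigma>) has_integral integral {0..t - \<sigma>} (\<lambda>v. G (\<sigma> + v))) {0..t - \<sigma>}"
    using integrable_integral[OF i] by (simp add: comp_def)
  then have "(G has_integral integral {0..t - \<sigma>} (\<lambda>v. G (\<sigma> + v))) {\<sigma>..t}"
    by (subst (asm) has_integral_shift_Icc_real) simp
  ultimately have "(G has_integral (0 + integral {0..t - \<sigma>} (\<lambda>v. G (\<sigma> + v)))) {0..t}"
    by (rule has_integral_combine[OF \<open>0 \<le> \<sigma>\<close> \<open>\<sigma> \<le> t\<close>])
  then show ?thesis by simp
qed

lemma delayed_integral_0: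
  fixes G :: "real \<Rightarrow> real"
  assumes "t \<le> \<sigma>" and 0: "\<And>u. u < \<sigma> \<Longrightarrow> G u = 0"
  shows "(G has_integral 0) {0..t}"
  by (rule has_integral_spike_finite[where S="{\<sigma>}" and f="\<lambda>_. 0"]) (use assms in auto)

lemma control_coord_integrable:
  assumes \<psi>: "\<psi> \<in> control_L2 n T" and k: "1 \<le> k" "k \<le> n"
  shows "(\<lambda>u. coord k (\<psi> u)) integrable_on {0..T}"
    "(\<lambda>u. (coord k (\<psi> u))^2) integrable_on {0..T}"
    "integrable (lebesgue_on {0..T}) (\<lambda>u. (coord k (\<psi> u))^2)"
proof -
  let ?M = "lebesgue_on {0..T}"
  have "\<psi> \<in> ?M \<rightarrow>\<^sub>M borel" and i: "integrable ?M (\<lambda>t. (norm (\<psi> t))^2)"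
    using \<psi> by (auto simp: control_L2_def measurable_restrict_space2_iff)
  then have m [measurable]: "(\<lambda>u. coord k (\<psi> u)) \<in> borel_measurable ?M"
    by (rule_tac measurable_compose[where N=borel]) (auto intro!: borel_measurable_continuous_onI continuous_intros)
  show sq: "integrable ?M (\<lambda>u. (coord k (\<psi> u))^2)"
  proof (rule Bochner_Integration.integrable_bound[OF i])
    have "(coord k (\<psi> u))^2 \<le> (norm (\<psi> u))^2" for u
      using Cauchy_Schwarz_ineq2[of "\<psi> u" "e_basis k"] norm_e_basis[OF k(1)] by (simp add: abs_le_square_iff[symmetric])
    then show "AE u in ?M. norm ((coord k (\<psi> u))^2) \<le> norm ((norm (\<psi> u))^2)" by simp
  qed simp
  have "integrable ?M (\<lambda>u. 1 :: real)"
    by (rule continuous_imp_integrable_real) simp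
  then have "integrable ?M (\<lambda>u. coord k (\<psi> u) * 1)"
    by (intro integrable_times_of_squares sq) auto
  then show "(\<lambda>u. coord k (\<psi> u)) integrable_on {0..T}"
    by (simp add: integrable_on_lebesgue_on)
  show "(\<lambda>u. (coord k (\<psi> u))^2) integrable_on {0..T}"
    using sq by (simp add: integrable_on_lebesgue_on)
qed

lemma control_energy_eq:
  assumes \<psi>: "\<psi> \<in> control_L2 n T"
  shows "control_energy T \<psi> = (\<Sum>i=1..n. integral {0..T} (\<lambda>u. (coord i (\<psi> u))^2))"
proof -
  have "\<psi> u \<in> Hn n" if "u \<in> {0..T}" for u
    using \<psi> that by (auto simp: control_L2_def measurable_restrict_space2_iff)
  then have "control_energy T \<psi> = (LINT u|lebesgue_on {0..T}. (\<Sum>i=1..n. (coord i (\<psi> u))^2))"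
    unfolding control_energy_def by (intro Bochner_Integration.integral_cong) (auto simp: Hn_norm simp del: One_nat_def)
  also have "\<dots> = (\<Sum>i=1..n. LINT u|lebesgue_on {0..T}. (coord i (\<psi> u))^2)"
    by (rule Bochner_Integration.integral_sum) (use control_coord_integrable(3)[OF \<psi>] in auto)
  also have "\<dots> = (\<Sum>i=1..n. integral {0..T} (\<lambda>u. (coord i (\<psi> u))^2))"
    by (intro sum.cong refl lebesgue_integral_eq_integral) (use control_coord_integrable(3)[OF \<psi>] in auto)
  finally show ?thesis .
qed

text \<open>Variation of constants in coordinates: expanding the control in the basis before
  applying \<open>R\<close> splits \<open>z\<close> into drift and control convolutions, the form in
  which \<open>mild_comparison\<close> measures deviations.\<close>

lemma skeleton_coord:
  assumes R: "bounded_linear R" and F: "continuous_on UNIV F"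
    and \<psi>: "\<psi> \<in> control_L2 n T" and sk: "skeleton_solution R F n T 0 \<psi> z"
    and t: "t \<in> {0..T}" and k: "1 \<le> k" "k \<le> n"
  shows "coord k (z t) = conv_coord F z k t
    + (\<Sum>i=1..n. coord k (R (e_basis i)) * exp_conv (eigval k) (\<lambda>u. coord i (\<psi> u)) t)"
proof -
  let ?h = "\<lambda>u. semigroup_n n (t - u) (Fn F n (z u) + sqrtQn R n (\<psi> u))"
  let ?r = "\<lambda>i k. coord k (R (e_basis i))"
  have \<psi>H: "\<psi> u \<in> Hn n" if "u \<in> {0..t}" for u
    using \<psi> that t by (auto simp: control_L2_def measurable_restrict_space2_iff)
  have z: "continuous_on {0..t} z" using sk t by (auto simp: skeleton_solution_def intro: continuous_on_subset)
  have Fz: "continuous_on {0..t} (\<lambda>s. F (z s))" by (rule continuous_on_compose2[OF F z]) auto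
  interpret R: bounded_linear R by (rule R)
  have in_Hn: "Fn F n v + sqrtQn R n w \<in> Hn n" for v w
    using Pn_in_Hn[of n "F v"] Pn_in_Hn[of n "R w"] unfolding Fn_def sqrtQn_def Hn_def by (rule span_add)
  have c: "coord j (?h u) = exp (- eigval j * (t - u)) * coord j (F (z u))
      + (\<Sum>i=1..n. ?r i j * (exp (- eigval j * (t - u)) * coord i (\<psi> u)))"
    if j: "1 \<le> j" "j \<le> n" and u: "u \<in> {0..t}" for j u
  proof -
    have "coord j (R (\<psi> u)) = coord j (R (\<Sum>i=1..n. coord i (\<psi> u) *\<^sub>R e_basis i))"
      using Hn_expansion[OF \<psi>H[OF u]] by simp
    also have "\<dots> = (\<Sum>i=1..n. coord i (\<psi> u) * ?r i j)"
      by (simp add: R.sum R.scaleR inner_sum_left)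
    finally show ?thesis
      unfolding inner_semigroup_n[OF in_Hn j] unfolding inner_add_left Fn_def sqrtQn_def inner_Pn[OF j]
      by (simp add: distrib_left sum_distrib_left mult_ac del: One_nat_def)
  qed
  have i1: "(\<lambda>u. exp (- eigval j * (t - u)) * coord j (F (z u))) integrable_on {0..t}" for j
    by (intro integrable_continuous_real continuous_intros Fz)
  have i2: "(\<lambda>u. ?r i j * (exp (- eigval j * (t - u)) * coord i (\<psi> u))) integrable_on {0..t}"
    if "1 \<le> j" "i \<in> {1..n}" for i j
  proof -
    have "(\<lambda>u. coord i (\<psi> u)) integrable_on {0..t}"
      by (rule integrable_on_subinterval[OF control_coord_integrable(1)[OF \<psi>]]) (use that t in auto)
    then show ?thesis
      using t eigval_pos[OF that(1)] by (intro integrable_on_mult_right exp_kernel_bound(1)) auto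
  qed
  have int: "(\<lambda>u. coord j (?h u)) integrable_on {0..t}" if j: "1 \<le> j" "j \<le> n" for j
    by (rule integrable_eq[rotated], rule c[OF j, symmetric], assumption)
      (intro Henstock_Kurzweil_Integration.integrable_add i1 integrable_sum i2 j(1); simp)
  have "z t = semigroup_n n t 0 + integral {0..t} ?h" using sk t by (simp add: skeleton_solution_def)
  then have "coord k (z t) = coord k (integral {0..t} ?h)" by (simp add: semigroup_n_zero)
  also have "\<dots> = integral {0..t} (\<lambda>u. coord k (?h u))"
    by (intro integral_Hn[where n=n] int k semigroup_n_in_Hn in_Hn)
  also have "\<dots> = integral {0..t} (\<lambda>u. exp (- eigval k * (t - u)) * coord k (F (z u))
      + (\<Sum>i=1..n. ?r i k * (exp (- eigval k * (t - u)) * coord i (\<psi> u))))"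
    by (intro Henstock_Kurzweil_Integration.integral_cong c k)
  also have "\<dots> = conv_coord F z k t + integral {0..t} (\<lambda>u. \<Sum>i=1..n. ?r i k * (exp (- eigval k * (t - u)) * coord i (\<psi> u)))"
    unfolding conv_coord_def
    by (intro Henstock_Kurzweil_Integration.integral_add i1 integrable_sum i2 k(1)) auto
  also have "integral {0..t} (\<lambda>u. \<Sum>i=1..n. ?r i k * (exp (- eigval k * (t - u)) * coord i (\<psi> u)))
      = (\<Sum>i=1..n. integral {0..t} (\<lambda>u. ?r i k * (exp (- eigval k * (t - u)) * coord i (\<psi> u))))"
    by (intro Henstock_Kurzweil_Integration.integral_sum i2 k(1)) auto
  finally show ?thesis by simp
qed

text \<open>Because \<open>F 0 = 0\<close>, a skeleton path may rest at \<open>0\<close> before it starts; delaying it makes it end at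
  any prescribed time \<open>s \<ge> T\<close> without extra cost.\<close>

lemma skeleton_delay:
  assumes R: "bounded_linear R" and F: "continuous_on UNIV F" "F 0 = 0"
    and \<psi>: "\<psi> \<in> control_L2 n T" and sk: "skeleton_solution R F n T 0 \<psi> z" and T: "0 < T" "T \<le> s"
  obtains x f where "continuous_on {0..s} x" "x ` {0..s} \<subseteq> Hn n" "x s = z T"
    "\<And>i. i \<in> {1..n} \<Longrightarrow> f i integrable_on {0..s}" "\<And>i. i \<in> {1..n} \<Longrightarrow> (\<lambda>u. (f i u)^2) integrable_on {0..s}"
    "(\<Sum>i=1..n. integral {0..s} (\<lambda>u. (f i u)^2)) = control_energy T \<psi>"
    "\<And>k t. k \<in> {1..n} \<Longrightarrow> t \<in> {0..s} \<Longrightarrow> coord k (x t) - conv_coord F x k t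
      = (\<Sum>i=1..n. coord k (R (e_basis i)) * exp_conv (eigval k) (f i) t)"
proof -
  define \<sigma> where "\<sigma> = s - T"
  have \<sigma>: "0 \<le> \<sigma>" "\<sigma> \<le> s" using T by (auto simp: \<sigma>_def)
  \<comment> \<open>The maximum makes the path rest at z(0) = 0 until time \<sigma>; the control
    \<open>f\<close> is switched off there.\<close>
  define x where "x t = z (max 0 (t - \<sigma>))" for t
  define f where "f i u = (if \<sigma> \<le> u then coord i (\<psi> (u - \<sigma>)) else 0)" for i u
  have z: "continuous_on {0..T} z" "z ` {0..T} \<subseteq> Hn n" using sk by (auto simp: skeleton_solution_def)
  have z0: "z 0 = 0" using sk T by (simp add: skeleton_solution_def semigroup_n_zero)
  have x: "continuous_on {0..s} x"
    unfolding x_def by (rule continuous_on_compose2[OF z(1)]) (use \<sigma> T in \<open>auto intro!: continuous_intros simp: \<sigma>_def\<close>)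
  have xH: "x ` {0..s} \<subseteq> Hn n"
  proof
    fix y assume "y \<in> x ` {0..s}"
    then obtain t where "t \<in> {0..s}" "y = z (max 0 (t - \<sigma>))" by (auto simp: x_def)
    then show "y \<in> Hn n" using z(2) T by (auto simp: \<sigma>_def max_def)
  qed
  \<comment> \<open>One shift serves both the control and its square; \<open>g 0 = 0\<close> makes
    \<open>g\<close> of the delayed control vanish before \<sigma>.\<close>
  have gen: "((\<lambda>u. g (f i u)) has_integral integral {0..T} (\<lambda>v. g (coord i (\<psi> v)))) {0..s}"
    if g: "(\<lambda>v. g (coord i (\<psi> v))) integrable_on {0..T}" "g 0 = 0" for g :: "real \<Rightarrow> real" and i
  proof -
    have T': "s - \<sigma> = T" by (simp add: \<sigma>_def)
    have fs: "f i (\<sigma> + v) = coord i (\<psi> v)" if "v \<in> {0..T}" for v using that by (simp add: f_def)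
    have "((\<lambda>u. g (f i u)) has_integral integral {0..s - \<sigma>} (\<lambda>v. g (f i (\<sigma> + v)))) {0..s}"
    proof (rule delayed_integral[OF \<sigma>])
      show "(\<lambda>v. g (f i (\<sigma> + v))) integrable_on {0..s - \<sigma>}"
        unfolding T' using g(1) by (rule integrable_eq) (simp add: fs)
    qed (simp add: f_def g(2))
    also have "integral {0..s - \<sigma>} (\<lambda>v. g (f i (\<sigma> + v))) = integral {0..T} (\<lambda>v. g (coord i (\<psi> v)))"
      unfolding T' by (intro Henstock_Kurzweil_Integration.integral_cong) (simp add: fs)
    finally show ?thesis .
  qed
  have fi: "(f i has_integral integral {0..T} (\<lambda>v. coord i (\<psi> v))) {0..s}"
    "((\<lambda>u. (f i u)^2) has_integral integral {0..T} (\<lambda>v. (coord i (\<psi> v))^2)) {0..s}" if "i \<in> {1..n}" for i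
    using gen[of "\<lambda>x. x" i] gen[of "\<lambda>x. x^2" i] control_coord_integrable(1,2)[OF \<psi>, of i] that by auto
  have coord: "coord k (x t) - conv_coord F x k t
      = (\<Sum>i=1..n. coord k (R (e_basis i)) * exp_conv (eigval k) (f i) t)"
    if k: "k \<in> {1..n}" and t: "t \<in> {0..s}" for k t
  \<comment> \<open>Before \<sigma> both sides vanish, the drift because F(0) = 0; from \<sigma> on
    all integrals are those of the original path at time t - \<sigma>.\<close>
  proof (cases "\<sigma> \<le> t")
    case False
    then have "conv_coord F x k t = 0" unfolding conv_coord_def
      by (intro integral_unique delayed_integral_0[of t \<sigma>]) (auto simp: x_def z0 F(2) max_def)
    moreover have "exp_conv (eigval k) (f i) t = 0" for i
      by (intro integral_unique delayed_integral_0[of t \<sigma>]) (use False in \<open>auto simp: f_def\<close>)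
    ultimately show ?thesis using False by (simp add: x_def z0)
  next
    case True
    define t' where "t' = t - \<sigma>"
    have t': "t' \<in> {0..T}" using t True by (auto simp: t'_def \<sigma>_def)
    have sub: "{0..t'} \<subseteq> {0..T}" using t' by auto
    have zc: "continuous_on {0..t'} z" by (rule continuous_on_subset[OF z(1) sub])
    have Fz: "continuous_on {0..t'} (\<lambda>s. F (z s))" by (rule continuous_on_compose2[OF F(1) zc]) auto
    have shift: "exp (- eigval k * (t - (\<sigma> + v))) = exp (- eigval k * (t' - v))" for v by (simp add: t'_def algebra_simps)
    have xs: "x (\<sigma> + v) = z v" if "v \<in> {0..t'}" for v using that by (simp add: x_def)
    have "((\<lambda>u. exp (- eigval k * (t - u)) * coord k (F (x u))) has_integral
        integral {0..t - \<sigma>} (\<lambda>v. exp (- eigval k * (t - (\<sigma> + v))) * coord k (F (x (\<sigma> + v))))) {0..t}"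
    proof (rule delayed_integral[OF \<sigma>(1) True])
      show "exp (- eigval k * (t - u)) * coord k (F (x u)) = 0" if "u < \<sigma>" for u
        using that by (simp add: x_def z0 F(2) max_def)
      have "(\<lambda>v. exp (- eigval k * (t' - v)) * coord k (F (z v))) integrable_on {0..t'}"
        by (intro integrable_continuous_real continuous_intros Fz)
      then show "(\<lambda>v. exp (- eigval k * (t - (\<sigma> + v))) * coord k (F (x (\<sigma> + v)))) integrable_on {0..t - \<sigma>}"
        unfolding shift t'_def[symmetric] by (rule integrable_eq) (simp add: xs)
    qed
    then have "conv_coord F x k t = exp_conv (eigval k) (\<lambda>v. coord k (F (x (\<sigma> + v)))) t'"
      unfolding conv_coord_def shift t'_def[symmetric] by (rule integral_unique)
    also have "\<dots> = conv_coord F z k t'"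
      unfolding conv_coord_def by (intro Henstock_Kurzweil_Integration.integral_cong) (simp add: xs)
    finally have 1: "conv_coord F x k t = conv_coord F z k t'" .
    have 2: "exp_conv (eigval k) (f i) t
        = exp_conv (eigval k) (\<lambda>u. coord i (\<psi> u)) t'" if i: "i \<in> {1..n}" for i
    proof -
      have fs: "f i (\<sigma> + v) = coord i (\<psi> v)" if "v \<in> {0..t'}" for v using that by (simp add: f_def)
      have "((\<lambda>u. exp (- eigval k * (t - u)) * f i u) has_integral
          integral {0..t - \<sigma>} (\<lambda>v. exp (- eigval k * (t - (\<sigma> + v))) * f i (\<sigma> + v))) {0..t}"
      proof (rule delayed_integral[OF \<sigma>(1) True])
        show "exp (- eigval k * (t - u)) * f i u = 0" if "u < \<sigma>" for u using that by (simp add: f_def)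
        have "(\<lambda>u. coord i (\<psi> u)) integrable_on {0..t'}"
          by (rule integrable_on_subinterval[OF control_coord_integrable(1)[OF \<psi>] sub]) (use i in auto)
        then have "(\<lambda>v. exp (- eigval k * (t' - v)) * coord i (\<psi> v)) integrable_on {0..t'}"
          using t' k eigval_pos[of k] by (intro exp_kernel_bound(1)) auto
        then show "(\<lambda>v. exp (- eigval k * (t - (\<sigma> + v))) * f i (\<sigma> + v)) integrable_on {0..t - \<sigma>}"
          unfolding shift t'_def[symmetric] by (rule integrable_eq) (simp add: fs)
      qed
      then have "exp_conv (eigval k) (f i) t
          = exp_conv (eigval k) (\<lambda>v. f i (\<sigma> + v)) t'"
        unfolding shift t'_def[symmetric] by (rule integral_unique)
      also have "\<dots> = exp_conv (eigval k) (\<lambda>u. coord i (\<psi> u)) t'"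
        by (intro Henstock_Kurzweil_Integration.integral_cong) (simp add: fs)
      finally show ?thesis .
    qed
    have "x t = z t'" using True by (simp add: x_def t'_def)
    then show ?thesis
      using skeleton_coord[OF R F(1) \<psi> sk t', of k] k 1 2 by (simp del: One_nat_def)
  qed
  have "(\<Sum>i=1..n. integral {0..s} (\<lambda>u. (f i u)^2)) = control_energy T \<psi>"
    unfolding control_energy_eq[OF \<psi>] by (intro sum.cong refl integral_unique fi(2))
  moreover have "x s = z T" using T by (simp add: x_def \<sigma>_def)
  ultimately show ?thesis
    using that[of x f] x xH fi has_integral_integrable coord by blast
qed

section \<open>Undoing the exponential tilt\<close>

lemma (in prob_space) tilt_mean_one:
  assumes [measurable]: "S \<in> borel_measurable M"
    and mgf: "\<And>b. nn_mean M (\<lambda>\<omega>. exp (b * S \<omega>)) = ennreal (exp (b^2 * E / 2))" and "0 < \<epsilon>"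
  shows "nn_mean M (\<lambda>\<omega>. exp (S \<omega> / \<epsilon> - E / (2 * \<epsilon>^2))) = 1"
proof -
  have "nn_mean M (\<lambda>\<omega>. exp (S \<omega> / \<epsilon> - E / (2 * \<epsilon>^2)))
      = (\<integral>\<^sup>+\<omega>. ennreal (exp (- (E / (2 * \<epsilon>^2)))) * ennreal (exp ((1 / \<epsilon>) * S \<omega>)) \<partial>M)"
    by (intro nn_integral_cong) (simp add: ennreal_mult'[symmetric] exp_add[symmetric])
  also have "\<dots> = ennreal (exp (- (E / (2 * \<epsilon>^2)))) * ennreal (exp ((1 / \<epsilon>)^2 * E / 2))"
    by (subst nn_integral_cmult) (measurable, simp only: mgf)
  also have "\<dots> = 1" by (simp add: ennreal_mult'[symmetric] exp_add[symmetric] power_one_over field_simps)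
  finally show ?thesis .
qed

text \<open>The tilted mass 1 is split: Markov's inequality bounds the part outside \<open>G\<close>
  by 1/4, exponential Chebyshev terms take at most 1/8 for each sign, and on the rest of
  \<open>G\<close> the density is at most \<open>p\<close>. Hence p P(G) \<ge> 1/2.\<close>

lemma (in prob_space) tilted_lower_bound:
  assumes S [measurable]: "S \<in> borel_measurable M" and X [measurable]: "X \<in> borel_measurable M"
    and mgf: "\<And>b. nn_mean M (\<lambda>\<omega>. exp (b * S \<omega>)) = ennreal (exp (b^2 * E / 2))"
    and "0 < \<epsilon>" "0 < \<rho>" and X0: "\<And>\<omega>. 0 \<le> X \<omega>"
    and small: "nn_mean M (\<lambda>\<omega>. exp (S \<omega> / \<epsilon> - E / (2 * \<epsilon>^2)) * X \<omega>) \<le> ennreal (\<rho> / 4)"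
  shows "exp (- (E / (2 * \<epsilon>^2)) - (E / 2 + 3) / \<epsilon>) / 2 \<le> prob {\<omega> \<in> space M. X \<omega> < \<rho>}"
proof -
  define G where "G = {\<omega> \<in> space M. X \<omega> < \<rho>}"
  have G [measurable]: "G \<in> events" unfolding G_def by measurable
  \<comment> \<open>Chosen for the Chebyshev terms: for b = 1 or b = -1 the mean of
    \<open>U b\<close> is exp(E/2 - K) = exp(-3), which is at most 1/8.\<close>
  define K where "K = E / 2 + 3"
  define D where "D \<omega> = exp (S \<omega> / \<epsilon> - E / (2 * \<epsilon>^2))" for \<omega>
  \<comment> \<open>Density times the Chebyshev weight exp(b (S - E/\<epsilon>) - K), which is at
    least 1 where b (S - E/\<epsilon>) exceeds K.\<close>
  define U where "U b \<omega> = exp (- (E / (2 * \<epsilon>^2)) - b * E / \<epsilon> - K) * exp ((1 / \<epsilon> + b) * S \<omega>)" for b \<omega>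
  have [measurable]: "D \<in> borel_measurable M" "U b \<in> borel_measurable M" for b
    unfolding D_def U_def by measurable
  have c: "nn_mean M (\<lambda>\<omega>. exp a * exp (b * S \<omega>)) = ennreal (exp (a + b^2 * E / 2))" for a b
  proof -
    have "nn_mean M (\<lambda>\<omega>. exp a * exp (b * S \<omega>)) = ennreal (exp a) * nn_mean M (\<lambda>\<omega>. exp (b * S \<omega>))"
      by (subst nn_integral_cmult[symmetric]) (auto simp: ennreal_mult')
    then show ?thesis by (simp add: mgf ennreal_mult'[symmetric] exp_add)
  qed
  have D1: "nn_mean M D = 1"
    unfolding D_def by (rule tilt_mean_one[OF S mgf \<open>0 < \<epsilon>\<close>])
  have e3: "exp (-3) \<le> (1 / 8 :: real)"
  proof -
    have "2 ^ 3 \<le> (exp 1 :: real) ^ 3" using exp_ge_add_one_self[of 1] by (intro power_mono) auto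
    also have "\<dots> = exp 3" by (simp add: exp_of_nat_mult[symmetric])
    finally show ?thesis by (simp add: exp_minus field_simps)
  qed
  have U1: "nn_mean M (\<lambda>\<omega>. U b \<omega>) \<le> ennreal (1 / 8)" if b: "b^2 = 1" for b
  proof -
    have "- (E / (2 * \<epsilon>^2)) - b * E / \<epsilon> - K + (1 / \<epsilon> + b)^2 * E / 2 = - 3 + (b^2 - 1) * E / 2"
      using \<open>0 < \<epsilon>\<close> by (simp add: K_def power2_sum field_simps power2_eq_square)
    then show ?thesis unfolding U_def c using b e3 by (simp add: ennreal_leI)
  qed
  define p where "p = exp (E / (2 * \<epsilon>^2) + K / \<epsilon>)"
  \<comment> \<open>Outside \<open>G\<close> the Markov term dominates the density; inside, either
    the density is at most \<open>p\<close> or \<open>U 1\<close> dominates it.\<close>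
  have ptw: "ennreal (D \<omega>) \<le> ennreal p * indicator G \<omega> + (ennreal (D \<omega> * X \<omega> / \<rho>) + (ennreal (U 1 \<omega>) + ennreal (U (-1) \<omega>)))"
    if \<omega>: "\<omega> \<in> space M" for \<omega>
  proof -
    have U0: "0 \<le> U b \<omega>" for b by (simp add: U_def)
    have UD: "U b \<omega> = D \<omega> * exp (b * (S \<omega> - E / \<epsilon>) - K)" for b
      by (simp add: U_def D_def exp_add[symmetric] algebra_simps)
    have D0: "0 < D \<omega>" by (simp add: D_def)
    have "D \<omega> \<le> p * indicator G \<omega> + (D \<omega> * X \<omega> / \<rho> + (U 1 \<omega> + U (-1) \<omega>))"
    proof (cases "\<omega> \<in> G")
      case False
      then have "\<rho> \<le> X \<omega>" using \<omega> by (auto simp: G_def)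
      then have "D \<omega> \<le> D \<omega> * X \<omega> / \<rho>" using D0 \<open>0 < \<rho>\<close> by (simp add: field_simps)
      then show ?thesis using False U0[of 1] U0[of "-1"] by simp
    next
      case True
      have X: "0 \<le> D \<omega> * X \<omega> / \<rho>" using D0 X0 \<open>0 < \<rho>\<close> by (simp add: less_imp_le)
      consider "S \<omega> - E / \<epsilon> \<le> K" | "K < S \<omega> - E / \<epsilon>" by linarith
      then show ?thesis
      proof cases
        case 1
        have "S \<omega> / \<epsilon> - E / (2 * \<epsilon>^2) = (S \<omega> - E / \<epsilon>) / \<epsilon> + E / (2 * \<epsilon>^2)"
          using \<open>0 < \<epsilon>\<close> by (simp add: field_simps power2_eq_square)
        also have "\<dots> \<le> K / \<epsilon> + E / (2 * \<epsilon>^2)" using 1 \<open>0 < \<epsilon>\<close> by (simp add: divide_right_mono)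
        finally have "D \<omega> \<le> p" by (simp add: D_def p_def)
        then show ?thesis using True X U0[of 1] U0[of "-1"] by simp
      next
        case 2
        then have "D \<omega> * 1 \<le> D \<omega> * exp (1 * (S \<omega> - E / \<epsilon>) - K)" using D0 by (intro mult_left_mono) auto
        then have "D \<omega> \<le> U 1 \<omega>" by (simp add: UD)
        moreover have "0 \<le> p" by (simp add: p_def)
        ultimately show ?thesis using True X U0[of "-1"] by simp
      qed
    qed
    then have "ennreal (D \<omega>) \<le> ennreal (p * indicator G \<omega> + (D \<omega> * X \<omega> / \<rho> + (U 1 \<omega> + U (-1) \<omega>)))" by (rule ennreal_leI)
    also have "\<dots> = ennreal p * indicator G \<omega> + (ennreal (D \<omega> * X \<omega> / \<rho>) + (ennreal (U 1 \<omega>) + ennreal (U (-1) \<omega>)))"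
      using U0 D0 X0 \<open>0 < \<rho>\<close> by (simp add: p_def ennreal_mult' ennreal_indicator[symmetric] less_imp_le)
    finally show ?thesis .
  qed
  have "1 = nn_mean M D" by (simp add: D1)
  also have "\<dots> \<le> (\<integral>\<^sup>+\<omega>. ennreal p * indicator G \<omega> + (ennreal (D \<omega> * X \<omega> / \<rho>) + (ennreal (U 1 \<omega>) + ennreal (U (-1) \<omega>))) \<partial>M)"
    by (rule nn_integral_mono[OF ptw])
  also have "\<dots> = ennreal p * emeasure M G + ((nn_mean M (\<lambda>\<omega>. D \<omega> * X \<omega> / \<rho>))
      + ((nn_mean M (\<lambda>\<omega>. U 1 \<omega>)) + nn_mean M (\<lambda>\<omega>. U (-1) \<omega>)))"
    by (subst nn_integral_add; simp?)+ (simp add: nn_integral_cmult_indicator)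
  also have "\<dots> \<le> ennreal p * emeasure M G + (ennreal (1 / 4) + (ennreal (1 / 8) + ennreal (1 / 8)))"
  proof (intro add_left_mono add_mono U1)
    have "nn_mean M (\<lambda>\<omega>. D \<omega> * X \<omega> / \<rho>) = ennreal (1 / \<rho>) * nn_mean M (\<lambda>\<omega>. D \<omega> * X \<omega>)"
      using \<open>0 < \<rho>\<close> by (subst nn_integral_cmult[symmetric]) (auto simp: ennreal_mult'[symmetric])
    also have "\<dots> \<le> ennreal (1 / \<rho>) * ennreal (\<rho> / 4)"
      using small by (intro mult_left_mono) (auto simp: D_def)
    also have "\<dots> = ennreal (1 / 4)" using \<open>0 < \<rho>\<close> by (simp add: ennreal_mult'[symmetric])
    finally show "nn_mean M (\<lambda>\<omega>. D \<omega> * X \<omega> / \<rho>) \<le> ennreal (1 / 4)" .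
  qed auto
  also have "\<dots> = ennreal (p * prob G + 1 / 2)"
  proof -
    have "ennreal (1 / 4) + (ennreal (1 / 8) + ennreal (1 / 8)) = ennreal (1 / 4 + (1 / 8 + 1 / 8))"
      by (simp only: ennreal_plus zero_le_divide_1_iff zero_le_numeral add_nonneg_nonneg)
    also have "1 / 4 + (1 / 8 + 1 / 8) = (1 / 2 :: real)" by simp
    finally show ?thesis
      by (simp only: emeasure_eq_measure p_def ennreal_mult'[symmetric] exp_ge_zero ennreal_plus[symmetric]
        zero_le_divide_1_iff zero_le_numeral mult_nonneg_nonneg measure_nonneg)
  qed
  finally have "1 \<le> p * prob G + 1 / 2"
    by (subst (asm) ennreal_1[symmetric], subst (asm) ennreal_le_iff) (auto simp: p_def)
  then have "exp (- (E / (2 * \<epsilon>^2)) - K / \<epsilon>) * (1 / 2) \<le> exp (- (E / (2 * \<epsilon>^2)) - K / \<epsilon>) * (p * prob G)"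
    by (intro mult_left_mono) auto
  then show ?thesis by (simp add: p_def K_def G_def exp_mult_exp)
qed

section \<open>Distance to the skeleton under the tilted measure\<close>

lemma (in prob_space) elem_int_sum_mgf:
  assumes W: "cylindrical_Wiener M \<beta>" and I: "finite I" "I \<subseteq> {1..}" and qs: "\<And>i. i \<in> I \<Longrightarrow> wf_elem (qs i)"
  shows "nn_mean M (\<lambda>\<omega>. exp (b * (\<Sum>i\<in>I. elem_Wiener \<beta> i \<omega> (qs i))))
    = ennreal (exp (b^2 * (\<Sum>i\<in>I. elem_energy (qs i)) / 2))"
  using cylindrical_Wiener_mgf[OF W I, of "\<lambda>i. map (\<lambda>(x, y, c). (x, y, b * c)) (qs i)"] qs
  by (simp add: elem_int_scale elem_fun_scale power_mult_distrib sum_distrib_left)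

lemma (in prob_space) elem_int_sum_measurable:
  assumes W: "cylindrical_Wiener M \<beta>" and I: "I \<subseteq> {1..}" and qs: "\<And>i. i \<in> I \<Longrightarrow> wf_elem (qs i)"
  shows "(\<lambda>\<omega>. \<Sum>i\<in>I. elem_Wiener \<beta> i \<omega> (qs i)) \<in> borel_measurable M"
  by (intro borel_measurable_sum elem_int_measurable qs) (use W I in \<open>auto simp: cylindrical_Wiener_def\<close>)

text \<open>Dividing the step functions by \<epsilon> turns the tilt into that of
  \<open>tilted_abs_moment\<close>. The covariance shift is then u/\<epsilon>, so after scaling the
  noise by \<epsilon> it is \<open>u\<close>, the convolution of the step control. The reference
  value \<open>w\<close> may differ from \<open>u\<close> at the price |w - u|, because the tilt has
  total mass 1.\<close>

lemma (in prob_space) tilted_coord_bound: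
  fixes r :: "nat \<Rightarrow> real"
  assumes W: "cylindrical_Wiener M \<beta>" and I: "finite I" "I \<subseteq> {1..}"
    and qs: "\<And>i. i \<in> I \<Longrightarrow> wf_elem (qs i)"
    and Y: "\<And>i. i \<in> I \<Longrightarrow> is_Wiener_integral M (\<beta> i) t (\<lambda>s. r i * exp (- l * (t - s))) (Y i)"
    and pos: "0 < l" "0 \<le> t" "0 < \<epsilon>" and v: "(\<Sum>i\<in>I. (r i)^2 / (2 * l)) \<le> v"
  defines "E \<equiv> (\<Sum>i\<in>I. elem_energy (qs i))"
    and "u \<equiv> (\<Sum>i\<in>I. r i * exp_conv l (elem_fun (qs i)) t)"
  shows "nn_mean M (\<lambda>\<omega>. exp ((\<Sum>i\<in>I. elem_Wiener \<beta> i \<omega> (qs i)) / \<epsilon> - E / (2 * \<epsilon>^2))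
      * \<bar>\<epsilon> * (\<Sum>i\<in>I. Y i \<omega>) - w\<bar>) \<le> ennreal (2 * \<epsilon> * exp (v / 2) + \<bar>w - u\<bar>)"
proof -
  define S where "S \<omega> = (\<Sum>i\<in>I. elem_Wiener \<beta> i \<omega> (qs i))" for \<omega>
  define D where "D \<omega> = exp (S \<omega> / \<epsilon> - E / (2 * \<epsilon>^2))" for \<omega>
  have [measurable]: "S \<in> borel_measurable M"
    unfolding S_def by (rule elem_int_sum_measurable[OF W I(2) qs])
  have [measurable]: "D \<in> borel_measurable M" unfolding D_def by measurable
  have Ym [measurable]: "(\<lambda>\<omega>. \<Sum>i\<in>I. Y i \<omega>) \<in> borel_measurable M"
    using Y by (intro borel_measurable_sum) (auto simp: is_Wiener_integral_def)
  let ?f = "\<lambda>i s. r i * exp (- l * (t - s))"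
  have fc: "continuous_on {0..t} (?f i)" for i by (intro continuous_intros)
  let ?ps = "\<lambda>i. map (\<lambda>(x, y, c). (x, y, (1 / \<epsilon>) * c)) (qs i)"
  have ps: "wf_elem (?ps i)" if "i \<in> I" for i
    unfolding wf_elem_scale by (rule qs[OF that])
  have E: "(\<Sum>i\<in>I. elem_energy (?ps i)) = E / \<epsilon>^2"
    unfolding elem_fun_scale E_def by (simp add: power_divide sum_divide_distrib)
  \<comment> \<open>The covariance of the tilting integral with the noise is the control convolution
    over \<epsilon>.\<close>
  have u: "(\<Sum>i\<in>I. LINT s|lborel. elem_fun (?ps i) s * (indicator {0..t} s * ?f i s)) = u / \<epsilon>"
  proof -
    have "(LINT s|lborel. elem_fun (?ps i) s * (indicator {0..t} s * ?f i s))
        = r i * exp_conv l (elem_fun (qs i)) t / \<epsilon>" if i: "i \<in> I" for i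
    proof -
      note 1 = elem_fun_integrable[OF qs[OF i]] and 2 = continuous_on_square_integrable[OF fc[of i]]
      note 3 = integrable_times_of_squares[of "elem_fun (qs i)" lborel, simplified, OF 1(2) 2(1) 1(1) 2(2)]
      have eq: "elem_fun (qs i) s * (indicator {0..t} s * ?f i s) = indicator {0..t} s *\<^sub>R (r i * (exp (- l * (t - s)) * elem_fun (qs i) s))" for s
        by (simp add: mult_ac)
      have "set_integrable lborel {0..t} (\<lambda>s. r i * (exp (- l * (t - s)) * elem_fun (qs i) s))"
        using 3 unfolding set_integrable_def eq[symmetric] by simp
      from set_borel_integral_eq_integral(2)[OF this]
      have "(LINT s|lborel. elem_fun (qs i) s * (indicator {0..t} s * ?f i s)) = r i * exp_conv l (elem_fun (qs i)) t"
        unfolding set_lebesgue_integral_def eq by simp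
      then show ?thesis unfolding elem_fun_scale by (simp add: mult.assoc)
    qed
    then show ?thesis by (simp add: u_def sum_divide_distrib)
  qed
  have v': "(\<Sum>i\<in>I. LINT s|lborel. (indicator {0..t} s * ?f i s)^2) \<le> v"
    using v by (rule order_trans[rotated]) (intro sum_mono exp_kernel_square pos)
  have sc: "(\<Sum>i\<in>I. elem_Wiener \<beta> i \<omega> (?ps i)) - E / \<epsilon>^2 / 2 = S \<omega> / \<epsilon> - E / (2 * \<epsilon>^2)" for \<omega>
    unfolding elem_int_scale S_def by (simp add: sum_divide_distrib)
  have A: "nn_mean M (\<lambda>\<omega>. D \<omega> * \<bar>(\<Sum>i\<in>I. Y i \<omega>) - u / \<epsilon>\<bar>) \<le> ennreal (2 * exp (v / 2))"
  proof -
    have "nn_mean M (\<lambda>\<omega>. D \<omega> * \<bar>(\<Sum>i\<in>I. Y i \<omega>) - u / \<epsilon>\<bar>)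
        \<le> ennreal (2 * exp ((\<Sum>i\<in>I. LINT s|lborel. (indicator {0..t} s * ?f i s)^2) / 2))"
      using tilted_abs_moment[of \<beta> I ?ps t ?f Y, OF W I ps Y fc] unfolding E u sc D_def by simp
    also have "\<dots> \<le> ennreal (2 * exp (v / 2))" using v' by (intro ennreal_leI) simp
    finally show ?thesis .
  qed
  have mgf: "nn_mean M (\<lambda>\<omega>. exp (b * S \<omega>)) = ennreal (exp (b^2 * E / 2))" for b
    unfolding S_def E_def by (rule elem_int_sum_mgf[OF W I qs])
  have D1: "nn_mean M D = 1"
    unfolding D_def by (rule tilt_mean_one[OF _ mgf pos(3)]) simp
  have "nn_mean M (\<lambda>\<omega>. D \<omega> * \<bar>\<epsilon> * (\<Sum>i\<in>I. Y i \<omega>) - w\<bar>)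
      \<le> (\<integral>\<^sup>+\<omega>. ennreal \<epsilon> * ennreal (D \<omega> * \<bar>(\<Sum>i\<in>I. Y i \<omega>) - u / \<epsilon>\<bar>) + ennreal \<bar>w - u\<bar> * ennreal (D \<omega>) \<partial>M)"
  proof (rule nn_integral_mono)
    fix \<omega>
    have D0: "0 \<le> D \<omega>" by (simp add: D_def)
    have "\<epsilon> * (\<Sum>i\<in>I. Y i \<omega>) - w = \<epsilon> * ((\<Sum>i\<in>I. Y i \<omega>) - u / \<epsilon>) - (w - u)"
      using pos by (simp add: field_simps)
    then have "\<bar>\<epsilon> * (\<Sum>i\<in>I. Y i \<omega>) - w\<bar> \<le> \<bar>\<epsilon> * ((\<Sum>i\<in>I. Y i \<omega>) - u / \<epsilon>)\<bar> + \<bar>w - u\<bar>" by linarith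
    then have "\<bar>\<epsilon> * (\<Sum>i\<in>I. Y i \<omega>) - w\<bar> \<le> \<epsilon> * \<bar>(\<Sum>i\<in>I. Y i \<omega>) - u / \<epsilon>\<bar> + \<bar>w - u\<bar>"
      using pos by (simp add: abs_mult)
    then have "D \<omega> * \<bar>\<epsilon> * (\<Sum>i\<in>I. Y i \<omega>) - w\<bar> \<le> D \<omega> * (\<epsilon> * \<bar>(\<Sum>i\<in>I. Y i \<omega>) - u / \<epsilon>\<bar> + \<bar>w - u\<bar>)"
      using D0 by (rule mult_left_mono)
    also have "\<dots> = \<epsilon> * (D \<omega> * \<bar>(\<Sum>i\<in>I. Y i \<omega>) - u / \<epsilon>\<bar>) + \<bar>w - u\<bar> * D \<omega>" by (simp add: algebra_simps)
    finally show "ennreal (D \<omega> * \<bar>\<epsilon> * (\<Sum>i\<in>I. Y i \<omega>) - w\<bar>)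
        \<le> ennreal \<epsilon> * ennreal (D \<omega> * \<bar>(\<Sum>i\<in>I. Y i \<omega>) - u / \<epsilon>\<bar>) + ennreal \<bar>w - u\<bar> * ennreal (D \<omega>)"
      using pos D0 by (simp add: ennreal_mult[symmetric] ennreal_plus[symmetric] ennreal_leI del: ennreal_plus)
  qed
  also have "\<dots> = ennreal \<epsilon> * nn_mean M (\<lambda>\<omega>. D \<omega> * \<bar>(\<Sum>i\<in>I. Y i \<omega>) - u / \<epsilon>\<bar>) + ennreal \<bar>w - u\<bar> * nn_mean M D"
    by (simp add: nn_integral_add nn_integral_cmult)
  also have "\<dots> \<le> ennreal \<epsilon> * ennreal (2 * exp (v / 2)) + ennreal \<bar>w - u\<bar> * 1"
    unfolding D1 by (intro add_right_mono mult_left_mono A) simp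
  also have "\<dots> = ennreal (2 * \<epsilon> * exp (v / 2) + \<bar>w - u\<bar>)"
    using pos by (simp add: ennreal_mult[symmetric] ennreal_plus[symmetric] mult_ac del: ennreal_plus)
  finally show ?thesis by (simp add: D_def S_def)
qed

text \<open>The Gronwall bound is pathwise, while tilted means are known only at fixed times. Its
  integral is approximated by Riemann sums, whose tilted means are bounded uniformly in the mesh,
  and Fatou's lemma passes to the limit. In the factor 1 + L/(\<open>eigval 1\<close> - L), the 1 is
  the boundary term at \<open>s\<close> and the quotient is L times a bound for the mass of the
  kernel.\<close>

lemma (in prob_space) mild_tilted_distance:
  assumes W: "cylindrical_Wiener M \<beta>" and Lip: "\<And>u v. norm (F u - F v) \<le> L * norm (u - v)"
    and L: "0 \<le> L" "L < eigval 1" and pos: "0 < \<epsilon>" "0 < s"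
    and X: "mild_solution M \<beta> R F n \<epsilon> 0 X"
    and x: "continuous_on {0..s} x" "x ` {0..s} \<subseteq> Hn n"
    and xf: "\<And>k t. k \<in> {1..n} \<Longrightarrow> t \<in> {0..s} \<Longrightarrow> coord k (x t) - conv_coord F x k t
      = (\<Sum>i=1..n. coord k (R (e_basis i)) * exp_conv (eigval k) (f i) t)"
    and f: "\<And>i. i \<in> {1..n} \<Longrightarrow> f i integrable_on {0..s}"
    and qs: "\<And>i. i \<in> {1..n} \<Longrightarrow> wf_elem (qs i)" "\<And>i. i \<in> {1..n} \<Longrightarrow> elem_fun (qs i) integrable_on {0..s}"
      "\<And>i t. i \<in> {1..n} \<Longrightarrow> t \<in> {0..s} \<Longrightarrow> \<bar>integral {0..t} (f i) - integral {0..t} (elem_fun (qs i))\<bar> \<le> \<tau>"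
    and v: "\<And>k. k \<in> {1..n} \<Longrightarrow> (\<Sum>i=1..n. (coord k (R (e_basis i)))^2 / (2 * eigval k)) \<le> v"
    and rs: "\<And>k. k \<in> {1..n} \<Longrightarrow> (\<Sum>i=1..n. \<bar>coord k (R (e_basis i))\<bar>) \<le> rs"
    and rs0: "0 \<le> rs" and \<tau>: "0 \<le> \<tau>"
  defines "E \<equiv> (\<Sum>i=1..n. elem_energy (qs i))"
  shows "nn_mean M (\<lambda>\<omega>. exp ((\<Sum>i=1..n. elem_Wiener \<beta> i \<omega> (qs i)) / \<epsilon> - E / (2 * \<epsilon>^2)) * norm (X s \<omega> - x s))
    \<le> ennreal (real n * (2 * \<epsilon> * exp (v / 2) + 3 * \<tau> * rs) * (1 + L / (eigval 1 - L)))"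
proof -
  define r where "r i k = coord k (R (e_basis i))" for i k
  define \<kappa> where "\<kappa> = eigval 1 - L"
  have "\<kappa> > 0" using L by (simp add: \<kappa>_def)
  have I: "finite {1..n}" "{1..n} \<subseteq> {1..}" by auto
  obtain Z where Z: "\<And>i t. i \<in> {1..n} \<Longrightarrow> 0 \<le> t \<Longrightarrow>
      is_Wiener_integral M (\<beta> i) t (\<lambda>s. semigroup_n n (t - s) (sqrtQn R n (e_basis i))) (Z i t)"
    and eq: "\<And>t. 0 \<le> t \<Longrightarrow> AE \<omega> in M. X t \<omega> = semigroup_n n t 0
             + integral {0..t} (\<lambda>s. semigroup_n n (t - s) (Fn F n (X s \<omega>)))
             + \<epsilon> *\<^sub>R (\<Sum>i=1..n. Z i t \<omega>)"
    using X unfolding mild_solution_def by blast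
  have Xm: "X t \<in> M \<rightarrow>\<^sub>M borel_Hn n" if "0 \<le> t" for t using X that by (simp add: mild_solution_def)
  have Xc: "AE \<omega> in M. continuous_on {0..} (\<lambda>t. X t \<omega>)" using X by (simp add: mild_solution_def)
  define Y where "Y i k t \<omega> = coord k (Z i t \<omega>)" for i k t \<omega>
  have Y: "is_Wiener_integral M (\<beta> i) t (\<lambda>s. r i k * exp (- eigval k * (t - s))) (Y i k t)"
    if "i \<in> {1..n}" "k \<in> {1..n}" "0 \<le> t" for i k t
  proof -
    have "coord k (semigroup_n n (t - s) (sqrtQn R n (e_basis i))) = r i k * exp (- eigval k * (t - s))" for s
      using that by (simp add: sqrtQn_def inner_semigroup_n Pn_in_Hn inner_Pn r_def)
    then show ?thesis
      using is_Wiener_integral_inner[OF Z[OF that(1,3)] norm_e_basis[of k]] that by (simp add: Y_def[abs_def])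
  qed
  define S where "S \<omega> = (\<Sum>i=1..n. elem_Wiener \<beta> i \<omega> (qs i))" for \<omega>
  define D where "D \<omega> = exp (S \<omega> / \<epsilon> - E / (2 * \<epsilon>^2))" for \<omega>
  have [measurable]: "S \<in> borel_measurable M"
    unfolding S_def by (rule elem_int_sum_measurable[OF W I(2) qs(1)])
  have Dm [measurable]: "D \<in> borel_measurable M" unfolding D_def by measurable
  have D0: "0 \<le> D \<omega>" for \<omega> by (simp add: D_def)
  define w where "w k t = (\<Sum>i=1..n. r i k * exp_conv (eigval k) (f i) t)" for k t
  define \<eta> where "\<eta> k t \<omega> = \<bar>\<epsilon> * (\<Sum>i=1..n. Y i k t \<omega>) - w k t\<bar>" for k t \<omega>
  \<comment> \<open>The deviation expressed through the stochastic convolutions: measurable at each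
    time and, at each fixed time in [0,s], almost surely equal to the continuous pathwise quantity
    \<open>b\<close> used below.\<close>
  define bh where "bh t \<omega> = (\<Sum>k=1..n. \<eta> k t \<omega>)" for t \<omega>
  have \<eta>m: "\<eta> k t \<in> borel_measurable M" if "k \<in> {1..n}" "0 \<le> t" for k t
    unfolding \<eta>_def using Y[OF _ that]
    by (intro borel_measurable_abs borel_measurable_diff borel_measurable_times borel_measurable_sum borel_measurable_const)
      (auto simp: is_Wiener_integral_def)
  have bm: "bh t \<in> borel_measurable M" if "0 \<le> t" for t
    unfolding bh_def by (intro borel_measurable_sum \<eta>m that)
  have b0: "0 \<le> bh t \<omega>" for t \<omega> by (simp add: bh_def \<eta>_def sum_nonneg)
  define c where "c = real n * (2 * \<epsilon> * exp (v / 2) + 3 * \<tau> * rs)"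
  have c0: "0 \<le> c" using pos rs0 \<tau> by (simp add: c_def)
  \<comment> \<open>For each mode, 2 \<epsilon> exp(v/2) is the Gaussian fluctuation and 3 \<tau> rs
    the error of replacing the control by step functions.\<close>
  have B1: "nn_mean M (\<lambda>\<omega>. D \<omega> * bh t \<omega>) \<le> ennreal c" if t: "t \<in> {0..s}" for t
  proof -
    have k: "nn_mean M (\<lambda>\<omega>. D \<omega> * \<eta> k t \<omega>) \<le> ennreal (2 * \<epsilon> * exp (v / 2) + 3 * \<tau> * rs)" if k: "k \<in> {1..n}" for k
    proof -
      define u where "u = (\<Sum>i=1..n. r i k * exp_conv (eigval k) (elem_fun (qs i)) t)"
      have lk: "0 < eigval k" using eigval_pos k by simp
      have "\<bar>w k t - u\<bar> = \<bar>\<Sum>i=1..n. r i k * (exp_conv (eigval k) (f i) t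
          - exp_conv (eigval k) (elem_fun (qs i)) t)\<bar>"
        by (simp add: w_def u_def sum_subtractf right_diff_distrib)
      also have "\<dots> \<le> (\<Sum>i=1..n. \<bar>r i k\<bar> * (3 * \<tau>))"
      proof (rule order_trans[OF sum_abs], rule sum_mono)
        fix i assume i: "i \<in> {1..n}"
        have sub: "f i integrable_on {0..t}" "elem_fun (qs i) integrable_on {0..t}"
          by (rule integrable_on_subinterval[OF f[OF i]] integrable_on_subinterval[OF qs(2)[OF i]]; use t in auto)+
        have "\<bar>exp_conv (eigval k) (f i) t
          - exp_conv (eigval k) (elem_fun (qs i)) t\<bar> \<le> 3 * \<tau>"
          by (rule exp_kernel_bound(2)[OF sub]) (use t lk qs(3)[OF i] in auto)
        then show "\<bar>r i k * (exp_conv (eigval k) (f i) t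
          - exp_conv (eigval k) (elem_fun (qs i)) t)\<bar> \<le> \<bar>r i k\<bar> * (3 * \<tau>)"
          unfolding abs_mult by (rule mult_left_mono) simp
      qed
      also have "\<dots> = 3 * \<tau> * (\<Sum>i=1..n. \<bar>r i k\<bar>)" by (simp add: sum_distrib_left mult_ac)
      also have "\<dots> \<le> 3 * \<tau> * rs" using rs[OF k] \<tau> by (intro mult_left_mono) (auto simp: r_def)
      finally have wu: "\<bar>w k t - u\<bar> \<le> 3 * \<tau> * rs" .
      have "nn_mean M (\<lambda>\<omega>. D \<omega> * \<eta> k t \<omega>) \<le> ennreal (2 * \<epsilon> * exp (v / 2) + \<bar>w k t - u\<bar>)"
        unfolding D_def S_def E_def \<eta>_def u_def
        by (rule tilted_coord_bound[OF W I qs(1) Y[OF _ k]]) (use t pos lk v[OF k] in \<open>auto simp: r_def\<close>)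
      also have "\<dots> \<le> ennreal (2 * \<epsilon> * exp (v / 2) + 3 * \<tau> * rs)" using wu by (intro ennreal_leI) simp
      finally show ?thesis .
    qed
    have "nn_mean M (\<lambda>\<omega>. D \<omega> * bh t \<omega>) = (\<integral>\<^sup>+\<omega>. (\<Sum>k=1..n. ennreal (D \<omega> * \<eta> k t \<omega>)) \<partial>M)"
      by (intro nn_integral_cong) (simp add: bh_def sum_distrib_left sum_ennreal D0 \<eta>_def)
    also have "\<dots> = (\<Sum>k=1..n. nn_mean M (\<lambda>\<omega>. D \<omega> * \<eta> k t \<omega>))"
      using \<eta>m t Dm by (intro nn_integral_sum) auto
    also have "\<dots> \<le> (\<Sum>k=1..n. ennreal (2 * \<epsilon> * exp (v / 2) + 3 * \<tau> * rs))" by (intro sum_mono k)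
    also have "\<dots> = ennreal c" using pos rs0 \<tau> by (simp add: c_def ennreal_mult ennreal_of_nat_eq_real_of_nat)
    finally show ?thesis .
  qed
  define h where "h N = s / real (Suc N)" for N
  define a where "a N j = L * (h N * exp (- \<kappa> * (s - real j * h N)))" for N j
  have a0: "0 \<le> a N j" for N j using L pos by (simp add: a_def h_def)
  have hs: "real j * h N \<in> {0..s}" if "j < Suc N" for j N
  proof -
    have "real j * h N \<le> real (Suc N) * h N" using that pos by (intro mult_right_mono) (auto simp: h_def)
    then show ?thesis using pos by (simp add: h_def)
  qed
  define B where "B N \<omega> = bh s \<omega> + (\<Sum>j<Suc N. a N j * bh (real j * h N) \<omega>)" for N \<omega>
  have B2: "nn_mean M (\<lambda>\<omega>. D \<omega> * B N \<omega>) \<le> ennreal (c * (1 + L / \<kappa>))" for N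
  proof -
    have "nn_mean M (\<lambda>\<omega>. D \<omega> * B N \<omega>)
        = (\<integral>\<^sup>+\<omega>. ennreal (D \<omega> * bh s \<omega>) + (\<Sum>j<Suc N. ennreal (a N j) * ennreal (D \<omega> * bh (real j * h N) \<omega>)) \<partial>M)"
    proof (intro nn_integral_cong)
      fix \<omega>
      have "D \<omega> * B N \<omega> = D \<omega> * bh s \<omega> + (\<Sum>j<Suc N. a N j * (D \<omega> * bh (real j * h N) \<omega>))"
        by (simp add: B_def distrib_left sum_distrib_left mult.left_commute del: sum.lessThan_Suc)
      moreover have "(\<Sum>j<Suc N. ennreal (a N j) * ennreal (D \<omega> * bh (real j * h N) \<omega>))
          = ennreal (\<Sum>j<Suc N. a N j * (D \<omega> * bh (real j * h N) \<omega>))"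
        by (simp add: ennreal_mult[symmetric] a0 D0 b0 sum_ennreal del: sum.lessThan_Suc)
      ultimately show "ennreal (D \<omega> * B N \<omega>)
        = ennreal (D \<omega> * bh s \<omega>) + (\<Sum>j<Suc N. ennreal (a N j) * ennreal (D \<omega> * bh (real j * h N) \<omega>))"
        by (simp add: ennreal_plus[symmetric] a0 D0 b0 sum_nonneg del: ennreal_plus sum.lessThan_Suc)
    qed
    also have "\<dots> = nn_mean M (\<lambda>\<omega>. D \<omega> * bh s \<omega>) + (\<Sum>j<Suc N. ennreal (a N j) * nn_mean M (\<lambda>\<omega>. D \<omega> * bh (real j * h N) \<omega>))"
    proof -
      have m: "(\<lambda>\<omega>. ennreal (D \<omega> * bh t \<omega>)) \<in> borel_measurable M" if "0 \<le> t" for t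
        using bm[OF that] Dm by measurable
      have m': "(\<lambda>\<omega>. ennreal (D \<omega> * bh (real j * h N) \<omega>)) \<in> borel_measurable M" for j
        using pos by (intro m) (simp add: h_def)
      show ?thesis
        using m[of s] m' pos by (subst nn_integral_add, simp, simp) (subst nn_integral_sum, auto simp: nn_integral_cmult simp del: sum.lessThan_Suc)
    qed
    also have "\<dots> \<le> ennreal c + (\<Sum>j<Suc N. ennreal (a N j) * ennreal c)"
      by (intro add_mono sum_mono mult_left_mono B1 hs) (use pos in auto)
    also have "\<dots> = ennreal (c + (\<Sum>j<Suc N. a N j) * c)"
      by (simp add: ennreal_mult[symmetric] a0 c0 sum_ennreal ennreal_plus[symmetric] sum_nonneg sum_distrib_right
        del: ennreal_plus sum.lessThan_Suc)
    also have "\<dots> \<le> ennreal (c * (1 + L / \<kappa>))"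
    proof (rule ennreal_leI)
      have "(\<Sum>j<Suc N. a N j) = L * (\<Sum>j<Suc N. h N * exp (- \<kappa> * (s - real j * h N)))"
        by (simp add: a_def sum_distrib_left del: sum.lessThan_Suc)
      also have "\<dots> \<le> L * (1 / \<kappa>)"
        unfolding h_def by (intro mult_left_mono exp_riemann_sum_le \<open>\<kappa> > 0\<close> pos L)
      finally have "(\<Sum>j<Suc N. a N j) * c \<le> L / \<kappa> * c" using c0 by (intro mult_right_mono) auto
      then show "c + (\<Sum>j<Suc N. a N j) * c \<le> c * (1 + L / \<kappa>)" by (simp add: algebra_simps)
    qed
    finally show ?thesis .
  qed
  \<comment> \<open>All grid points of all meshes, and s itself: countably many times, so outside
    one null set the mild equation holds at all of them.\<close>
  define T0 where "T0 = insert s (range (\<lambda>(j, N). real j * h N))"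
  have T0: "countable T0" "\<And>t. t \<in> T0 \<Longrightarrow> 0 \<le> t" using pos by (auto simp: T0_def h_def)
  have "AE \<omega> in M. \<forall>t\<in>T0. X t \<omega> = semigroup_n n t 0
             + integral {0..t} (\<lambda>s. semigroup_n n (t - s) (Fn F n (X s \<omega>)))
             + \<epsilon> *\<^sub>R (\<Sum>i=1..n. Z i t \<omega>)"
    using T0 eq by (subst AE_ball_countable) auto
  then have dist: "AE \<omega> in M. ennreal (D \<omega> * norm (X s \<omega> - x s)) \<le> liminf (\<lambda>N. ennreal (D \<omega> * B N \<omega>))"
    using Xc AE_space
  proof eventually_elim
    case (elim \<omega>)
    have Xs: "continuous_on {0..t} (\<lambda>t. X t \<omega>)" for t by (rule continuous_on_subset[OF elim(2)]) auto
    have XH: "(\<lambda>t. X t \<omega>) ` {0..s} \<subseteq> Hn n"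
      using measurable_space[OF Xm elim(3)] by (auto simp: space_restrict_space)
    define b where "b t = (\<Sum>k=1..n. \<bar>(coord k (X t \<omega>) - conv_coord F (\<lambda>t. X t \<omega>) k t) - (coord k (x t) - conv_coord F x k t)\<bar>)" for t
    have bc: "continuous_on {0..s} b"
      and d: "norm (X s \<omega> - x s) \<le> b s + L * integral {0..s} (\<lambda>u. exp (- (eigval 1 - L) * (s - u)) * b u)"
      using mild_comparison[OF Xs XH x Lip _ L(1)] pos unfolding b_def by auto
    have F: "continuous_on UNIV F" by (rule norm_lipschitz_continuous[OF Lip L(1)])
    have bb: "b t = bh t \<omega>" if t: "t \<in> T0" "t \<in> {0..s}" for t
      unfolding b_def bh_def
    proof (intro sum.cong refl)
      fix k assume k: "k \<in> {1..n}"
      have "coord k (X t \<omega>) = conv_coord F (\<lambda>t. X t \<omega>) k t + \<epsilon> * (\<Sum>i=1..n. Y i k t \<omega>)"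
        using elim(1) t(1) k
        by (subst bspec[OF elim(1) t(1)])
          (simp add: semigroup_n_zero inner_add_left inner_mild_drift[OF Xs F, of k n] inner_sum_left Y_def del: One_nat_def)
      then show "\<bar>(coord k (X t \<omega>) - conv_coord F (\<lambda>t. X t \<omega>) k t) - (coord k (x t) - conv_coord F x k t)\<bar> = \<eta> k t \<omega>"
        using xf[OF k t(2)] by (simp add: \<eta>_def w_def r_def del: One_nat_def)
    qed
    \<comment> \<open>Pathwise \<open>b\<close> is continuous, so its Riemann sums converge; on the
      grid its values are those of \<open>bh\<close>.\<close>
    have "(\<lambda>N. \<Sum>j<Suc N. h N * (exp (- \<kappa> * (s - real j * h N)) * b (real j * h N)))
        \<longlonglongrightarrow> exp_conv \<kappa> b s"
      unfolding h_def by (rule left_riemann_sum_tendsto) (use pos bc in \<open>auto intro!: continuous_intros\<close>)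
    moreover have "b (real j * h N) = bh (real j * h N) \<omega>" if "j < Suc N" for j N
      by (rule bb[OF _ hs[OF that]]) (auto simp: T0_def)
    then have "(\<Sum>j<Suc N. h N * (exp (- \<kappa> * (s - real j * h N)) * b (real j * h N)))
        = (\<Sum>j<Suc N. h N * (exp (- \<kappa> * (s - real j * h N)) * bh (real j * h N) \<omega>))" for N
      by (intro sum.cong refl) auto
    ultimately have "(\<lambda>N. \<Sum>j<Suc N. h N * (exp (- \<kappa> * (s - real j * h N)) * bh (real j * h N) \<omega>))
        \<longlonglongrightarrow> exp_conv \<kappa> b s"
      by (simp only:)
    from tendsto_add[OF tendsto_const tendsto_mult_left[OF this, of L], of "bh s \<omega>"]
    have "(\<lambda>N. B N \<omega>) \<longlonglongrightarrow> bh s \<omega> + L * exp_conv \<kappa> b s"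
      by (simp only: B_def a_def sum_distrib_left mult.assoc)
    then have "(\<lambda>N. ennreal (D \<omega> * B N \<omega>)) \<longlonglongrightarrow> ennreal (D \<omega> * (bh s \<omega> + L * exp_conv \<kappa> b s))"
      by (intro tendsto_ennrealI tendsto_mult tendsto_const)
    then have "liminf (\<lambda>N. ennreal (D \<omega> * B N \<omega>)) = ennreal (D \<omega> * (bh s \<omega> + L * exp_conv \<kappa> b s))"
      by (rule lim_imp_Liminf[OF trivial_limit_sequentially])
    moreover have "bh s \<omega> = b s" using bb[of s] pos by (simp add: T0_def)
    ultimately show ?case
      using d D0 by (simp add: \<kappa>_def ennreal_leI mult_left_mono)
  qed
  have "nn_mean M (\<lambda>\<omega>. D \<omega> * norm (X s \<omega> - x s)) \<le> (\<integral>\<^sup>+\<omega>. liminf (\<lambda>N. ennreal (D \<omega> * B N \<omega>)) \<partial>M)"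
    by (rule nn_integral_mono_AE[OF dist])
  also have "\<dots> \<le> liminf (\<lambda>N. nn_mean M (\<lambda>\<omega>. D \<omega> * B N \<omega>))"
  proof (rule nn_integral_liminf)
    fix N
    have [measurable]: "bh t \<in> borel_measurable M" if "t \<in> {0..s}" for t using that bm by simp
    have "B N \<in> borel_measurable M"
      unfolding B_def using hs pos
      by (intro borel_measurable_add borel_measurable_sum borel_measurable_times borel_measurable_const bm) auto
    then show "(\<lambda>\<omega>. ennreal (D \<omega> * B N \<omega>)) \<in> borel_measurable M" by measurable
  qed
  also have "\<dots> \<le> liminf (\<lambda>N::nat. ennreal (c * (1 + L / \<kappa>)))"
    by (intro Liminf_mono always_eventually allI B2)
  also have "\<dots> = ennreal (c * (1 + L / \<kappa>))" by (simp add: Liminf_const)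
  finally show ?thesis by (simp add: D_def S_def c_def \<kappa>_def)
qed

section \<open>Time averages and the lower bound\<close>

text \<open>\<open>measure_of\<close> falls back to the null measure when its argument is no
  measure, so a nonzero total mass certifies the formula. In the application this spares a proof
  that s -> P(X(s) in B) is measurable.\<close>

lemma measure_of_emeasure:
  assumes "sigma_algebra \<Omega> A" "emeasure (measure_of \<Omega> A \<mu>) \<Omega> \<noteq> 0" "B \<in> A"
  shows "emeasure (measure_of \<Omega> A \<mu>) B = \<mu> B"
proof -
  interpret sigma_algebra \<Omega> A by (rule assms(1))
  have s: "sigma_sets \<Omega> A = A" by (rule sigma_sets_eq)
  have "measure_space \<Omega> (sigma_sets \<Omega> A) \<mu>"
    using assms(2) space_closed by (auto simp: emeasure_measure_of_conv split: if_splits)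
  then show ?thesis using assms(3) space_closed by (simp add: emeasure_measure_of_conv s)
qed

text \<open>That \<open>time_average\<close> is a genuine measure for large times, and not the null measure that
  \<open>measure_of\<close> returns for functions that are not countably additive, is read off the weak
  convergence of the total masses.\<close>

lemma time_average_limit_lower_bound:
  assumes M: "prob_space M" and \<mu>: "time_average_limit M n X \<mu>"
    and lower: "\<And>s. T \<le> s \<Longrightarrow> p \<le> measure M {\<omega> \<in> space M. norm (X s \<omega> - y) < \<rho>}"
    and H: "\<And>s \<omega>. 0 \<le> s \<Longrightarrow> \<omega> \<in> space M \<Longrightarrow> X s \<omega> \<in> Hn n"
    and T: "0 \<le> T" "0 \<le> p" and \<rho>: "\<rho> < \<delta>"
  shows "p \<le> measure \<mu> {x \<in> Hn n. norm (x - y) < \<delta>}"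
proof -
  interpret prob_space M by (rule M)
  interpret \<mu>: prob_space \<mu> using \<mu> by (simp add: time_average_limit_def)
  have sets_\<mu>: "sets \<mu> = sets (borel_Hn n)" using \<mu> by (simp add: time_average_limit_def)
  have space_\<mu>: "space \<mu> = Hn n" using sets_eq_imp_space_eq[OF sets_\<mu>] by (simp add: space_restrict_space)
  obtain t :: "nat \<Rightarrow> real" where t: "\<And>i. 0 < t i" "filterlim t at_top sequentially"
    and wl: "weak_limit n (\<lambda>i. time_average M n X (t i)) \<mu>"
    using \<mu> by (auto simp: time_average_limit_def)
  define N where "N i = time_average M n X (t i)" for i
  have sa: "sigma_algebra (Hn n) (sets (borel_Hn n))"
    using sets.sigma_algebra_axioms[of "borel_Hn n"] by (simp add: space_restrict_space)
  have sub: "sets (borel_Hn n) \<subseteq> Pow (Hn n)"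
    using sets.space_closed[of "borel_Hn n"] by (simp add: space_restrict_space)
  have sets_N: "sets (N i) = sets (borel_Hn n)" for i
    unfolding N_def time_average_def using sub sigma_algebra.sigma_sets_eq[OF sa] by simp
  have space_N: "space (N i) = Hn n" for i
    unfolding N_def time_average_def using sub by simp
  have HN: "Hn n \<in> sets (N i)" for i using sets.top[of "N i"] by (simp add: space_N)
  have conv: "(\<lambda>i. LINT x|N i. f x) \<longlonglongrightarrow> (LINT x|\<mu>. f x)"
    if "continuous_on (Hn n) f" "bounded (f ` Hn n)" for f :: "L2 \<Rightarrow> real"
    using wl that by (simp add: weak_limit_def N_def)
  have "(\<lambda>i. LINT x|N i. (1::real)) \<longlonglongrightarrow> (LINT x|\<mu>. (1::real))"
    by (rule conv) (auto intro: continuous_on_const boundedI[of _ 1])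
  then have "(\<lambda>i. measure (N i) (Hn n)) \<longlonglongrightarrow> 1"
    using \<mu>.prob_space by (simp add: space_N space_\<mu>)
  then have "eventually (\<lambda>i. 0 < measure (N i) (Hn n)) sequentially"
    by (rule order_tendstoD) simp
  moreover have "eventually (\<lambda>i. T \<le> t i) sequentially"
    using t(2) by (simp add: filterlim_at_top)
  \<comment> \<open>Continuous cutoff, 1 on the \<rho>-ball and 0 outside the \<delta>-ball: weak
    convergence tests only continuous functions, whence the two radii.\<close>
  define g where "g x = max 0 (min 1 ((\<delta> - norm (x - y)) / (\<delta> - \<rho>)))" for x :: L2
  have gc: "continuous_on A g" for A unfolding g_def using \<rho> by (intro continuous_intros) auto
  have g01: "0 \<le> g x" "g x \<le> 1" for x by (auto simp: g_def)
  have g1: "g x = 1" if "norm (x - y) < \<rho>" for x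
    using that \<rho> by (simp add: g_def min_def max_def field_simps)
  have g0: "g x = 0" if "\<delta> \<le> norm (x - y)" for x
    using that \<rho> by (simp add: g_def min_def max_def divide_le_0_iff zero_le_divide_iff not_le)
  have gm: "g \<in> borel_measurable (borel_Hn n)"
    by (intro measurable_restrict_space1 borel_measurable_continuous_onI gc)
  have ball: "{x \<in> Hn n. norm (x - y) < r} \<in> sets (borel_Hn n)" for r
  proof -
    have "open {x. norm (x - y) < r}"
      by (intro open_Collect_less continuous_intros)
    then have "Hn n \<inter> {x. norm (x - y) < r} \<in> sets (borel_Hn n)"
      by (auto simp: sets_restrict_space)
    moreover have "Hn n \<inter> {x. norm (x - y) < r} = {x \<in> Hn n. norm (x - y) < r}" by auto
    ultimately show ?thesis by simp
  qed
  \<comment> \<open>Dropping the times before T costs the fraction T/t_i, which vanishes in the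
    limit.\<close>
  have low: "(1 - T / t i) * p \<le> (LINT x|N i. g x)" if pos: "0 < measure (N i) (Hn n)" and ti: "T \<le> t i" for i
  proof -
    have nz: "emeasure (N i) (Hn n) \<noteq> 0" using pos by (auto simp: measure_def)
    have em: "emeasure (N i) B = (\<integral>\<^sup>+s\<in>{0..t i}. emeasure M {\<omega> \<in> space M. X s \<omega> \<in> B} \<partial>lborel) / ennreal (t i)"
      if "B \<in> sets (borel_Hn n)" for B
      using measure_of_emeasure[OF sa, of "\<lambda>B. (\<integral>\<^sup>+s\<in>{0..t i}. emeasure M {\<omega> \<in> space M. X s \<omega> \<in> B} \<partial>lborel) / ennreal (t i)" B] nz that
      unfolding N_def time_average_def by simp
    have "emeasure (N i) (Hn n) \<le> (\<integral>\<^sup>+s\<in>{0..t i}. 1 \<partial>lborel) / ennreal (t i)"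
      unfolding em[OF HN[of i, unfolded sets_N]]
      by (intro divide_right_mono_ennreal nn_integral_mono mult_right_mono emeasure_le_1) simp
    also have "\<dots> < \<infinity>" using t(1)[of i] by (simp add: ennreal_divide_eq_top_iff less_top)
    finally have "finite_measure (N i)" by (intro finite_measureI) (simp add: space_N less_top)
    then interpret N: finite_measure "N i" .
    define B where "B = {x \<in> Hn n. norm (x - y) < \<rho>}"
    have B: "B \<in> sets (borel_Hn n)" unfolding B_def by (rule ball)
    have "ennreal ((t i - T) * p) = (\<integral>\<^sup>+s. ennreal p * indicator {T..t i} s \<partial>lborel)"
      using ti T by (simp add: nn_integral_cmult_indicator ennreal_mult[symmetric] mult.commute)
    also have "\<dots> \<le> (\<integral>\<^sup>+s\<in>{0..t i}. emeasure M {\<omega> \<in> space M. X s \<omega> \<in> B} \<partial>lborel)"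
    proof (rule nn_integral_mono)
      fix s
      show "ennreal p * indicator {T..t i} s \<le> emeasure M {\<omega> \<in> space M. X s \<omega> \<in> B} * indicator {0..t i} s"
      proof (cases "s \<in> {T..t i}")
        case True
        then have s: "T \<le> s" "0 \<le> s" "s \<in> {0..t i}" using T by auto
        have "{\<omega> \<in> space M. X s \<omega> \<in> B} = {\<omega> \<in> space M. norm (X s \<omega> - y) < \<rho>}"
          using H s by (auto simp: B_def)
        then show ?thesis using lower[OF s(1)] True s by (simp add: emeasure_eq_measure ennreal_leI)
      qed simp
    qed
    finally have "ennreal ((t i - T) * p) / ennreal (t i) \<le> emeasure (N i) B"
      unfolding em[OF B] by (rule divide_right_mono_ennreal)
    then have "ennreal ((t i - T) * p / t i) \<le> ennreal (measure (N i) B)"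
      using t(1)[of i] T ti by (simp add: divide_ennreal N.emeasure_eq_measure)
    then have "(t i - T) * p / t i \<le> measure (N i) B" by simp
    then have "(1 - T / t i) * p \<le> measure (N i) B" using t(1)[of i] by (simp add: field_simps)
    also have "\<dots> = (LINT x|N i. indicator B x)"
      using sets.sets_into_space[of B "N i"] B by (simp add: sets_N Int_absorb2)
    also have "\<dots> \<le> (LINT x|N i. g x)"
    proof (rule integral_mono)
      show "integrable (N i) (indicator B :: L2 \<Rightarrow> real)"
        using B N.emeasure_finite[of B] by (intro integrable_real_indicator) (simp_all add: sets_N less_top[symmetric])
      have "g \<in> borel_measurable (N i)" using gm measurable_cong_sets[OF sets_N refl] by blast
      then show "integrable (N i) g"
        by (rule N.integrable_const_bound[where B=1, rotated]) (use g01 in auto)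
      show "indicator B x \<le> g x" for x using g01 g1 by (auto simp: B_def indicator_def)
    qed
    finally show ?thesis .
  qed
  have "(\<lambda>i. LINT x|N i. g x) \<longlonglongrightarrow> (LINT x|\<mu>. g x)"
    by (rule conv[OF gc]) (use g01 in \<open>auto intro!: boundedI[of _ 1]\<close>)
  moreover have "(\<lambda>i. (1 - T / t i) * p) \<longlonglongrightarrow> (1 - 0) * p"
    by (intro tendsto_intros tendsto_divide_0[OF tendsto_const] filterlim_at_top_imp_at_infinity t(2))
  moreover have "eventually (\<lambda>i. (1 - T / t i) * p \<le> (LINT x|N i. g x)) sequentially"
    using \<open>eventually (\<lambda>i. 0 < measure (N i) (Hn n)) sequentially\<close> \<open>eventually (\<lambda>i. T \<le> t i) sequentially\<close>
    by eventually_elim (rule low)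
  ultimately have "(1 - 0) * p \<le> (LINT x|\<mu>. g x)"
    by (intro tendsto_le[OF trivial_limit_sequentially])
  also have "\<dots> \<le> (LINT x|\<mu>. indicator {x \<in> Hn n. norm (x - y) < \<delta>} x)"
  proof (rule integral_mono)
    have "g \<in> borel_measurable \<mu>" using gm measurable_cong_sets[OF sets_\<mu> refl] by blast
    then show "integrable \<mu> g"
      by (rule \<mu>.integrable_const_bound[where B=1, rotated]) (use g01 in auto)
    show "integrable \<mu> (indicator {x \<in> Hn n. norm (x - y) < \<delta>} :: L2 \<Rightarrow> real)"
      using ball[of \<delta>] \<mu>.emeasure_finite by (intro integrable_real_indicator) (simp_all add: sets_\<mu> less_top[symmetric])
    show "g x \<le> indicator {x \<in> Hn n. norm (x - y) < \<delta>} x" if "x \<in> space \<mu>" for x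
      using that g01[of x] g0[of x] by (auto simp: space_\<mu> indicator_def)
  qed
  also have "\<dots> = measure \<mu> {x \<in> Hn n. norm (x - y) < \<delta>}"
    using sets.sets_into_space[of _ \<mu>] ball[of \<delta>] by (simp add: sets_\<mu> Int_absorb2)
  finally show ?thesis by simp
qed

text \<open>The two nested infima are approximated together: a path of rate below V + g/2 has a
  control of energy below 2 V + g, the 2 undoing the 1/2 in the rate function. Nonnegativity
  excludes the value -\<infinity>, so V is real.\<close>

lemma quasi_potential_finite:
  assumes "quasi_potential R F n y \<noteq> \<infinity>"
  obtains V where "quasi_potential R F n y = ereal V" "0 \<le> V"
    "\<And>g. 0 < g \<Longrightarrow> \<exists>T z \<psi>. 0 < T \<and> z T = y \<and> \<psi> \<in> control_L2 n T \<and>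
        skeleton_solution R F n T 0 \<psi> z \<and> control_energy T \<psi> < 2 * V + g"
proof -
  have e0: "0 \<le> control_energy T \<psi>" for T \<psi>
    unfolding control_energy_def by (rule integral_nonneg_AE) simp
  have r0: "0 \<le> rate_function R F n T x z" for T x z
    unfolding rate_function_def by (intro ereal_0_le_mult Inf_greatest) (auto simp: e0)
  have q0: "0 \<le> quasi_potential R F n y"
    unfolding quasi_potential_def by (rule Inf_greatest) (auto simp: r0)
  then obtain V where V: "quasi_potential R F n y = ereal V" "0 \<le> V"
    using assms by (cases "quasi_potential R F n y") auto
  have "\<exists>T z \<psi>. 0 < T \<and> z T = y \<and> \<psi> \<in> control_L2 n T \<and>
        skeleton_solution R F n T 0 \<psi> z \<and> control_energy T \<psi> < 2 * V + g" if "0 < g" for g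
  proof -
    have "quasi_potential R F n y < ereal (V + g / 2)" using V that by simp
    then obtain T z where T: "0 < T" "z T = y" and r: "rate_function R F n T 0 z < ereal (V + g / 2)"
      unfolding quasi_potential_def Inf_less_iff by blast
    define J where "J = Inf {ereal (control_energy T \<psi>) |\<psi>. \<psi> \<in> control_L2 n T \<and> skeleton_solution R F n T 0 \<psi> z}"
    have "J < ereal (2 * V + g)"
    proof (rule ccontr)
      assume "\<not> J < ereal (2 * V + g)"
      then have "ereal (1 / 2) * ereal (2 * V + g) \<le> ereal (1 / 2) * J"
        by (intro ereal_mult_left_mono) auto
      then have "ereal (V + g / 2) \<le> ereal (1 / 2) * J" by (simp add: add_divide_distrib)
      then show False using r by (simp add: rate_function_def J_def)
    qed
    then obtain \<psi> where "\<psi> \<in> control_L2 n T" "skeleton_solution R F n T 0 \<psi> z" "control_energy T \<psi> < 2 * V + g"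
      unfolding J_def Inf_less_iff by auto
    then show ?thesis using T by blast
  qed
  then show ?thesis using that V by blast
qed

theorem theorem3p7:
  fixes Q R :: "L2 \<Rightarrow> L2" and q :: "nat \<Rightarrow> real"
    and F :: "L2 \<Rightarrow> L2" and F' :: "L2 \<Rightarrow> L2 \<Rightarrow> L2" and L_F L :: real
    and M :: "'w measure" and \<beta> :: "nat \<Rightarrow> real \<Rightarrow> 'w \<Rightarrow> real"
    and n :: nat and X :: "real \<Rightarrow> real \<Rightarrow> 'w \<Rightarrow> L2" and \<mu> :: "real \<Rightarrow> L2 measure"
  assumes Q: "bounded_linear Q" "selfadjoint_op Q" "positive_definite_op Q"
    and Q_eigen: "\<forall>i\<ge>1. 0 < q i \<and> Q (e_basis i) = q i *\<^sub>R e_basis i"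
    and R_sqrt_Q: "is_op_sqrt R Q"
    and dom_A_sub: "dom_A \<subseteq> range R"
    and HS: "range R \<subseteq> dom_neg_A_pow (1/2)" "hilbert_schmidt (\<lambda>u. neg_A_pow (1/2) (R u))"
    and bdd: "bounded_linear (\<lambda>u. inv R (neg_A_inv u))"
    and F_deriv: "\<forall>u. (F has_derivative F' u) (at u)"
    and const_pos: "0 < L_F" "0 < L"
    and F_Lipschitz: "\<forall>u v. norm (F u - F v) \<le> L_F * norm (u - v)"
    and F_Hdot1: "\<forall>u\<in>Hdot 1. F u \<in> Hdot 1 \<and> norm_Hdot 1 (F u) \<le> L * (1 + norm_Hdot 1 u)"
    and F'_Hdot2: "\<forall>u\<in>Hdot 2. \<forall>v\<in>Hdot 2. F' u v \<in> Hdot 2 \<and>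
          norm_Hdot 2 (F' u v) \<le> L * (1 + (norm_Hdot 2 u)\<^sup>2) * norm_Hdot 2 v"
    and F_zero: "F 0 = 0"
    and L_F_less: "L_F < eigval 1"
    and M: "prob_space M"
    and W: "cylindrical_Wiener M \<beta>"
    and n: "1 \<le> n"
    and X: "\<forall>\<epsilon>>0. mild_solution M \<beta> R F n \<epsilon> 0 (X \<epsilon>)"
    and \<mu>: "\<forall>\<epsilon>>0. time_average_limit M n (X \<epsilon>) (\<mu> \<epsilon>)"
  shows "\<forall>y_bar\<in>Hn n. \<forall>\<delta>>0. \<forall>\<gamma>>0. \<exists>\<epsilon>\<^sub>0>0. \<forall>\<epsilon>. 0 < \<epsilon> \<and> \<epsilon> \<le> \<epsilon>\<^sub>0 \<longrightarrow>
    measure (\<mu> \<epsilon>) {y \<in> Hn n. norm (y - y_bar) < \<delta>}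
      \<ge> exp_lower_bound (quasi_potential R F n y_bar) \<gamma> \<epsilon>"
proof (intro ballI allI impI)
  fix y_bar and \<delta> \<gamma> :: real
  assume y_bar: "y_bar \<in> Hn n" and "0 < \<delta>" "0 < \<gamma>"
  interpret prob_space M by (rule M)
  have R: "bounded_linear R" using R_sqrt_Q by (simp add: is_op_sqrt_def)
  have Lip: "norm (F u - F v) \<le> L_F * norm (u - v)" for u v using F_Lipschitz by blast
  have L: "0 \<le> L_F" using const_pos by simp
  have Fc: "continuous_on UNIV F" by (rule norm_lipschitz_continuous[OF Lip L])
  show "\<exists>\<epsilon>\<^sub>0>0. \<forall>\<epsilon>. 0 < \<epsilon> \<and> \<epsilon> \<le> \<epsilon>\<^sub>0 \<longrightarrow>
    measure (\<mu> \<epsilon>) {y \<in> Hn n. norm (y - y_bar) < \<delta>} \<ge> exp_lower_bound (quasi_potential R F n y_bar) \<gamma> \<epsilon>"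
  proof (cases "quasi_potential R F n y_bar = \<infinity>")
    case True
    then show ?thesis by (intro exI[of _ 1]) (simp add: exp_lower_bound_def)
  next
    case False
    then obtain V where V: "quasi_potential R F n y_bar = ereal V" "0 \<le> V"
      and "\<exists>T z \<psi>. 0 < T \<and> z T = y_bar \<and> \<psi> \<in> control_L2 n T \<and>
        skeleton_solution R F n T 0 \<psi> z \<and> control_energy T \<psi> < 2 * V + \<gamma>"
      using quasi_potential_finite \<open>0 < \<gamma>\<close> by metis
    then obtain T z \<psi> where T: "0 < T" "z T = y_bar" and \<psi>: "\<psi> \<in> control_L2 n T"
      and sk: "skeleton_solution R F n T 0 \<psi> z" and energy: "control_energy T \<psi> < 2 * V + \<gamma>"
      by blast
    define r where "r i k = coord k (R (e_basis i))" for i k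
    \<comment> \<open>Crude sums over all modes: \<open>v\<close> dominates the stationary variance
      of each coordinate and \<open>rs\<close> its absolute noise coefficients, so neither depends
      on k or on time.\<close>
    define v where "v = (\<Sum>k=1..n. \<Sum>i=1..n. (r i k)^2 / (2 * eigval k))"
    define rs where "rs = (\<Sum>k=1..n. \<Sum>i=1..n. \<bar>r i k\<bar>)"
    have lk: "0 \<le> eigval k" for k by (simp add: eigval_def)
    have v: "(\<Sum>i=1..n. (coord k (R (e_basis i)))^2 / (2 * eigval k)) \<le> v" if "k \<in> {1..n}" for k
      unfolding v_def r_def[symmetric]
      by (rule member_le_sum[OF that]) (auto intro!: sum_nonneg divide_nonneg_nonneg simp: lk)
    have rs: "(\<Sum>i=1..n. \<bar>coord k (R (e_basis i))\<bar>) \<le> rs" if "k \<in> {1..n}" for k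
      unfolding rs_def r_def[symmetric] by (rule member_le_sum[OF that]) (auto intro!: sum_nonneg)
    have rs0: "0 \<le> rs" unfolding rs_def by (intro sum_nonneg) auto
    define m where "m = 1 + L_F / (eigval 1 - L_F)"
    have m: "0 < m" using L L_F_less by (simp add: m_def add_pos_nonneg)
    have n0: "0 < real n" using n by simp
    define \<rho> where "\<rho> = \<delta> / 2"
    have \<rho>: "0 < \<rho>" "\<rho> < \<delta>" using \<open>0 < \<delta>\<close> by (auto simp: \<rho>_def)
    \<comment> \<open>24 = 3 * 8: the control error becomes at most \<rho>/8. Taking
      \<open>rs + 1\<close> avoids a division by zero.\<close>
    define \<tau> where "\<tau> = \<rho> / (24 * real n * (rs + 1) * m)"
    have \<tau>: "0 < \<tau>" using \<rho> rs0 m n0 by (simp add: \<tau>_def add_nonneg_pos)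
    \<comment> \<open>16 = 2 * 8: the fluctuation becomes at most \<rho>/8, so both errors together
      stay within the \<rho>/4 asked for by \<open>tilted_lower_bound\<close>.\<close>
    define \<epsilon>1 where "\<epsilon>1 = \<rho> / (16 * real n * exp (v / 2) * m)"
    have \<epsilon>1: "0 < \<epsilon>1" using \<rho> m n0 by (simp add: \<epsilon>1_def)
    \<comment> \<open>Dominates E/2 + 3, because E < 2 V + \<gamma>; unlike E it is fixed before s
      and the step control are chosen.\<close>
    define K where "K = V + \<gamma> / 2 + 3"
    have K: "0 < K" using V \<open>0 < \<gamma>\<close> by (simp add: K_def)
    \<comment> \<open>Ensures \<epsilon> (1 + K) \<le> \<gamma>/2: the half of \<gamma> not spent on
      the energy pays for the terms of lower order.\<close>
    define \<epsilon>2 where "\<epsilon>2 = (\<gamma> / 2) / (1 + K)"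
    have \<epsilon>2: "0 < \<epsilon>2" using K \<open>0 < \<gamma>\<close> by (simp add: \<epsilon>2_def)
    have small: "real n * (2 * \<epsilon> * exp (v / 2) + 3 * \<tau> * rs) * m \<le> \<rho> / 4" if "\<epsilon> \<le> \<epsilon>1" for \<epsilon>
    proof -
      have "real n * (2 * \<epsilon> * exp (v / 2)) * m \<le> real n * (2 * \<epsilon>1 * exp (v / 2)) * m"
        using that n0 m by (intro mult_right_mono mult_left_mono) auto
      also have "\<dots> = \<rho> / 8" using n0 m by (simp add: \<epsilon>1_def field_simps)
      finally have 1: "real n * (2 * \<epsilon> * exp (v / 2)) * m \<le> \<rho> / 8" .
      have "real n * (3 * \<tau> * rs) * m \<le> real n * (3 * \<tau> * (rs + 1)) * m"
        using n0 m \<tau> by (intro mult_right_mono mult_left_mono) auto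
      also have "\<dots> = \<rho> / 8" using n0 m rs0 by (simp add: \<tau>_def add_nonneg_eq_0_iff)
      finally have 2: "real n * (3 * \<tau> * rs) * m \<le> \<rho> / 8" .
      have "real n * (2 * \<epsilon> * exp (v / 2) + 3 * \<tau> * rs) * m
          = real n * (2 * \<epsilon> * exp (v / 2)) * m + real n * (3 * \<tau> * rs) * m" by (simp add: algebra_simps)
      with 1 2 show ?thesis by linarith
    qed
    have key: "exp (- (V + \<gamma>) / \<epsilon>^2) \<le> measure M {\<omega> \<in> space M. norm (X \<epsilon> s \<omega> - y_bar) < \<rho>}"
      if \<epsilon>: "0 < \<epsilon>" "\<epsilon> \<le> 1" "\<epsilon> \<le> \<epsilon>1" "\<epsilon> \<le> \<epsilon>2" and s: "T \<le> s" for \<epsilon> s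
    proof -
      have s0: "0 < s" using s T by simp
      have mild: "mild_solution M \<beta> R F n \<epsilon> 0 (X \<epsilon>)" using X \<epsilon> by blast
      obtain x f where x: "continuous_on {0..s} x" "x ` {0..s} \<subseteq> Hn n" "x s = z T"
        and f: "\<And>i. i \<in> {1..n} \<Longrightarrow> f i integrable_on {0..s}" "\<And>i. i \<in> {1..n} \<Longrightarrow> (\<lambda>u. (f i u)^2) integrable_on {0..s}"
        and fE: "(\<Sum>i=1..n. integral {0..s} (\<lambda>u. (f i u)^2)) = control_energy T \<psi>"
        and xf: "\<And>k t. k \<in> {1..n} \<Longrightarrow> t \<in> {0..s} \<Longrightarrow> coord k (x t) - conv_coord F x k t
      = (\<Sum>i=1..n. coord k (R (e_basis i)) * exp_conv (eigval k) (f i) t)"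
        by (rule skeleton_delay[OF R Fc F_zero \<psi> sk T(1) s]) blast
      define P where "P i q \<longleftrightarrow> wf_elem q \<and> (LINT u|lborel. (elem_fun q u)^2) \<le> integral {0..s} (\<lambda>u. (f i u)^2) \<and>
        elem_fun q integrable_on {0..s} \<and> (\<forall>t\<in>{0..s}. \<bar>integral {0..t} (f i) - integral {0..t} (elem_fun q)\<bar> \<le> \<tau>)" for i q
      have "\<exists>q. P i q" if "i \<in> {1..n}" for i
        by (rule step_control_approx[OF f(1)[OF that] f(2)[OF that] s0 \<tau>]) (auto simp: P_def)
      then have "\<forall>i\<in>{1..n}. \<exists>q. P i q" by blast
      then obtain qs where qs: "\<forall>i\<in>{1..n}. P i (qs i)" by (rule bchoice[THEN exE])
      have q: "wf_elem (qs i)" "elem_energy (qs i) \<le> integral {0..s} (\<lambda>u. (f i u)^2)"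
        "elem_fun (qs i) integrable_on {0..s}"
        "t \<in> {0..s} \<Longrightarrow> \<bar>integral {0..t} (f i) - integral {0..t} (elem_fun (qs i))\<bar> \<le> \<tau>" if "i \<in> {1..n}" for i t
        using qs that unfolding P_def by blast+
      define E where "E = (\<Sum>i=1..n. elem_energy (qs i))"
      have E: "E < 2 * V + \<gamma>"
        unfolding E_def using sum_mono[OF q(2), of "{1..n}" "\<lambda>i. i"] fE energy by simp
      define S where "S \<omega> = (\<Sum>i=1..n. elem_Wiener \<beta> i \<omega> (qs i))" for \<omega>
      have I: "finite {1..n}" "{1..n} \<subseteq> {1..}" by auto
      have "exp (- (E / (2 * \<epsilon>^2)) - (E / 2 + 3) / \<epsilon>) / 2 \<le> measure M {\<omega> \<in> space M. norm (X \<epsilon> s \<omega> - y_bar) < \<rho>}"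
      proof (rule tilted_lower_bound[where S=S and E=E and \<epsilon>=\<epsilon> and \<rho>=\<rho>])
        show "S \<in> borel_measurable M" unfolding S_def by (rule elem_int_sum_measurable[OF W I(2) q(1)])
        have "X \<epsilon> s \<in> M \<rightarrow>\<^sub>M borel"
          using mild s0 by (simp add: mild_solution_def measurable_restrict_space2_iff)
        then show "(\<lambda>\<omega>. norm (X \<epsilon> s \<omega> - y_bar)) \<in> borel_measurable M"
          by (rule measurable_compose) (intro borel_measurable_continuous_onI continuous_intros)
        show "nn_mean M (\<lambda>\<omega>. exp (b * S \<omega>)) = ennreal (exp (b^2 * E / 2))" for b
          unfolding S_def E_def by (rule elem_int_sum_mgf[OF W I q(1)])
        have "nn_mean M (\<lambda>\<omega>. exp (S \<omega> / \<epsilon> - E / (2 * \<epsilon>^2)) * norm (X \<epsilon> s \<omega> - x s))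
            \<le> ennreal (real n * (2 * \<epsilon> * exp (v / 2) + 3 * \<tau> * rs) * (1 + L_F / (eigval 1 - L_F)))"
          unfolding S_def E_def
          by (rule mild_tilted_distance[OF W Lip L L_F_less \<epsilon>(1) s0 mild x(1,2) xf f(1) q(1,3,4) v rs rs0])
            (use \<tau> in auto)
        also have "\<dots> \<le> ennreal (\<rho> / 4)" using small[OF \<epsilon>(3)] by (intro ennreal_leI) (simp add: m_def)
        finally show "nn_mean M (\<lambda>\<omega>. exp (S \<omega> / \<epsilon> - E / (2 * \<epsilon>^2)) * norm (X \<epsilon> s \<omega> - y_bar)) \<le> ennreal (\<rho> / 4)"
          by (simp add: x(3) T(2))
      qed (use \<epsilon> \<rho> in auto)
      \<comment> \<open>The energy term E/2 stays below V + \<gamma>/2. The factor 1/2 is absorbed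
        by exp(-1), whence the summand \<epsilon>^2, which \<epsilon> \<le> 1 bounds by
        \<epsilon>.\<close>
      moreover have "exp (- (V + \<gamma>) / \<epsilon>^2) \<le> exp (- (E / (2 * \<epsilon>^2)) - (E / 2 + 3) / \<epsilon>) / 2"
      proof -
        have "\<epsilon> * (1 + K) \<le> \<gamma> / 2" using \<epsilon>(4) K by (simp add: \<epsilon>2_def field_simps)
        moreover have "\<epsilon> * \<epsilon> \<le> \<epsilon> * 1" using \<epsilon> by (intro mult_left_mono) auto
        moreover have "\<epsilon> * (E / 2 + 3) \<le> \<epsilon> * K" using E \<epsilon> by (intro mult_left_mono) (auto simp: K_def)
        ultimately have "\<epsilon>^2 + \<epsilon> * (E / 2 + 3) + E / 2 \<le> V + \<gamma>"
          using E by (simp add: power2_eq_square distrib_left)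
        then have "(\<epsilon>^2 + \<epsilon> * (E / 2 + 3) + E / 2) / \<epsilon>^2 \<le> (V + \<gamma>) / \<epsilon>^2" by (rule divide_right_mono) simp
        moreover have "(\<epsilon>^2 + \<epsilon> * (E / 2 + 3) + E / 2) / \<epsilon>^2 = 1 + (E / 2 + 3) / \<epsilon> + E / (2 * \<epsilon>^2)"
          using \<epsilon> by (simp add: add_divide_distrib power2_eq_square)
        ultimately have "- (V + \<gamma>) / \<epsilon>^2 \<le> - 1 + (- (E / (2 * \<epsilon>^2)) - (E / 2 + 3) / \<epsilon>)"
          unfolding minus_divide_left[symmetric] by linarith
        then have "exp (- (V + \<gamma>) / \<epsilon>^2) \<le> exp (- 1 + (- (E / (2 * \<epsilon>^2)) - (E / 2 + 3) / \<epsilon>))" by simp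
        also have "\<dots> = exp (- 1) * exp (- (E / (2 * \<epsilon>^2)) - (E / 2 + 3) / \<epsilon>)" by (rule exp_add)
        also have "\<dots> \<le> (1 / 2) * exp (- (E / (2 * \<epsilon>^2)) - (E / 2 + 3) / \<epsilon>)"
        proof (rule mult_right_mono)
          have "2 \<le> exp (1::real)" using exp_ge_add_one_self[of 1] by simp
          then show "exp (- 1) \<le> (1 / 2 :: real)" by (simp add: exp_minus field_simps)
        qed simp
        finally show ?thesis by simp
      qed
      ultimately show ?thesis by linarith
    qed
    show ?thesis
    proof (intro exI[of _ "min 1 (min \<epsilon>1 \<epsilon>2)"] conjI allI impI)
      show "0 < min 1 (min \<epsilon>1 \<epsilon>2)" using \<epsilon>1 \<epsilon>2 by simp
      fix \<epsilon> assume "0 < \<epsilon> \<and> \<epsilon> \<le> min 1 (min \<epsilon>1 \<epsilon>2)"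
      then have \<epsilon>: "0 < \<epsilon>" "\<epsilon> \<le> 1" "\<epsilon> \<le> \<epsilon>1" "\<epsilon> \<le> \<epsilon>2" by auto
      have "X \<epsilon> s \<omega> \<in> Hn n" if "0 \<le> s" "\<omega> \<in> space M" for s \<omega>
        using X \<epsilon>(1) that measurable_space[of "X \<epsilon> s" M "borel_Hn n" \<omega>]
        by (auto simp: mild_solution_def space_restrict_space)
      then have "exp (- (V + \<gamma>) / \<epsilon>^2) \<le> measure (\<mu> \<epsilon>) {y \<in> Hn n. norm (y - y_bar) < \<delta>}"
        using \<mu> \<epsilon>(1) T(1) \<rho>(2) key[OF \<epsilon>]
        by (intro time_average_limit_lower_bound[OF M, where T=T and \<rho>=\<rho> and X="X \<epsilon>"]) auto
      then show "measure (\<mu> \<epsilon>) {y \<in> Hn n. norm (y - y_bar) < \<delta>} \<ge> exp_lower_bound (quasi_potential R F n y_bar) \<gamma> \<epsilon>"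
        by (simp add: exp_lower_bound_def V)
    qed
  qed
qed

end
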